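(* Let $\kappa$ be a bounded probability density on $[0,1]^d$ and let $\rho\in(0,\infty)$. Consider the Čech or the Vietoris-Rips filtration. There is a constant $C_{0,\kappa}\in(0,\infty)$, depending on $\kappa$ and $\rho$ (and on $d,T$) but not on $\nu\in B_\infty(\kappa,\rho)$ and not on $n$, such that for every $\nu\in B_\infty(\kappa,\rho)$ and every $n\in\mathbb{N}$ there are coupled Poisson processes $(\mathcal{P}_n,\mathcal{Q}_n)$ with intensity functions $(n\kappa,n\nu)$ and coupled binomial processes $(\mathbb{X}_n,\mathbb{Y}_n)$ of length $n$ with densities $(\kappa,\nu)$, respectively, for which, in the Poisson sampling scheme (with $\overline{\chi}_{\kappa,n}$ built from $\mathcal{P}_n$ and $\overline{\chi}_{\nu,n}$ from $\mathcal{Q}_n$) as well as in the binomial sampling scheme (with $\overline{\chi}_{\kappa,n}$ built from $\mathbb{X}_n$ and $\overline{\chi}_{\nu,n}$ from $\mathbb{Y}_n$), $$\sup_{t\in[0,T]}\operatorname{Var}\big(\overline{\chi}_{\kappa,n}(t)-\overline{\chi}_{\nu,n}(t)\big)\le C_{0,\kappa}\,\|\kappa-\nu\|_\infty .$$ In particular, $$\sup_{t\in[0,T]} d_W\big(\overline{\chi}_{\kappa,n}(t),\overline{\chi}_{\nu,n}(t)\big)\le \sqrt{C_{0,\kappa}}\;\|\kappa-\nu\|_\infty^{1/2}.$$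
   Context: For a finite set $P\subset\mathbb{R}^d$ and $t\ge 0$, the Čech complex is $\mathcal{C}_t(P)=\{\emptyset\ne\sigma\subseteq P:\bigcap_{x\in\sigma}B(x,t)\ne\emptyset\}$, where $B(x,t)$ is the closed Euclidean ball, and the Vietoris-Rips complex is $\mathcal{R}_t(P)=\{\emptyset\ne\sigma\subseteq P:\operatorname{diam}(\sigma)\le t\}$. $\mathcal{K}_t$ denotes either one of these (the choice being fixed). A simplex $\sigma$ has dimension $\#\sigma-1$. The Euler characteristic of a finite simplicial complex $\mathcal{K}$ is $\chi(\mathcal{K})=\sum_{k\ge0}(-1)^k\#\{\sigma\in\mathcal{K}:\dim\sigma=k\}$. Fix $T\in(0,\infty)$. For a density $\kappa$ on $[0,1]^d$ and $n\in\mathbb{N}$, a Poisson process with intensity $n\kappa$ is denoted $\mathcal{P}_n$, and a binomial process of length $n$ with density $\kappa$ is $\mathbb{X}_n=\{X_1,\dots,X_n\}$ with $X_i$ i.i.d. with density $\kappa$. Put $\mathcal{K}_{t,n}=\mathcal{K}_t(n^{1/d}\mathcal{P}_n)$ in the Poisson sampling scheme and $\mathcal{K}_{t,n}=\mathcal{K}_t(n^{1/d}\mathbb{X}_n)$ in the binomial sampling scheme, and $$\overline{\chi}_{\kappa,n}(t)=n^{-1/2}\big(\chi(\mathcal{K}_{t,n})-\mathbb{E}[\chi(\mathcal{K}_{t,n})]\big),\quad t\in[0,T].$$ $\overline{\chi}_{\nu,n}$ is defined in the same way with the density $\nu$. A coupling means a construction on a common probability space with the prescribed marginal laws. $B_\infty(\kappa,\rho)$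 is the class of all probability densities $\nu$ on $[0,1]^d$ with $\|\kappa-\nu\|_\infty\le\rho$ (sup-norm). $d_W(Z_1,Z_2)$ is the Kantorovich-Wasserstein distance between the laws $\mu_1,\mu_2$ on $\mathbb{R}$ of $Z_1,Z_2$: $d_W(\mu_1,\mu_2)=\sup\{|\int f\,d\mu_1-\int f\,d\mu_2|: f:\mathbb{R}\to\mathbb{R}\text{ Lipschitz with constant}\le1\}$. *)

theory Defs
  imports "HOL-Probability.Probability"
begin

section \<open>Simplicial complexes and the Euler characteristic\<close>

definition cech_complex :: "real \<Rightarrow> (real^'d) set \<Rightarrow> (real^'d) set set" where
  "cech_complex t P = {\<sigma>. \<sigma> \<noteq> {} \<and> \<sigma> \<subseteq> P \<and> (\<Inter>x\<in>\<sigma>. cball x t) \<noteq> {}}"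

definition rips_complex :: "real \<Rightarrow> (real^'d) set \<Rightarrow> (real^'d) set set" where
  "rips_complex t P = {\<sigma>. \<sigma> \<noteq> {} \<and> \<sigma> \<subseteq> P \<and> diameter \<sigma> \<le> t}"

text \<open>Simplices are nonempty finite sets, so the truncated subtraction is harmless.\<close>

definition simplex_dim :: "'a set \<Rightarrow> nat" where
  "simplex_dim \<sigma> = card \<sigma> - 1"

text \<open>The sum over all \<open>k \<ge> 0\<close> is restricted to the finitely many dimensions attained in
  \<open>K\<close>; every other summand vanishes.\<close>

definition euler_char :: "'a set set \<Rightarrow> int" where
  "euler_char K = (\<Sum>k\<in>simplex_dim ` K. (-1) ^ k * int (card {\<sigma> \<in> K. simplex_dim \<sigma> = k}))"


section \<open>Densities on the unit cube\<close>

abbreviation unit_cube :: "(real^'d) set" where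
  "unit_cube \<equiv> cbox 0 1"

text \<open>A density on the cube is represented by its extension by zero to the whole space.\<close>

definition cube_densities :: "(real^'d \<Rightarrow> real) set" where
  "cube_densities = {f. f \<in> borel_measurable borel \<and> (\<forall>x. 0 \<le> f x) \<and>
     (\<forall>x. x \<notin> unit_cube \<longrightarrow> f x = 0) \<and> (\<integral>\<^sup>+x. ennreal (f x) \<partial>lborel) = 1}"

definition sup_norm :: "(real^'d \<Rightarrow> real) \<Rightarrow> real" where
  "sup_norm f = (SUP x\<in>unit_cube. \<bar>f x\<bar>)"

text \<open>The boundedness condition says that the real-valued supremum is a genuine one, i.e. that
  the sup-norm is finite.\<close>

definition density_ball :: "(real^'d \<Rightarrow> real) \<Rightarrow> real \<Rightarrow> (real^'d \<Rightarrow> real) set" where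
  "density_ball \<kappa> \<rho> = {\<nu> \<in> cube_densities.
     bdd_above ((\<lambda>x. \<bar>\<kappa> x - \<nu> x\<bar>) ` unit_cube) \<and> sup_norm (\<lambda>x. \<kappa> x - \<nu> x) \<le> \<rho>}"


section \<open>Point processes\<close>

text \<open>Poisson process on \<open>M\<close> with integrable intensity function \<open>f\<close>, as a random finite set:
  since the intensity measure has no atoms, such a process has almost surely no multiple points.
  The counts of Borel sets are Poisson distributed, and those of disjoint sets are independent;
  \<open>indep_vars\<close> includes the measurability of the counts. Finite disjoint families are covered by
  padding with empty sets. The probabilities are written out, with \<open>0 ^ 0 = 1\<close>, because
  \<open>poisson_pmf\<close> is not available for the rate \<open>0\<close>.\<close>

definition poisson_process ::
    "'w measure \<Rightarrow> (real^'d \<Rightarrow> real) \<Rightarrow> ('w \<Rightarrow> (real^'d) set) \<Rightarrow> bool" where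
  "poisson_process M f P \<longleftrightarrow>
     prob_space M \<and>
     (\<forall>\<omega>\<in>space M. finite (P \<omega>)) \<and>
     (\<forall>B\<in>sets borel. \<forall>k::nat.
        measure M {\<omega> \<in> space M. card (P \<omega> \<inter> B) = k} =
          exp (- (LINT x:B|lborel. f x)) * (LINT x:B|lborel. f x) ^ k / fact k) \<and>
     (\<forall>A::nat \<Rightarrow> (real^'d) set. range A \<subseteq> sets borel \<and> disjoint_family A \<longrightarrow>
        prob_space.indep_vars M (\<lambda>_. count_space UNIV) (\<lambda>i \<omega>. card (P \<omega> \<inter> A i)) UNIV)"

definition iid_sample ::
    "'w measure \<Rightarrow> nat \<Rightarrow> (real^'d \<Rightarrow> real) \<Rightarrow> (nat \<Rightarrow> 'w \<Rightarrow> real^'d) \<Rightarrow> bool" where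
  "iid_sample M n f X \<longleftrightarrow>
     prob_space M \<and>
     prob_space.indep_vars M (\<lambda>_. borel) X {1..n} \<and>
     (\<forall>i\<in>{1..n}. distributed M lborel (X i) (\<lambda>x. ennreal (f x)))"

definition point_set :: "nat \<Rightarrow> (nat \<Rightarrow> 'w \<Rightarrow> real^'d) \<Rightarrow> 'w \<Rightarrow> (real^'d) set" where
  "point_set n X \<omega> = (\<lambda>i. X i \<omega>) ` {1..n}"


section \<open>The normalized Euler characteristic and the Wasserstein distance\<close>

definition rescale :: "nat \<Rightarrow> (real^'d) set \<Rightarrow> (real^'d) set" where
  "rescale n P = (\<lambda>x. (real n powr (1 / real CARD('d))) *\<^sub>R x) ` P"

definition chi ::
    "(real \<Rightarrow> (real^'d) set \<Rightarrow> (real^'d) set set) \<Rightarrow> nat \<Rightarrow> ('w \<Rightarrow> (real^'d) set) \<Rightarrow> real \<Rightarrow> 'w \<Rightarrow> real"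
  where "chi K n P t \<omega> = of_int (euler_char (K t (rescale n (P \<omega>))))"

definition chi_bar ::
    "'w measure \<Rightarrow> (real \<Rightarrow> (real^'d) set \<Rightarrow> (real^'d) set set) \<Rightarrow> nat \<Rightarrow> ('w \<Rightarrow> (real^'d) set) \<Rightarrow>
     real \<Rightarrow> 'w \<Rightarrow> real"
  where "chi_bar M K n P t \<omega> =
    real n powr (- 1 / 2) * (chi K n P t \<omega> - prob_space.expectation M (chi K n P t))"

text \<open>Used to assert that expectations and variances below are genuine ones, and not the default
  value \<open>0\<close> of the Bochner integral of a non-integrable function.\<close>

definition square_integrable :: "'w measure \<Rightarrow> ('w \<Rightarrow> real) \<Rightarrow> bool" where
  "square_integrable M Z \<longleftrightarrow> Z \<in> borel_measurable M \<and> integrable M (\<lambda>\<omega>. (Z \<omega>)\<^sup>2)"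

definition wasserstein :: "real measure \<Rightarrow> real measure \<Rightarrow> ereal" where
  "wasserstein \<mu>\<^sub>1 \<mu>\<^sub>2 =
     (SUP f\<in>{f::real \<Rightarrow> real. 1-lipschitz_on UNIV f}. ereal \<bar>(\<integral>x. f x \<partial>\<mu>\<^sub>1) - (\<integral>x. f x \<partial>\<mu>\<^sub>2)\<bar>)"

text \<open>Sample space carrying the couplings: a counter together with a sequence of pairs of points.
  HOL cannot quantify existentially over types, so the type of the sample space has to be fixed;
  the measure and its sigma-algebra remain free.\<close>

type_synonym 'd sample = "nat \<times> (nat \<Rightarrow> (real^'d) \<times> (real^'d))"

end

theory Submission
  imports Defs
begin

text \<open>
  The processes are coupled through a maximal coupling \<open>J\<close> of \<open>\<kappa>\<close> and \<open>\<nu>\<close>: a pair \<open>(x, y)\<close>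
  with marginal densities \<open>\<kappa>\<close> and \<open>\<nu>\<close> for which \<open>x \<noteq> y\<close> has probability at most
  the sup-norm \<open>\<delta>\<close> of \<open>\<kappa> - \<nu>\<close>, and for which the event that moreover \<open>x\<close> or \<open>y\<close> lies in a given
  set \<open>B\<close> has probability at most a constant times \<open>\<delta> vol B\<close>
  (lemma \<open>density_ball_coupling\<close>). Take independent pairs from \<open>J\<close>. The first \<open>n\<close> of them give the two binomial samples. Since both intensities have total mass
  \<open>n\<close>, the first \<open>N\<close> of them, for an independent Poisson variable \<open>N\<close> of mean \<open>n\<close>, give the two
  Poisson processes (lemma \<open>poisson_process_points\<close>).

  Adding a point \<open>x\<close> to a configuration changes the Euler characteristic by the signed number of
  simplices that contain \<open>x\<close>. This number depends only on the points at distance at most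
  \<open>r = 2 T n powr (- 1 / d)\<close> from \<open>x\<close>, and it is at most \<open>2\<close> to the number of these points
  (lemma \<open>local_functional_euler_char\<close>). Let \<open>D\<close> be the difference of the Euler
  characteristics of the two coupled configurations. When one pair \<open>(x, y)\<close> is added, \<open>D\<close> can change only if
  \<open>x \<noteq> y\<close>, which has probability at most \<open>\<delta>\<close>, or if one of the other pairs is split and near
  \<open>x\<close>, which for each of them has probability of order \<open>\<delta> / n\<close>. The number of points near \<open>x\<close>
  is dominated by a binomial variable of bounded mean and so has bounded exponential moments.
  Hence the squared increment of \<open>D\<close> has expectation of order \<open>\<delta>\<close>
  (lemma \<open>F_insert_moment\<close>).

  For a fixed number \<open>k\<close> of pairs, the Efron-Stein inequality turns this into a bound of order
  \<open>\<delta> k\<close> for the variance of \<open>D\<close>. The same increment bound says that the mean of \<open>D\<close> moves by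
  \<open>O(sqrt \<delta>)\<close> when \<open>k\<close> grows by one, so that it contributes at most a term of order
  \<open>\<delta> (k - n)\<^sup>2\<close> to the second moment of \<open>D\<close> about its mean for \<open>n\<close> pairs
  (lemma \<open>F_second_moment\<close>). Both terms carry factors \<open>(1 + c / n) ^ k\<close>, and averaging over
  \<open>k = n\<close> or over a Poisson variable \<open>k\<close> of mean \<open>n\<close> gives a total of order \<open>\<delta> n\<close>. After division
  by \<open>n\<close> this is the variance bound. The two normalized characteristics are centred, so the
  variance bounds the mean square of their difference, and the Cauchy-Schwarz inequality bounds
  the Wasserstein distance by its square root.
\<close>

section \<open>Locality of the Euler characteristic\<close>

lemma euler_char_eq_sum:
  assumes "finite K"
  shows "euler_char K = (\<Sum>\<sigma>\<in>K. (-1) ^ simplex_dim \<sigma>)"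
proof -
  have "(\<Sum>\<sigma>\<in>K. (-1::int) ^ simplex_dim \<sigma>)
      = (\<Sum>k\<in>simplex_dim ` K. \<Sum>\<sigma>\<in>{\<sigma>\<in>K. simplex_dim \<sigma> = k}. (-1) ^ simplex_dim \<sigma>)"
    by (rule sum.image_gen[OF assms])
  also have "\<dots> = euler_char K"
    unfolding euler_char_def by (intro sum.cong) (auto simp: mult.commute)
  finally show ?thesis ..
qed

text \<open>Both complexes consist of the nonempty subsets of the point set that satisfy a condition on the
  subset alone. Only this common form matters for the combinatorics below.\<close>

definition complex_of :: "('a set \<Rightarrow> bool) \<Rightarrow> 'a set \<Rightarrow> 'a set set" where
  "complex_of s S = {\<sigma>. \<sigma> \<noteq> {} \<and> \<sigma> \<subseteq> S \<and> s \<sigma>}"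

lemma finite_complex_of: "finite S \<Longrightarrow> finite (complex_of s S)"
  by (rule finite_subset[of _ "Pow S"]) (auto simp: complex_of_def)

text \<open>The new simplices are exactly those that contain the new vertex.\<close>

lemma euler_char_complex_of_insert:
  assumes "finite S" "x \<notin> S"
  shows "euler_char (complex_of s (insert x S)) - euler_char (complex_of s S)
       = (\<Sum>\<sigma>\<in>{\<sigma>. x \<in> \<sigma> \<and> \<sigma> \<subseteq> insert x S \<and> s \<sigma>}. (-1) ^ simplex_dim \<sigma>)"
proof -
  have split: "complex_of s (insert x S)
      = complex_of s S \<union> {\<sigma>. x \<in> \<sigma> \<and> \<sigma> \<subseteq> insert x S \<and> s \<sigma>}"
    by (auto simp: complex_of_def)
  have fin: "finite {\<sigma>. x \<in> \<sigma> \<and> \<sigma> \<subseteq> insert x S \<and> s \<sigma>}"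
    by (rule finite_subset[of _ "Pow (insert x S)"]) (use assms in auto)
  have disj: "complex_of s S \<inter> {\<sigma>. x \<in> \<sigma> \<and> \<sigma> \<subseteq> insert x S \<and> s \<sigma>} = {}"
    using assms by (auto simp: complex_of_def)
  have "euler_char (complex_of s (insert x S))
      = (\<Sum>\<sigma>\<in>complex_of s (insert x S). (-1) ^ simplex_dim \<sigma>)"
    using assms by (intro euler_char_eq_sum finite_complex_of) auto
  also have "\<dots> = (\<Sum>\<sigma>\<in>complex_of s S. (-1) ^ simplex_dim \<sigma>)
      + (\<Sum>\<sigma>\<in>{\<sigma>. x \<in> \<sigma> \<and> \<sigma> \<subseteq> insert x S \<and> s \<sigma>}. (-1) ^ simplex_dim \<sigma>)"
    unfolding split by (rule sum.union_disjoint) (use assms fin disj in \<open>auto intro: finite_complex_of\<close>)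
  finally show ?thesis
    using euler_char_eq_sum[OF finite_complex_of[OF assms(1)], of s] by simp
qed

text \<open>The two properties of the Euler characteristic on which the probabilistic part rests: the
  effect of adding a point is determined by the points within distance \<open>r\<close>, and it is at most
  exponential in their number.\<close>

definition local_functional :: "real \<Rightarrow> ((real^'d) set \<Rightarrow> real) \<Rightarrow> bool" where
  "local_functional r \<phi> \<longleftrightarrow> \<phi> {} = 0 \<and> (\<forall>S x. finite S \<longrightarrow>
     \<phi> (insert x S) - \<phi> S = \<phi> (insert x (S \<inter> cball x r)) - \<phi> (S \<inter> cball x r) \<and>
     \<bar>\<phi> (insert x S) - \<phi> S\<bar> \<le> 2 ^ card (S \<inter> cball x r))"

lemma local_functionalD:
  assumes "local_functional r \<phi>" "finite S"
  shows "\<phi> (insert x S) - \<phi> S = \<phi> (insert x (S \<inter> cball x r)) - \<phi> (S \<inter> cball x r) \<and>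
    \<bar>\<phi> (insert x S) - \<phi> S\<bar> \<le> 2 ^ card (S \<inter> cball x r)"
  using conjunct2[OF assms(1)[unfolded local_functional_def],
      THEN spec, THEN spec, THEN mp, OF assms(2)] .

lemma local_functional_empty: "local_functional r \<phi> \<Longrightarrow> \<phi> {} = 0"
  unfolding local_functional_def by (rule conjunct1)

text \<open>A simplex that contains \<open>x\<close> lies in the ball of radius \<open>r\<close> about \<open>x\<close>, so it is one of the
  sets \<open>insert x A\<close> with \<open>A\<close> a set of points in that ball.\<close>

lemma local_functional_complex_of:
  fixes s :: "(real^'d) set \<Rightarrow> bool"
  assumes r: "0 \<le> r"
    and s: "\<And>\<sigma> x y. finite \<sigma> \<Longrightarrow> s \<sigma> \<Longrightarrow> x \<in> \<sigma> \<Longrightarrow> y \<in> \<sigma> \<Longrightarrow> dist x y \<le> r"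
  shows "local_functional r (\<lambda>S. of_int (euler_char (complex_of s S)))"
  unfolding local_functional_def
proof (intro conjI allI impI)
  have "complex_of s {} = {}" by (auto simp: complex_of_def)
  then show "real_of_int (euler_char (complex_of s {})) = 0"
    by (simp add: euler_char_def)
next
  fix S :: "(real^'d) set" and x assume S: "finite S"
  let ?\<chi> = "\<lambda>S. euler_char (complex_of s S)"
  let ?N = "\<lambda>S. {\<sigma>. x \<in> \<sigma> \<and> \<sigma> \<subseteq> insert x S \<and> s \<sigma>}"
  let ?B = "S \<inter> cball x r"
  have N: "?N S = ?N ?B"
  proof (intro set_eqI iffI)
    fix \<sigma> assume \<sigma>: "\<sigma> \<in> ?N S"
    then have "finite \<sigma>" using S by (auto intro: finite_subset[of _ "insert x S"])
    then have "dist x y \<le> r" if "y \<in> \<sigma>" for y using s \<sigma> that by auto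
    then show "\<sigma> \<in> ?N ?B" using \<sigma> by auto
  qed auto
  have *: "?\<chi> (insert x S) - ?\<chi> S = ?\<chi> (insert x ?B) - ?\<chi> ?B
      \<and> \<bar>?\<chi> (insert x S) - ?\<chi> S\<bar> \<le> 2 ^ card ?B"
  proof (cases "x \<in> S")
    case False
    have eq: "?\<chi> (insert x S) - ?\<chi> S = (\<Sum>\<sigma>\<in>?N ?B. (-1) ^ simplex_dim \<sigma>)"
      using euler_char_complex_of_insert[OF S False] N by simp
    moreover have "?\<chi> (insert x ?B) - ?\<chi> ?B = (\<Sum>\<sigma>\<in>?N ?B. (-1) ^ simplex_dim \<sigma>)"
      by (rule euler_char_complex_of_insert) (use S False in auto)
    moreover have "\<bar>\<Sum>\<sigma>\<in>?N ?B. (-1::int) ^ simplex_dim \<sigma>\<bar> \<le> 2 ^ card ?B"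
    proof -
      have "\<bar>\<Sum>\<sigma>\<in>?N ?B. (-1::int) ^ simplex_dim \<sigma>\<bar> \<le> (\<Sum>\<sigma>\<in>?N ?B. \<bar>(-1::int) ^ simplex_dim \<sigma>\<bar>)"
        by (rule sum_abs)
      also have "\<dots> = int (card (?N ?B))" by (simp add: power_abs)
      also have "card (?N ?B) \<le> card (insert x ` Pow ?B)"
      proof (rule card_mono)
        show "finite (insert x ` Pow ?B)" using S by simp
        show "?N ?B \<subseteq> insert x ` Pow ?B"
        proof
          fix \<sigma> assume \<sigma>: "\<sigma> \<in> ?N ?B"
          then have "\<sigma> = insert x (\<sigma> - {x})" "\<sigma> - {x} \<in> Pow ?B" by auto
          then show "\<sigma> \<in> insert x ` Pow ?B" by blast
        qed
      qed
      also have "card (insert x ` Pow ?B) \<le> card (Pow ?B)" by (rule card_image_le) (use S in simp)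
      also have "\<dots> = 2 ^ card ?B" by (rule card_Pow) (use S in simp)
      finally show ?thesis by simp
    qed
    ultimately show ?thesis by simp
  next
    case True
    then have "insert x S = S" "insert x ?B = ?B" using r by auto
    then show ?thesis by simp
  qed
  show "real_of_int (?\<chi> (insert x S)) - ?\<chi> S = real_of_int (?\<chi> (insert x ?B)) - ?\<chi> ?B"
    using conjunct1[OF *] by linarith
  have "\<bar>?\<chi> (insert x S) - ?\<chi> S\<bar> \<le> 2 ^ card ?B" using * by blast
  then have "real_of_int \<bar>?\<chi> (insert x S) - ?\<chi> S\<bar> \<le> real_of_int (2 ^ card ?B)"
    by (simp only: of_int_le_iff)
  then show "\<bar>real_of_int (?\<chi> (insert x S)) - ?\<chi> S\<bar> \<le> 2 ^ card ?B" by simp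
qed

lemma local_functional_scale:
  fixes \<phi> :: "(real^'d) set \<Rightarrow> real"
  assumes \<phi>: "local_functional r \<phi>" and a: "a > 0"
  shows "local_functional (r / a) (\<lambda>S. \<phi> ((\<lambda>x. a *\<^sub>R x) ` S))"
  unfolding local_functional_def
proof (intro conjI allI impI)
  show "\<phi> ((*\<^sub>R) a ` {}) = 0" using local_functional_empty[OF \<phi>] by simp
  fix S :: "(real^'d) set" and x assume S: "finite S"
  have ball: "(\<lambda>x. a *\<^sub>R x) ` S \<inter> cball (a *\<^sub>R x) r = (\<lambda>x. a *\<^sub>R x) ` (S \<inter> cball x (r / a))"
  proof -
    have "dist (a *\<^sub>R x) (a *\<^sub>R y) \<le> r \<longleftrightarrow> dist x y \<le> r / a" for y
    proof -
      have "dist (a *\<^sub>R x) (a *\<^sub>R y) = a * dist x y"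
        using a by (simp add: dist_norm flip: scaleR_diff_right)
      then show ?thesis using a by (simp add: field_simps)
    qed
    then show ?thesis by auto
  qed
  have card: "card ((\<lambda>x. a *\<^sub>R x) ` A) = card A" for A :: "(real^'d) set"
    by (rule card_image) (use a in \<open>auto simp: inj_on_def\<close>)
  have "finite ((\<lambda>x. a *\<^sub>R x) ` S)" using S by simp
  note local_functionalD[OF \<phi> this, of "a *\<^sub>R x"]
  note * = this[unfolded ball card]
  show "\<phi> ((*\<^sub>R) a ` insert x S) - \<phi> ((*\<^sub>R) a ` S) =
           \<phi> ((*\<^sub>R) a ` insert x (S \<inter> cball x (r / a))) - \<phi> ((*\<^sub>R) a ` (S \<inter> cball x (r / a)))"
    using conjunct1[OF *] by (simp only: image_insert)
  show "\<bar>\<phi> ((*\<^sub>R) a ` insert x S) - \<phi> ((*\<^sub>R) a ` S)\<bar> \<le> 2 ^ card (S \<inter> cball x (r / a))"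
    using conjunct2[OF *] by (simp only: image_insert)
qed

lemma local_functional_bound:
  assumes \<phi>: "local_functional r \<phi>" and "finite S"
  shows "\<bar>\<phi> S\<bar> \<le> 2 ^ card S"
proof -
  have "\<bar>\<phi> S\<bar> \<le> 2 ^ card S - 1"
    using assms(2)
  proof (induction S)
    case empty
    then show ?case using local_functional_empty[OF \<phi>] by simp
  next
    case (insert x S)
    have "\<bar>\<phi> (insert x S) - \<phi> S\<bar> \<le> 2 ^ card (S \<inter> cball x r)"
      using local_functionalD[OF \<phi> insert(1)] by blast
    also have "\<dots> \<le> 2 ^ card S"
      using insert by (intro power_increasing card_mono) auto
    finally show ?case using insert by simp
  qed
  then show ?thesis by simp
qed

text \<open>A sample may contain a point several times. The indices at which a point occurs for the first
  time represent the set of points without repetition, and whether an index is of this kind is a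
  condition on finitely many coordinates. This makes functions of the random set measurable.\<close>

lemma inj_on_first_occurrences:
  fixes I :: "nat set"
  shows "inj_on f {j\<in>I. \<forall>i\<in>I. i < j \<longrightarrow> f i \<noteq> f j}"
  unfolding inj_on_def by (metis (mono_tags, lifting) mem_Collect_eq linorder_neqE_nat)

lemma image_first_occurrences:
  fixes I :: "nat set"
  shows "f ` {j\<in>I. \<forall>i\<in>I. i < j \<longrightarrow> f i \<noteq> f j} = f ` I" (is "f ` ?R = _")
proof
  show "f ` I \<subseteq> f ` ?R"
  proof
    fix y assume "y \<in> f ` I"
    then obtain i where i: "i \<in> I" "f i = y" by auto
    define j where "j = (LEAST i. i \<in> I \<and> f i = y)"
    have "j \<in> I \<and> f j = y" unfolding j_def by (rule LeastI[of _ i]) (use i in auto)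
    moreover have "f k \<noteq> f j" if "k \<in> I" "k < j" for k
      using not_less_Least[of k "\<lambda>i. i \<in> I \<and> f i = y"] that calculation unfolding j_def by auto
    ultimately show "y \<in> f ` ?R" by auto
  qed
qed auto

lemma euler_char_complex_of_image:
  fixes f :: "nat \<Rightarrow> 'a"
  assumes I: "finite I"
  shows "euler_char (complex_of s (f ` I)) = (\<Sum>J\<in>Pow I - {{}}.
    if (\<forall>j\<in>J. \<forall>i\<in>I. i < j \<longrightarrow> f i \<noteq> f j) \<and> s (f ` J) then (-1) ^ (card J - 1) else 0)"
proof -
  define R where "R = {j\<in>I. \<forall>i\<in>I. i < j \<longrightarrow> f i \<noteq> f j}"
  note inj = inj_on_first_occurrences[of f I, folded R_def]
  note img = image_first_occurrences[of f I, folded R_def]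
  have "finite R" using I by (auto simp: R_def)
  have "bij_betw (image f) {J\<in>Pow R - {{}}. s (f ` J)} (complex_of s (f ` R))"
  proof (rule bij_betw_imageI)
    show "inj_on ((`) f) {J \<in> Pow R - {{}}. s (f ` J)}"
      by (rule inj_on_subset[OF inj_on_image_Pow[OF inj]]) auto
    show "(`) f ` {J \<in> Pow R - {{}}. s (f ` J)} = complex_of s (f ` R)"
      by (auto simp: complex_of_def subset_image_iff)
  qed
  then have "(\<Sum>\<sigma>\<in>complex_of s (f ` R). (-1) ^ simplex_dim \<sigma>)
      = (\<Sum>J\<in>{J\<in>Pow R - {{}}. s (f ` J)}. (-1::int) ^ simplex_dim (f ` J))"
    by (rule sum.reindex_bij_betw[symmetric])
  then have "euler_char (complex_of s (f ` I))
      = (\<Sum>J\<in>{J\<in>Pow R - {{}}. s (f ` J)}. (-1) ^ simplex_dim (f ` J))"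
    using I img euler_char_eq_sum[OF finite_complex_of[of "f ` I" s]] by simp
  also have "\<dots> = (\<Sum>J\<in>{J\<in>Pow R - {{}}. s (f ` J)}. (-1) ^ (card J - 1))"
    by (intro sum.cong) (auto simp: simplex_dim_def card_image[OF inj_on_subset[OF inj]])
  also have "\<dots> = (\<Sum>J\<in>Pow I - {{}}.
    if (\<forall>j\<in>J. \<forall>i\<in>I. i < j \<longrightarrow> f i \<noteq> f j) \<and> s (f ` J) then (-1) ^ (card J - 1) else 0)"
    using I by (intro sum.mono_neutral_cong_left) (auto simp: R_def)
  finally show ?thesis .
qed

lemma measurable_euler_char_complex_of:
  fixes f :: "nat \<Rightarrow> 'w \<Rightarrow> real^'d"
  assumes I: "finite I" and f: "\<And>i. i \<in> I \<Longrightarrow> f i \<in> borel_measurable M"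
    and s: "\<And>J. J \<subseteq> I \<Longrightarrow> J \<noteq> {} \<Longrightarrow> Measurable.pred M (\<lambda>w. s ((\<lambda>i. f i w) ` J))"
  shows "(\<lambda>w. real_of_int (euler_char (complex_of s ((\<lambda>i. f i w) ` I)))) \<in> borel_measurable M"
proof -
  have "Measurable.pred M (\<lambda>w. (\<forall>j\<in>J. \<forall>i\<in>I. i < j \<longrightarrow> f i w \<noteq> f j w) \<and> s ((\<lambda>i. f i w) ` J))"
    if J: "J \<in> Pow I - {{}}" for J
  proof -
    have "Measurable.pred M (\<lambda>w. \<forall>j\<in>J. \<forall>i\<in>I. i < j \<longrightarrow> f i w \<noteq> f j w)"
    proof (intro pred_intros_finite)
      fix i j assume "j \<in> J" "i \<in> I"
      then have [measurable]: "f i \<in> borel_measurable M" "f j \<in> borel_measurable M" using J f by auto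
      show "Measurable.pred M (\<lambda>w. i < j \<longrightarrow> f i w \<noteq> f j w)" by measurable
    qed (use I J finite_subset in auto)
    moreover have "Measurable.pred M (\<lambda>w. s ((\<lambda>i. f i w) ` J))" by (rule s) (use J in auto)
    ultimately show ?thesis by (rule pred_intros_logic(3))
  qed
  then have "(\<lambda>w. if (\<forall>j\<in>J. \<forall>i\<in>I. i < j \<longrightarrow> f i w \<noteq> f j w) \<and> s ((\<lambda>i. f i w) ` J)
      then (-1::real) ^ (card J - 1) else 0) \<in> borel_measurable M" if "J \<in> Pow I - {{}}" for J
    using that unfolding pred_def by (intro measurable_If borel_measurable_const)
  then have "(\<lambda>w. \<Sum>J\<in>Pow I - {{}}.
      if (\<forall>j\<in>J. \<forall>i\<in>I. i < j \<longrightarrow> f i w \<noteq> f j w) \<and> s ((\<lambda>i. f i w) ` J)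
      then (-1::real) ^ (card J - 1) else 0) \<in> borel_measurable M"
    by (rule borel_measurable_sum)
  also have "(\<lambda>w. \<Sum>J\<in>Pow I - {{}}.
      if (\<forall>j\<in>J. \<forall>i\<in>I. i < j \<longrightarrow> f i w \<noteq> f j w) \<and> s ((\<lambda>i. f i w) ` J)
      then (-1::real) ^ (card J - 1) else 0)
    = (\<lambda>w. real_of_int (euler_char (complex_of s ((\<lambda>i. f i w) ` I))))"
    unfolding euler_char_complex_of_image[OF I] of_int_sum
    by (intro ext sum.cong refl) simp
  finally show ?thesis .
qed

text \<open>The condition quantifies over all points of space. By compactness it suffices that the slightly
  enlarged balls have a common point in a countable dense set, and this form is measurable.\<close>

lemma cech_condition_approx:
  fixes x :: "'i \<Rightarrow> real^'d"
  assumes d: "\<And>U. open U \<Longrightarrow> U \<noteq> {} \<Longrightarrow> \<exists>k::nat. d k \<in> (U :: (real^'d) set)"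
    and J: "J \<noteq> {}" "finite J"
  shows "(\<Inter>i\<in>J. cball (x i) t) \<noteq> {} \<longleftrightarrow>
    (\<forall>m::nat. \<exists>k. \<forall>i\<in>J. dist (x i) (d k) < t + 1 / (real m + 1))"
proof
  assume "(\<Inter>i\<in>J. cball (x i) t) \<noteq> {}"
  then obtain z where "z \<in> (\<Inter>i\<in>J. cball (x i) t)" by blast
  then have z: "\<And>i. i \<in> J \<Longrightarrow> dist (x i) z \<le> t" by auto
  show "\<forall>m::nat. \<exists>k. \<forall>i\<in>J. dist (x i) (d k) < t + 1 / (real m + 1)"
  proof
    fix m :: nat
    obtain k where q: "d k \<in> ball z (1 / (real m + 1))"
      using d[of "ball z (1 / (real m + 1))"] by auto
    have "dist (x i) (d k) < t + 1 / (real m + 1)" if "i \<in> J" for i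
      using dist_triangle[of "x i" "d k" z] z[OF that] q by auto
    then show "\<exists>k. \<forall>i\<in>J. dist (x i) (d k) < t + 1 / (real m + 1)" by blast
  qed
next
  assume "\<forall>m::nat. \<exists>k. \<forall>i\<in>J. dist (x i) (d k) < t + 1 / (real m + 1)"
  then obtain \<kappa> where \<kappa>: "\<And>m i. i \<in> J \<Longrightarrow> dist (x i) (d (\<kappa> m)) < t + 1 / (real m + 1)" by metis
  define q where "q = d \<circ> \<kappa>"
  have q: "\<And>m i. i \<in> J \<Longrightarrow> dist (x i) (q m) < t + 1 / (real m + 1)"
    using \<kappa> by (simp add: q_def)
  obtain i0 where i0: "i0 \<in> J" using J by auto
  have "q m \<in> cball (x i0) (t + 1)" for m
  proof -
    have "1 / (real m + 1) \<le> 1" by simp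
    with q[OF i0, of m] have "dist (x i0) (q m) \<le> t + 1" by linarith
    then show ?thesis by simp
  qed
  then obtain z \<theta> where z: "strict_mono \<theta>" "(q \<circ> \<theta>) \<longlonglongrightarrow> z"
    using compact_cball[of "x i0" "t + 1"] unfolding compact_def by blast
  have "dist (x i) z \<le> t" if i: "i \<in> J" for i
  proof (rule LIMSEQ_le)
    show "(\<lambda>m. dist (x i) ((q \<circ> \<theta>) m)) \<longlonglongrightarrow> dist (x i) z"
      by (intro tendsto_intros z)
    have "(\<lambda>m. t + 1 / (real m + 1)) \<longlonglongrightarrow> t" by real_asymp
    from LIMSEQ_subseq_LIMSEQ[OF this z(1)]
    show "((\<lambda>m. t + 1 / (real m + 1)) \<circ> \<theta>) \<longlonglongrightarrow> t" .
    show "\<exists>N. \<forall>m\<ge>N. dist (x i) ((q \<circ> \<theta>) m) \<le> ((\<lambda>m. t + 1 / (real m + 1)) \<circ> \<theta>) m"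
      using q[OF i] by (auto intro: less_imp_le)
  qed
  then have "z \<in> (\<Inter>i\<in>J. cball (x i) t)" by auto
  then show "(\<Inter>i\<in>J. cball (x i) t) \<noteq> {}" by blast
qed

lemma measurable_cech_condition:
  fixes f :: "'i \<Rightarrow> 'w \<Rightarrow> real^'d"
  assumes J: "J \<noteq> {}" "finite J" and f: "\<And>i. i \<in> J \<Longrightarrow> f i \<in> borel_measurable M"
  shows "Measurable.pred M (\<lambda>w. (\<Inter>x\<in>(\<lambda>i. f i w) ` J. cball x t) \<noteq> {})"
proof -
  obtain D :: "(real^'d) set" where D: "countable D" "\<And>U. open U \<Longrightarrow> U \<noteq> {} \<Longrightarrow> \<exists>q\<in>D. q \<in> U"
    using countable_dense_exists by blast
  define d where "d = from_nat_into D"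
  have d: "\<exists>k. d k \<in> U" if "open U" "U \<noteq> {}" for U
    using D(2)[OF that] from_nat_into_surj[OF D(1)] unfolding d_def by metis
  have "Measurable.pred M (\<lambda>w. \<forall>m::nat. \<exists>k. \<forall>i\<in>J. dist (f i w) (d k) < t + 1 / (real m + 1))"
  proof (intro pred_intros_countable pred_intros_finite(3) J(2))
    fix m k i assume "i \<in> J"
    then have [measurable]: "f i \<in> borel_measurable M" using f by auto
    show "Measurable.pred M (\<lambda>w. dist (f i w) (d k) < t + 1 / (real m + 1))" by measurable
  qed
  then show ?thesis using cech_condition_approx[of d, OF d J] by (simp cong: measurable_cong)
qed

lemma diameter_le_iff_finite:
  fixes \<sigma> :: "'a::metric_space set"
  assumes "finite \<sigma>" "\<sigma> \<noteq> {}"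
  shows "diameter \<sigma> \<le> t \<longleftrightarrow> (\<forall>x\<in>\<sigma>. \<forall>y\<in>\<sigma>. dist x y \<le> t)"
proof
  assume "diameter \<sigma> \<le> t"
  then show "\<forall>x\<in>\<sigma>. \<forall>y\<in>\<sigma>. dist x y \<le> t"
    using diameter_bounded_bound[OF finite_imp_bounded[OF assms(1)]] by fastforce
next
  assume "\<forall>x\<in>\<sigma>. \<forall>y\<in>\<sigma>. dist x y \<le> t"
  then show "diameter \<sigma> \<le> t"
    unfolding diameter_def using assms by (auto intro!: cSUP_least)
qed

definition cech_or_rips :: "(real \<Rightarrow> (real^'d) set \<Rightarrow> (real^'d) set set) \<Rightarrow> bool" where
  "cech_or_rips K \<longleftrightarrow> K = cech_complex \<or> K = rips_complex"

lemma cech_or_rips_eq_complex_of: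
  "cech_or_rips K \<Longrightarrow> K t = complex_of (\<lambda>\<sigma>. \<sigma> \<in> K t \<sigma>)"
  by (auto simp: cech_or_rips_def cech_complex_def rips_complex_def complex_of_def fun_eq_iff)

lemma cech_or_rips_dist_le:
  assumes K: "cech_or_rips K" and \<sigma>: "finite \<sigma>" "\<sigma> \<in> K t \<sigma>" "x \<in> \<sigma>" "y \<in> \<sigma>"
  shows "dist x y \<le> 2 * t"
  using K unfolding cech_or_rips_def
proof (elim disjE)
  assume "K = cech_complex"
  then have "(\<Inter>x\<in>\<sigma>. cball x t) \<noteq> {}" using \<sigma> by (simp add: cech_complex_def)
  then obtain z where "z \<in> (\<Inter>x\<in>\<sigma>. cball x t)" by blast
  then have "dist x z \<le> t" "dist y z \<le> t" using \<sigma> by auto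
  then show ?thesis using dist_triangle2[of x y z] by simp
next
  assume "K = rips_complex"
  then have "diameter \<sigma> \<le> t" "\<sigma> \<noteq> {}" using \<sigma> by (auto simp: rips_complex_def)
  then have "dist x y \<le> t" using diameter_le_iff_finite[OF \<sigma>(1)] \<sigma> by blast
  then show ?thesis using zero_le_dist[of x y] by linarith
qed

lemma measurable_cech_or_rips_condition:
  fixes f :: "'i \<Rightarrow> 'w \<Rightarrow> real^'d"
  assumes K: "cech_or_rips K"
    and f: "\<And>i. i \<in> J \<Longrightarrow> f i \<in> borel_measurable M" and J: "finite J" "J \<noteq> {}"
  shows "Measurable.pred M (\<lambda>w. (\<lambda>i. f i w) ` J \<in> K t ((\<lambda>i. f i w) ` J))"
  using K unfolding cech_or_rips_def
proof (elim disjE)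
  assume "K = cech_complex"
  then show ?thesis
    using measurable_cech_condition[OF J(2,1) f, where t = t] J by (simp add: cech_complex_def)
next
  assume K: "K = rips_complex"
  have "Measurable.pred M (\<lambda>w. \<forall>i\<in>J. \<forall>j\<in>J. dist (f i w) (f j w) \<le> t)"
  proof (intro pred_intros_finite(3) J(1))
    fix i j assume "i \<in> J" "j \<in> J"
    then have [measurable]: "f i \<in> borel_measurable M" "f j \<in> borel_measurable M" using f by auto
    show "Measurable.pred M (\<lambda>w. dist (f i w) (f j w) \<le> t)" by measurable
  qed
  then show ?thesis using J by (simp add: K rips_complex_def diameter_le_iff_finite)
qed

text \<open>The radius does not depend on \<open>t\<close>: it is the one that works for the largest scale \<open>T\<close>.\<close>

lemma local_functional_euler_char:
  fixes K :: "real \<Rightarrow> (real^'d) set \<Rightarrow> (real^'d) set set"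
  assumes K: "cech_or_rips K" and t: "0 \<le> t" "t \<le> T" and n: "n \<ge> 1"
  shows "local_functional (2 * T / real n powr (1 / real CARD('d)))
    (\<lambda>S. of_int (euler_char (K t (rescale n S))))"
proof -
  have "local_functional (2 * T) (\<lambda>S. of_int (euler_char (complex_of (\<lambda>\<sigma>. \<sigma> \<in> K t \<sigma>) S)))"
    by (rule local_functional_complex_of) (use t cech_or_rips_dist_le[OF K, of _ t] in fastforce)+
  from local_functional_scale[OF this, of "real n powr (1 / real CARD('d))"] n
  show ?thesis unfolding rescale_def cech_or_rips_eq_complex_of[OF K, of t, symmetric] by simp
qed

lemma measurable_euler_char:
  fixes K :: "real \<Rightarrow> (real^'d) set \<Rightarrow> (real^'d) set set" and f :: "nat \<Rightarrow> 'w \<Rightarrow> real^'d"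
  assumes K: "cech_or_rips K" and I: "finite I" and f: "\<And>i. i \<in> I \<Longrightarrow> f i \<in> borel_measurable M"
  shows "(\<lambda>w. real_of_int (euler_char (K t (rescale n ((\<lambda>i. f i w) ` I))))) \<in> borel_measurable M"
proof -
  define a where "a = real n powr (1 / real CARD('d))"
  have f': "(\<lambda>w. a *\<^sub>R f i w) \<in> borel_measurable M" if "i \<in> I" for i
    using f[OF that] by measurable
  have "(\<lambda>w. real_of_int (euler_char (complex_of (\<lambda>\<sigma>. \<sigma> \<in> K t \<sigma>) ((\<lambda>i. a *\<^sub>R f i w) ` I)))) \<in> borel_measurable M"
    by (intro measurable_euler_char_complex_of measurable_cech_or_rips_condition K I f')
      (use I finite_subset in auto)
  then show ?thesis unfolding rescale_def image_image a_def cech_or_rips_eq_complex_of[OF K, of t, symmetric] .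
qed

section \<open>The Efron-Stein inequality\<close>

text \<open>For a fixed number of points all random variables below are bounded. This class is closed under
  the operations of the Efron-Stein argument, and its members are integrable over every finite
  measure.\<close>

definition bounded_measurable :: "'a measure \<Rightarrow> ('a \<Rightarrow> real) \<Rightarrow> bool" where
  "bounded_measurable M h \<longleftrightarrow> h \<in> borel_measurable M \<and> (\<exists>B. \<forall>x. \<bar>h x\<bar> \<le> B)"

lemma bounded_measurableI: "h \<in> borel_measurable M \<Longrightarrow> (\<And>x. \<bar>h x\<bar> \<le> B) \<Longrightarrow> bounded_measurable M h"
  by (auto simp: bounded_measurable_def)

lemma bounded_measurable_integrable:
  "finite_measure M \<Longrightarrow> bounded_measurable M h \<Longrightarrow> integrable M h"
  unfolding bounded_measurable_def
  by (elim conjE exE, rule finite_measure.integrable_const_bound) auto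

lemma bounded_measurable_const: "bounded_measurable M (\<lambda>_. c)"
  by (auto simp: bounded_measurable_def)

lemma bounded_measurable_diff:
  assumes "bounded_measurable M f" "bounded_measurable M g"
  shows "bounded_measurable M (\<lambda>x. f x - g x)"
proof -
  obtain A B where "\<And>x. \<bar>f x\<bar> \<le> A" "\<And>x. \<bar>g x\<bar> \<le> B" using assms by (auto simp: bounded_measurable_def)
  then have "\<bar>f x - g x\<bar> \<le> A + B" for x using order_trans[OF abs_triangle_ineq4 add_mono] by blast
  then show ?thesis using assms by (intro bounded_measurableI) (auto simp: bounded_measurable_def)
qed

lemma bounded_measurable_power2:
  assumes "bounded_measurable M f"
  shows "bounded_measurable M (\<lambda>x. (f x)\<^sup>2)"
proof -
  obtain A where "\<And>x. \<bar>f x\<bar> \<le> A" using assms by (auto simp: bounded_measurable_def)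
  then have "\<bar>(f x)\<^sup>2\<bar> \<le> A\<^sup>2" for x using power_mono[of "\<bar>f x\<bar>" A 2] by simp
  then show ?thesis using assms by (intro bounded_measurableI) (auto simp: bounded_measurable_def)
qed

lemma bounded_measurable_compose:
  "f \<in> measurable M N \<Longrightarrow> bounded_measurable N h \<Longrightarrow> bounded_measurable M (\<lambda>x. h (f x))"
  by (auto simp: bounded_measurable_def)

lemma bounded_measurable_integral:
  assumes N: "prob_space N" and h: "bounded_measurable (M \<Otimes>\<^sub>M N) (\<lambda>(x, y). h x y)"
  shows "bounded_measurable M (\<lambda>x. \<integral>y. h x y \<partial>N)"
proof -
  interpret N: prob_space N by fact
  obtain B where B: "\<And>x y. \<bar>h x y\<bar> \<le> B" using h by (auto simp: bounded_measurable_def)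
  have "\<bar>\<integral>y. h x y \<partial>N\<bar> \<le> B" for x
  proof (cases "integrable N (h x)")
    case True
    have "h x y \<le> B" "- B \<le> h x y" for y using B[of x y] by auto
    then have "(\<integral>y. h x y \<partial>N) \<le> B" "- B \<le> (\<integral>y. h x y \<partial>N)"
      using True by (auto intro!: N.integral_le_const N.integral_ge_const)
    then show ?thesis by simp
  next
    case False
    then show ?thesis using B[of undefined undefined] by (simp add: not_integrable_integral_eq)
  qed
  moreover have "(\<lambda>x. \<integral>y. h x y \<partial>N) \<in> borel_measurable M"
    using h by (intro N.borel_measurable_lebesgue_integral) (auto simp: bounded_measurable_def)
  ultimately show ?thesis by (rule bounded_measurableI[rotated])
qed

lemma square_integral_le:
  fixes h :: "'a \<Rightarrow> real"
  assumes M: "prob_space M" and h: "bounded_measurable M h"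
  shows "(\<integral>x. h x \<partial>M)\<^sup>2 \<le> (\<integral>x. (h x)\<^sup>2 \<partial>M)"
proof -
  interpret prob_space M by fact
  have int: "integrable M h" "integrable M (\<lambda>x. (h x)\<^sup>2)"
    by (intro bounded_measurable_integrable bounded_measurable_power2 finite_measure_axioms h)+
  have "0 \<le> (\<integral>x. (h x)\<^sup>2 \<partial>M) - (\<integral>x. h x \<partial>M)\<^sup>2"
    unfolding variance_eq[OF int, symmetric] by (rule variance_positive)
  then show ?thesis by linarith
qed

text \<open>Replacing the centre of a second moment by the mean decreases it by the square of the shift.\<close>

lemma second_moment_shift:
  fixes h :: "'a \<Rightarrow> real"
  assumes M: "prob_space M" and h: "integrable M h" "integrable M (\<lambda>x. (h x)\<^sup>2)"
  shows "(\<integral>x. (h x - c)\<^sup>2 \<partial>M) = (\<integral>x. (h x - (\<integral>x. h x \<partial>M))\<^sup>2 \<partial>M) + ((\<integral>x. h x \<partial>M) - c)\<^sup>2"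
proof -
  interpret prob_space M by fact
  have sq: "(h x - c)\<^sup>2 = (h x)\<^sup>2 - 2 * c * h x + c\<^sup>2" for x
    by (simp add: power2_diff)
  have *: "(\<integral>x. (h x - c)\<^sup>2 \<partial>M) = (\<integral>x. (h x)\<^sup>2 \<partial>M) - 2 * c * (\<integral>x. h x \<partial>M) + c\<^sup>2"
    unfolding sq using h by (simp add: prob_space)
  show ?thesis unfolding * variance_eq[OF h] by (simp add: power2_diff)
qed

lemma integral_PiM_insert:
  fixes F :: "('i \<Rightarrow> 'a) \<Rightarrow> real"
  assumes J: "prob_space J" and I: "finite I" "j \<notin> I"
    and F: "bounded_measurable (PiM (insert j I) (\<lambda>_. J)) F"
  shows "(\<integral>x. F x \<partial>PiM (insert j I) (\<lambda>_. J)) = (\<integral>x. \<integral>y. F (x(j := y)) \<partial>J \<partial>PiM I (\<lambda>_. J))"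
    and "bounded_measurable (PiM I (\<lambda>_. J) \<Otimes>\<^sub>M J) (\<lambda>(x, y). F (x(j := y)))"
    and "bounded_measurable (PiM I (\<lambda>_. J)) (\<lambda>x. \<integral>y. F (x(j := y)) \<partial>J)"
    and "x \<in> space (PiM I (\<lambda>_. J)) \<Longrightarrow> bounded_measurable J (\<lambda>y. F (x(j := y)))"
proof -
  interpret J: prob_space J by fact
  interpret product_prob_space "\<lambda>_. J" UNIV by standard
  have fin: "finite_measure (PiM K (\<lambda>_. J))" for K :: "'i set"
    by (intro prob_space.finite_measure prob_space_PiM J)
  show "(\<integral>x. F x \<partial>PiM (insert j I) (\<lambda>_. J)) = (\<integral>x. \<integral>y. F (x(j := y)) \<partial>J \<partial>PiM I (\<lambda>_. J))"
    by (intro product_integral_insert I bounded_measurable_integrable fin F)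
  show *: "bounded_measurable (PiM I (\<lambda>_. J) \<Otimes>\<^sub>M J) (\<lambda>(x, y). F (x(j := y)))"
    using bounded_measurable_compose[OF measurable_add_dim F] by (simp add: case_prod_unfold)
  show "bounded_measurable (PiM I (\<lambda>_. J)) (\<lambda>x. \<integral>y. F (x(j := y)) \<partial>J)"
    by (rule bounded_measurable_integral[OF J *])
  show "bounded_measurable J (\<lambda>y. F (x(j := y)))" if x: "x \<in> space (PiM I (\<lambda>_. J))"
    using bounded_measurable_compose[OF measurable_Pair1'[OF x, of J] *] by simp
qed

text \<open>If \<open>G i\<close> does not depend on the coordinate \<open>i\<close>, then \<open>(F - G i)\<^sup>2\<close> dominates the conditional
  variance of \<open>F\<close> in that coordinate. The proof is by induction on the number of coordinates: the
  variance of \<open>F\<close> splits into the mean conditional variance in the coordinate \<open>j\<close> and the variance of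
  the average \<open>f\<close> of \<open>F\<close> over that coordinate. The induction hypothesis applies to \<open>f\<close> and the
  averages of the functions \<open>G i\<close>, and averaging decreases mean squares.\<close>

theorem efron_stein:
  fixes F :: "('i \<Rightarrow> 'a) \<Rightarrow> real" and G :: "'i \<Rightarrow> ('i \<Rightarrow> 'a) \<Rightarrow> real"
  assumes J: "prob_space J" and I: "finite I"
    and F: "bounded_measurable (PiM I (\<lambda>_. J)) F"
    and G: "\<And>i. i \<in> I \<Longrightarrow> bounded_measurable (PiM I (\<lambda>_. J)) (G i)"
    and ind: "\<And>i x y. i \<in> I \<Longrightarrow> G i (x(i := y)) = G i x"
  shows "(\<integral>x. (F x - (\<integral>x. F x \<partial>PiM I (\<lambda>_. J)))\<^sup>2 \<partial>PiM I (\<lambda>_. J))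
       \<le> (\<Sum>i\<in>I. \<integral>x. (F x - G i x)\<^sup>2 \<partial>PiM I (\<lambda>_. J))"
  using I F G ind
proof (induction I arbitrary: F G)
  case empty
  interpret P: prob_space "PiM {} (\<lambda>_::'i. J)" by (intro prob_space_PiM J)
  have F0: "h (F x) = h (F (\<lambda>_. undefined))" if "x \<in> space (PiM {} (\<lambda>_::'i. J))" for x and h :: "real \<Rightarrow> real"
    using that by (simp add: space_PiM_empty)
  have "(\<integral>x. h (F x) \<partial>PiM {} (\<lambda>_. J)) = h (F (\<lambda>_. undefined))" for h :: "real \<Rightarrow> real"
    by (subst Bochner_Integration.integral_cong[OF refl F0]) (simp_all add: P.prob_space)
  note E = this
  show ?case by (simp add: E[of "\<lambda>z. z"] E[of "\<lambda>z. (z - c)\<^sup>2" for c])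
next
  case (insert j I)
  let ?P = "PiM I (\<lambda>_::'i. J)" and ?Q = "PiM (insert j I) (\<lambda>_::'i. J)"
  interpret P: prob_space ?P by (intro prob_space_PiM J)
  interpret Q: prob_space ?Q by (intro prob_space_PiM J)
  interpret J: prob_space J by fact
  note F = insert.prems(1)
  define f where "f x = (\<integral>y. F (x(j := y)) \<partial>J)" for x
  define g where "g i x = (\<integral>y. G i (x(j := y)) \<partial>J)" for i x
  note insQ = integral_PiM_insert[OF J insert.hyps(1,2)]
  note bm = bounded_measurable_diff bounded_measurable_power2 bounded_measurable_const
  have f: "bounded_measurable ?P f" unfolding f_def by (rule insQ(3)[OF F])
  have g: "bounded_measurable ?P (g i)" if "i \<in> I" for i
    unfolding g_def using insert.prems(2) that by (intro insQ(3)) auto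
  have intQ: "integrable ?P (\<lambda>x. \<integral>y. h (x(j := y)) \<partial>J)" if "bounded_measurable ?Q h" for h :: "_ \<Rightarrow> real"
    by (intro bounded_measurable_integrable P.finite_measure_axioms insQ(3) that)
  have intP: "integrable ?P h" if "bounded_measurable ?P h" for h :: "_ \<Rightarrow> real"
    by (intro bounded_measurable_integrable P.finite_measure_axioms that)
  have intJ: "integrable J h" if "bounded_measurable J h" for h :: "_ \<Rightarrow> real"
    by (intro bounded_measurable_integrable J.finite_measure_axioms that)
  define c where "c = (\<integral>x. F x \<partial>?Q)"
  have c: "c = (\<integral>x. f x \<partial>?P)" unfolding c_def f_def by (rule insQ(1)[OF F])
  have "(\<integral>x. (F x - c)\<^sup>2 \<partial>?Q) = (\<integral>x. \<integral>y. (F (x(j := y)) - c)\<^sup>2 \<partial>J \<partial>?P)"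
    by (intro insQ(1) bm F)
  also have "\<dots> = (\<integral>x. (\<integral>y. (F (x(j := y)) - f x)\<^sup>2 \<partial>J) + (f x - c)\<^sup>2 \<partial>?P)"
    unfolding f_def by (intro Bochner_Integration.integral_cong refl second_moment_shift J intJ bm insQ(4) F)
  also have "\<dots> \<le> (\<integral>x. (\<integral>y. (F (x(j := y)) - G j (x(j := y)))\<^sup>2 \<partial>J) + (f x - c)\<^sup>2 \<partial>?P)"
  proof (rule integral_mono)
    have "bounded_measurable ?Q (\<lambda>x. (F x - G j x)\<^sup>2)" using insert.prems(2) by (intro bm F) auto
    from intQ[OF this]
    show "integrable ?P (\<lambda>x. (\<integral>y. (F (x(j := y)) - G j (x(j := y)))\<^sup>2 \<partial>J) + (f x - c)\<^sup>2)"
      by (rule Bochner_Integration.integrable_add[OF _ intP[OF bounded_measurable_power2[OF bounded_measurable_diff[OF f bounded_measurable_const]]]])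
    have "bounded_measurable (?P \<Otimes>\<^sub>M J) (\<lambda>(x, y). (F (x(j := y)) - f x)\<^sup>2)"
    proof -
      have "bounded_measurable (?P \<Otimes>\<^sub>M J) (\<lambda>p. (case p of (x, y) \<Rightarrow> F (x(j := y))))"
        by (rule insQ(2)[OF F])
      moreover have "bounded_measurable (?P \<Otimes>\<^sub>M J) (\<lambda>p. f (fst p))"
        by (rule bounded_measurable_compose[OF measurable_fst f])
      ultimately have "bounded_measurable (?P \<Otimes>\<^sub>M J)
        (\<lambda>p. ((case p of (x, y) \<Rightarrow> F (x(j := y))) - f (fst p))\<^sup>2)" by (intro bm)
      then show ?thesis by (simp add: case_prod_unfold)
    qed
    then show "integrable ?P (\<lambda>x. (\<integral>y. (F (x(j := y)) - f x)\<^sup>2 \<partial>J) + (f x - c)\<^sup>2)"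
      by (intro Bochner_Integration.integrable_add intP bounded_measurable_integral J bm f)
  next
    fix x assume x: "x \<in> space ?P"
    have "G j (x(j := y)) = G j x" for y by (rule insert.prems(3)) simp
    then show "(\<integral>y. (F (x(j := y)) - f x)\<^sup>2 \<partial>J) + (f x - c)\<^sup>2
        \<le> (\<integral>y. (F (x(j := y)) - G j (x(j := y)))\<^sup>2 \<partial>J) + (f x - c)\<^sup>2"
      using second_moment_shift[OF J, of "\<lambda>y. F (x(j := y))" "G j x"] x
      by (simp add: f_def intJ bm insQ(4) F)
  qed
  also have "\<dots> = (\<integral>x. (F x - G j x)\<^sup>2 \<partial>?Q) + (\<integral>x. (f x - c)\<^sup>2 \<partial>?P)"
  proof -
    have *: "bounded_measurable ?Q (\<lambda>x. (F x - G j x)\<^sup>2)" using insert.prems(2) by (intro bm F) auto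
    show ?thesis unfolding insQ(1)[OF *]
      by (intro Bochner_Integration.integral_add intQ[OF *] intP bm f)
  qed
  also have "(\<integral>x. (f x - c)\<^sup>2 \<partial>?P) \<le> (\<Sum>i\<in>I. \<integral>x. (f x - g i x)\<^sup>2 \<partial>?P)"
    unfolding c
  proof (rule insert.IH[OF f g])
    fix i x and y :: 'a assume i: "i \<in> I"
    then have "i \<noteq> j" using insert.hyps by auto
    then have "(x(i := y))(j := z) = (x(j := z))(i := y)" for z :: 'a by (rule fun_upd_twist)
    moreover have "G i ((x(j := z))(i := y)) = G i (x(j := z))" for z
      by (rule insert.prems(3)) (use i in simp)
    ultimately show "g i (x(i := y)) = g i x" unfolding g_def by (simp only:)
  qed
  also have "\<dots> \<le> (\<Sum>i\<in>I. \<integral>x. (F x - G i x)\<^sup>2 \<partial>?Q)"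
  proof (rule sum_mono)
    fix i assume i: "i \<in> I"
    have Gi: "bounded_measurable ?Q (G i)" using insert.prems(2) i by auto
    have D: "bounded_measurable ?Q (\<lambda>x. F x - G i x)" by (intro bm F Gi)
    have "(\<integral>x. (f x - g i x)\<^sup>2 \<partial>?P) = (\<integral>x. (\<integral>y. F (x(j := y)) - G i (x(j := y)) \<partial>J)\<^sup>2 \<partial>?P)"
    proof (intro Bochner_Integration.integral_cong refl)
      fix x assume "x \<in> space ?P"
      then show "(f x - g i x)\<^sup>2 = (\<integral>y. F (x(j := y)) - G i (x(j := y)) \<partial>J)\<^sup>2"
        by (simp add: f_def g_def Bochner_Integration.integral_diff intJ insQ(4) F Gi)
    qed
    also have "\<dots> \<le> (\<integral>x. \<integral>y. (F (x(j := y)) - G i (x(j := y)))\<^sup>2 \<partial>J \<partial>?P)"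
    proof (rule integral_mono)
      show "integrable ?P (\<lambda>x. (\<integral>y. F (x(j := y)) - G i (x(j := y)) \<partial>J)\<^sup>2)"
        by (intro intP bm insQ(3)[OF D])
      show "integrable ?P (\<lambda>x. \<integral>y. (F (x(j := y)) - G i (x(j := y)))\<^sup>2 \<partial>J)"
        by (rule intQ[OF bounded_measurable_power2[OF D]])
      show "(\<integral>y. F (x(j := y)) - G i (x(j := y)) \<partial>J)\<^sup>2 \<le> (\<integral>y. (F (x(j := y)) - G i (x(j := y)))\<^sup>2 \<partial>J)"
        if "x \<in> space ?P" for x
        by (rule square_integral_le[OF J insQ(4)[OF D that]])
    qed
    also have "\<dots> = (\<integral>x. (F x - G i x)\<^sup>2 \<partial>?Q)"
      by (rule insQ(1)[OF bounded_measurable_power2[OF D], symmetric])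
    finally show "(\<integral>x. (f x - g i x)\<^sup>2 \<partial>?P) \<le> (\<integral>x. (F x - G i x)\<^sup>2 \<partial>?Q)" .
  qed
  finally show ?case using insert.hyps by (simp add: c_def)
qed

section \<open>Maximal coupling of two densities\<close>

lemma nn_integral_count_bool:
  "(\<integral>\<^sup>+b. h b \<partial>count_space (UNIV :: bool set)) = h True + h False"
  by (subst nn_integral_count_space_finite) (simp_all add: UNIV_bool add.commute)

text \<open>With \<open>m = min f g\<close>, the first component is drawn from \<open>f\<close>. With conditional probability
  \<open>m / f\<close> the second component is the same point, otherwise it is drawn independently from the
  normalized excess \<open>\<tau>\<close> of \<open>g\<close> over \<open>m\<close>. This is the image of a density on triples of a flag and
  two points, where the flag says whether the point is kept.\<close>

lemma maximal_coupling_exists: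
  fixes f g :: "'a::euclidean_space \<Rightarrow> ennreal"
  assumes [measurable]: "f \<in> borel_measurable borel" "g \<in> borel_measurable borel"
    and f1: "(\<integral>\<^sup>+x. f x \<partial>lborel) = 1" and g1: "(\<integral>\<^sup>+x. g x \<partial>lborel) = 1"
  obtains J :: "('a \<times> 'a) measure" where "prob_space J" "sets J = sets (borel \<Otimes>\<^sub>M borel)"
    "distr J lborel fst = density lborel f" "distr J lborel snd = density lborel g"
    "\<And>B. B \<in> sets borel \<Longrightarrow> emeasure J {p. fst p \<noteq> snd p \<and> fst p \<in> B} \<le> (\<integral>\<^sup>+x\<in>B. (f x - g x) \<partial>lborel)"
    "\<And>B. B \<in> sets borel \<Longrightarrow> emeasure J {p. fst p \<noteq> snd p \<and> snd p \<in> B} \<le> (\<integral>\<^sup>+x\<in>B. (g x - f x) \<partial>lborel)"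
proof -
  define m where "m x = min (f x) (g x)" for x
  have [measurable]: "m \<in> borel_measurable borel" unfolding m_def by measurable
  have fm: "m x + (f x - m x) = f x" and gm: "m x + (g x - m x) = g x" for x
    by (simp_all add: m_def add.commute diff_add_cancel_ennreal)
  define a where "a = (\<integral>\<^sup>+x. (f x - m x) \<partial>lborel)"
  have ma: "(\<integral>\<^sup>+x. m x \<partial>lborel) + a = 1"
    unfolding a_def by (subst nn_integral_add[symmetric]) (simp_all add: fm f1)
  have mb: "(\<integral>\<^sup>+x. m x \<partial>lborel) + (\<integral>\<^sup>+x. (g x - m x) \<partial>lborel) = 1"
    by (subst nn_integral_add[symmetric]) (simp_all add: gm g1)
  have mfin: "(\<integral>\<^sup>+x. m x \<partial>lborel) \<noteq> \<infinity>" and afin: "a \<noteq> \<infinity>" using ma by auto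
  have b: "(\<integral>\<^sup>+x. (g x - m x) \<partial>lborel) = a"
  proof -
    have "(\<integral>\<^sup>+x. m x \<partial>lborel) + (\<integral>\<^sup>+x. (g x - m x) \<partial>lborel) = (\<integral>\<^sup>+x. m x \<partial>lborel) + a"
      using ma mb by simp
    then show ?thesis using mfin by (simp add: ennreal_add_left_cancel)
  qed
  define \<tau> where "\<tau> y = (if a = 0 then g y else (g y - m y) / a)" for y
  have [measurable]: "\<tau> \<in> borel_measurable borel" unfolding \<tau>_def by measurable
  have \<tau>1: "(\<integral>\<^sup>+y. \<tau> y \<partial>lborel) = 1"
  proof (cases "a = 0")
    case True
    then show ?thesis by (simp add: \<tau>_def g1)
  next
    case False
    then have "(\<integral>\<^sup>+y. \<tau> y \<partial>lborel) = (\<integral>\<^sup>+y. (g y - m y) \<partial>lborel) / a"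
      by (simp add: \<tau>_def nn_integral_divide)
    then show ?thesis using False afin b by (simp add: ennreal_divide_self top.not_eq_extremum)
  qed
  have a\<tau>: "a * (\<integral>\<^sup>+y. \<tau> y * h y \<partial>lborel) = (\<integral>\<^sup>+y. (g y - m y) * h y \<partial>lborel)"
    if [measurable]: "h \<in> borel_measurable borel" for h
  proof (cases "a = 0")
    case True
    then have "(\<integral>\<^sup>+x. (g x - m x) \<partial>lborel) = 0" using b by simp
    then have "AE y in lborel. g y - m y = 0" by (subst (asm) nn_integral_0_iff_AE) auto
    then have "(\<integral>\<^sup>+y. (g y - m y) * h y \<partial>lborel) = (\<integral>\<^sup>+y. 0 \<partial>(lborel :: 'a measure))"
      by (intro nn_integral_cong_AE) auto
    then show ?thesis using True by simp
  next
    case False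
    have "a * (\<integral>\<^sup>+y. \<tau> y * h y \<partial>lborel) = (\<integral>\<^sup>+y. a * (\<tau> y * h y) \<partial>lborel)"
      by (rule nn_integral_cmult[symmetric]) simp
    also have "\<dots> = (\<integral>\<^sup>+y. (g y - m y) * h y \<partial>lborel)"
    proof (intro nn_integral_cong)
      fix y
      have "a * \<tau> y = g y - m y"
        using False afin by (simp add: \<tau>_def ennreal_times_divide ennreal_mult_divide_eq mult.commute[of a])
      then show "a * (\<tau> y * h y) = (g y - m y) * h y" by (simp add: mult.assoc[symmetric])
    qed
    finally show ?thesis .
  qed
  define W where "W = count_space (UNIV :: bool set) \<Otimes>\<^sub>M (lborel \<Otimes>\<^sub>M lborel :: ('a \<times> 'a) measure)"
  define w :: "bool \<times> 'a \<times> 'a \<Rightarrow> ennreal"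
    where "w = (\<lambda>(b, x, y). (if b then m x else f x - m x) * \<tau> y)"
  have [measurable]: "w \<in> borel_measurable W"
    unfolding w_def W_def by measurable
  define \<Phi> :: "bool \<times> 'a \<times> 'a \<Rightarrow> 'a \<times> 'a" where "\<Phi> = (\<lambda>(b, x, y). if b then (x, x) else (x, y))"
  have \<Phi>[measurable]: "\<Phi> \<in> measurable W (borel \<Otimes>\<^sub>M borel)"
    unfolding \<Phi>_def W_def by measurable
  define J where "J = distr (density W w) (borel \<Otimes>\<^sub>M borel) \<Phi>"
  \<comment> \<open>The two terms belong to the two values of the flag.\<close>
  have J: "(\<integral>\<^sup>+p. h p \<partial>J) = (\<integral>\<^sup>+x. m x * h (x, x) \<partial>lborel)
      + (\<integral>\<^sup>+x. (f x - m x) * (\<integral>\<^sup>+y. \<tau> y * h (x, y) \<partial>lborel) \<partial>lborel)"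
    if h[measurable]: "h \<in> borel_measurable (borel \<Otimes>\<^sub>M borel)" for h
  proof -
    note L_fst = sigma_finite_measure.nn_integral_fst[OF sigma_finite_lborel]
    note LL_fst = sigma_finite_measure.nn_integral_fst[OF
        sigma_finite_pair_measure[OF sigma_finite_lborel sigma_finite_lborel]]
    have "(\<integral>\<^sup>+p. h p \<partial>J) = (\<integral>\<^sup>+p. w p * h (\<Phi> p) \<partial>W)"
      unfolding J_def by (simp add: nn_integral_distr nn_integral_density)
    also have "\<dots> = (\<integral>\<^sup>+b. \<integral>\<^sup>+q. w (b, q) * h (\<Phi> (b, q)) \<partial>(lborel \<Otimes>\<^sub>M lborel) \<partial>count_space UNIV)"
      unfolding W_def by (rule LL_fst[symmetric]) (simp add: W_def[symmetric])
    also have "\<dots> = (\<integral>\<^sup>+q. w (True, q) * h (\<Phi> (True, q)) \<partial>(lborel \<Otimes>\<^sub>M lborel))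
        + (\<integral>\<^sup>+q. w (False, q) * h (\<Phi> (False, q)) \<partial>(lborel \<Otimes>\<^sub>M lborel))"
      by (rule nn_integral_count_bool)
    also have "(\<integral>\<^sup>+q. w (True, q) * h (\<Phi> (True, q)) \<partial>(lborel \<Otimes>\<^sub>M lborel))
        = (\<integral>\<^sup>+x. \<integral>\<^sup>+y. m x * h (x, x) * \<tau> y \<partial>lborel \<partial>lborel)"
      by (subst L_fst[symmetric])
        (auto simp: w_def \<Phi>_def case_prod_unfold mult_ac)
    also have "\<dots> = (\<integral>\<^sup>+x. m x * h (x, x) \<partial>lborel)"
      by (simp add: nn_integral_cmult \<tau>1)
    also have "(\<integral>\<^sup>+q. w (False, q) * h (\<Phi> (False, q)) \<partial>(lborel \<Otimes>\<^sub>M lborel))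
        = (\<integral>\<^sup>+x. \<integral>\<^sup>+y. (f x - m x) * (\<tau> y * h (x, y)) \<partial>lborel \<partial>lborel)"
      by (subst L_fst[symmetric])
        (auto simp: w_def \<Phi>_def case_prod_unfold mult_ac)
    also have "\<dots> = (\<integral>\<^sup>+x. (f x - m x) * (\<integral>\<^sup>+y. \<tau> y * h (x, y) \<partial>lborel) \<partial>lborel)"
      by (intro nn_integral_cong nn_integral_cmult) simp
    finally show ?thesis .
  qed
  have setsJ[measurable_cong]: "sets J = sets (borel \<Otimes>\<^sub>M borel)" by (simp add: J_def)
  have spaceJ: "space J = UNIV" using sets_eq_imp_space_eq[OF setsJ] by (simp add: space_pair_measure)
  have J_fst: "(\<integral>\<^sup>+p. h (fst p) \<partial>J) = (\<integral>\<^sup>+x. f x * h x \<partial>lborel)"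
    if [measurable]: "h \<in> borel_measurable borel" for h
  proof -
    have "(\<integral>\<^sup>+p. h (fst p) \<partial>J) = (\<integral>\<^sup>+x. m x * h x \<partial>lborel)
      + (\<integral>\<^sup>+x. (f x - m x) * (\<integral>\<^sup>+y. \<tau> y * h x \<partial>lborel) \<partial>lborel)"
      by (subst J) simp_all
    also have "\<dots> = (\<integral>\<^sup>+x. m x * h x \<partial>lborel) + (\<integral>\<^sup>+x. (f x - m x) * h x \<partial>lborel)"
      by (simp add: nn_integral_multc \<tau>1)
    also have "\<dots> = (\<integral>\<^sup>+x. f x * h x \<partial>lborel)"
      by (subst nn_integral_add[symmetric]) (simp_all add: fm flip: distrib_right)
    finally show ?thesis .
  qed
  have J_snd: "(\<integral>\<^sup>+p. h (snd p) \<partial>J) = (\<integral>\<^sup>+x. g x * h x \<partial>lborel)"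
    if [measurable]: "h \<in> borel_measurable borel" for h
  proof -
    have "(\<integral>\<^sup>+p. h (snd p) \<partial>J) = (\<integral>\<^sup>+x. m x * h x \<partial>lborel)
      + (\<integral>\<^sup>+x. (f x - m x) * (\<integral>\<^sup>+y. \<tau> y * h y \<partial>lborel) \<partial>lborel)"
      by (subst J) simp_all
    also have "\<dots> = (\<integral>\<^sup>+x. m x * h x \<partial>lborel) + (\<integral>\<^sup>+x. (g x - m x) * h x \<partial>lborel)"
      by (simp add: nn_integral_multc flip: a\<tau> a_def)
    also have "\<dots> = (\<integral>\<^sup>+x. g x * h x \<partial>lborel)"
      by (subst nn_integral_add[symmetric]) (simp_all add: gm flip: distrib_right)
    finally show ?thesis .
  qed
  show thesis
  proof (rule that)
    show "prob_space J"
      using J_fst[of "\<lambda>_. 1"] f1 by (intro prob_spaceI) (simp add: spaceJ[symmetric])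
    show "sets J = sets (borel \<Otimes>\<^sub>M borel)" by (rule setsJ)
    have dist: "distr J lborel k = density lborel F"
      if [measurable]: "k \<in> measurable J borel" "F \<in> borel_measurable borel"
        and k: "\<And>h. h \<in> borel_measurable borel \<Longrightarrow> (\<integral>\<^sup>+p. h (k p) \<partial>J) = (\<integral>\<^sup>+x. F x * h x \<partial>lborel)"
      for k :: "'a \<times> 'a \<Rightarrow> 'a" and F
    proof (rule measure_eqI)
      fix A assume "A \<in> sets (distr J lborel k)"
      then have [measurable]: "A \<in> sets borel" by simp
      have "emeasure (distr J lborel k) A = (\<integral>\<^sup>+x. indicator A x \<partial>distr J lborel k)" by simp
      also have "\<dots> = (\<integral>\<^sup>+p. indicator A (k p) \<partial>J)" by (rule nn_integral_distr) simp_all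
      also have "\<dots> = emeasure (density lborel F) A"
        by (subst k) (simp_all add: emeasure_density)
      finally show "emeasure (distr J lborel k) A = emeasure (density lborel F) A" .
    qed simp
    show "distr J lborel fst = density lborel f" by (rule dist) (simp_all add: J_fst)
    show "distr J lborel snd = density lborel g" by (rule dist) (simp_all add: J_snd)
    fix B :: "'a set" assume [measurable]: "B \<in> sets borel"
    have eq: "emeasure J {p. P p} = (\<integral>\<^sup>+x. m x * indicator {p. P p} (x, x) \<partial>lborel)
        + (\<integral>\<^sup>+x. (f x - m x) * (\<integral>\<^sup>+y. \<tau> y * indicator {p. P p} (x, y) \<partial>lborel) \<partial>lborel)"
      if "Measurable.pred (borel \<Otimes>\<^sub>M borel) P" for P
    proof -
      have P: "{p. P p} \<in> sets (borel \<Otimes>\<^sub>M borel)"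
        using that by (simp add: pred_def space_pair_measure)
      then have "emeasure J {p. P p} = (\<integral>\<^sup>+p. indicator {p. P p} p \<partial>J)"
        by (simp add: setsJ)
      also note J[OF borel_measurable_indicator[OF P]]
      finally show ?thesis .
    qed
    have predB: "Measurable.pred borel (\<lambda>x. x \<in> B)" by (simp add: pred_def)
    have ne: "Measurable.pred (borel \<Otimes>\<^sub>M borel) (\<lambda>p::'a \<times> 'a. fst p \<noteq> snd p)" by measurable
    have "Measurable.pred (borel \<Otimes>\<^sub>M borel) (\<lambda>p::'a \<times> 'a. fst p \<in> B)"
      "Measurable.pred (borel \<Otimes>\<^sub>M borel) (\<lambda>p::'a \<times> 'a. snd p \<in> B)"
      by (rule measurable_compose[OF _ predB], simp)+
    note predBs = this[THEN pred_intros_logic(3)[OF ne]]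
    have fm': "f x - m x = f x - g x" and gm': "g x - m x = g x - f x" for x
      by (cases "f x = top"; cases "g x = top";
          auto simp: m_def min_def not_le less_imp_le top.not_eq_extremum diff_eq_0_iff_ennreal)+
    have "emeasure J {p. fst p \<noteq> snd p \<and> fst p \<in> B}
        = (\<integral>\<^sup>+x. (f x - m x) * (\<integral>\<^sup>+y. \<tau> y * indicator {p. fst p \<noteq> snd p \<and> fst p \<in> B} (x, y) \<partial>lborel) \<partial>lborel)"
      by (subst eq) (simp_all add: predBs)
    also have "\<dots> \<le> (\<integral>\<^sup>+x. (f x - m x) * (\<integral>\<^sup>+y. \<tau> y * indicator B x \<partial>lborel) \<partial>lborel)"
      by (intro nn_integral_mono mult_left_mono) (auto simp: indicator_def)
    also have "\<dots> = (\<integral>\<^sup>+x\<in>B. (f x - g x) \<partial>lborel)"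
      by (simp add: nn_integral_multc \<tau>1 fm')
    finally show "emeasure J {p. fst p \<noteq> snd p \<and> fst p \<in> B} \<le> (\<integral>\<^sup>+x\<in>B. (f x - g x) \<partial>lborel)" .
    have "emeasure J {p. fst p \<noteq> snd p \<and> snd p \<in> B}
        = (\<integral>\<^sup>+x. (f x - m x) * (\<integral>\<^sup>+y. \<tau> y * indicator {p. fst p \<noteq> snd p \<and> snd p \<in> B} (x, y) \<partial>lborel) \<partial>lborel)"
      by (subst eq) (simp_all add: predBs)
    also have "\<dots> \<le> (\<integral>\<^sup>+x. (f x - m x) * (\<integral>\<^sup>+y. \<tau> y * indicator B y \<partial>lborel) \<partial>lborel)"
      by (intro nn_integral_mono mult_left_mono) (auto simp: indicator_def)
    also have "\<dots> = (\<integral>\<^sup>+x\<in>B. (g x - f x) \<partial>lborel)"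
      by (simp add: nn_integral_multc gm' a\<tau> flip: a_def)
    finally show "emeasure J {p. fst p \<noteq> snd p \<and> snd p \<in> B} \<le> (\<integral>\<^sup>+x\<in>B. (g x - f x) \<partial>lborel)" .
  qed
qed

lemma pred_neq:
  fixes g h :: "'a \<Rightarrow> real^'d"
  assumes [measurable]: "g \<in> borel_measurable M" "h \<in> borel_measurable M"
  shows "Measurable.pred M (\<lambda>x. g x \<noteq> h x)"
  by measurable

lemma emeasure_lborel_unit_cube: "emeasure lborel (unit_cube :: (real^'d) set) = 1"
proof -
  have "emeasure lborel (unit_cube :: (real^'d) set) = ennreal (\<Prod>b\<in>(Basis :: (real^'d) set). (1 - 0) \<bullet> b)"
    by (rule emeasure_lborel_cbox) (auto simp: Basis_vec_def inner_axis)
  also have "(\<Prod>b\<in>(Basis :: (real^'d) set). (1 - 0) \<bullet> b) = (1 :: real)"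
    by (rule prod.neutral) (auto simp: Basis_vec_def inner_axis)
  finally show ?thesis by simp
qed

lemma abs_diff_le_sup_norm:
  assumes \<kappa>: "\<kappa> \<in> cube_densities" and \<nu>: "\<nu> \<in> density_ball \<kappa> \<rho>"
  shows "\<bar>\<kappa> x - \<nu> x\<bar> \<le> sup_norm (\<lambda>x. \<kappa> x - \<nu> x)" and "0 \<le> sup_norm (\<lambda>x. \<kappa> x - \<nu> x)"
proof -
  have bdd: "bdd_above ((\<lambda>x. \<bar>\<kappa> x - \<nu> x\<bar>) ` unit_cube)" using \<nu> by (simp add: density_ball_def)
  have in_cube: "\<bar>\<kappa> x - \<nu> x\<bar> \<le> sup_norm (\<lambda>x. \<kappa> x - \<nu> x)" if "x \<in> unit_cube" for x
    unfolding sup_norm_def by (rule cSUP_upper[OF that bdd])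
  have "(0 :: real^'b) \<in> unit_cube" by (simp add: mem_box_cart)
  from in_cube[OF this] show nonneg: "0 \<le> sup_norm (\<lambda>x. \<kappa> x - \<nu> x)" by linarith
  show "\<bar>\<kappa> x - \<nu> x\<bar> \<le> sup_norm (\<lambda>x. \<kappa> x - \<nu> x)"
  proof (cases "x \<in> unit_cube")
    case False
    then have "\<kappa> x = 0" "\<nu> x = 0" using \<kappa> \<nu> by (auto simp: cube_densities_def density_ball_def)
    then show ?thesis using nonneg by simp
  qed (rule in_cube)
qed

text \<open>The maximal coupling in the form needed for balls. The factor \<open>A + \<rho> + 1\<close> bounds both densities
  and is at least \<open>1\<close>, so that a single quantity \<open>b = 2 v (A + \<rho> + 1)\<close> serves for the probability
  that a pair meets \<open>B\<close> and, up to the factor \<open>\<delta>\<close>, for the probability that it also splits.\<close>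

lemma density_ball_coupling:
  fixes \<kappa> \<nu> :: "real^'d \<Rightarrow> real"
  assumes \<kappa>: "\<kappa> \<in> cube_densities" and \<nu>: "\<nu> \<in> density_ball \<kappa> \<rho>"
    and A: "\<And>x. \<kappa> x \<le> A" and \<rho>: "0 \<le> \<rho>"
  defines "\<delta> \<equiv> sup_norm (\<lambda>x. \<kappa> x - \<nu> x)"
  obtains J :: "((real^'d) \<times> (real^'d)) measure" where
    "prob_space J" "sets J = sets (borel \<Otimes>\<^sub>M borel)"
    "distr J lborel fst = density lborel (\<lambda>x. ennreal (\<kappa> x))"
    "distr J lborel snd = density lborel (\<lambda>x. ennreal (\<nu> x))"
    "emeasure J {p. fst p \<noteq> snd p} \<le> ennreal \<delta>"
    "\<And>B v. B \<in> sets borel \<Longrightarrow> emeasure lborel B = ennreal v \<Longrightarrow> 0 \<le> v \<Longrightarrow>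
      emeasure J {p. fst p \<in> B \<or> snd p \<in> B} \<le> ennreal (2 * v * (A + \<rho> + 1))"
    "\<And>B v. B \<in> sets borel \<Longrightarrow> emeasure lborel B = ennreal v \<Longrightarrow> 0 \<le> v \<Longrightarrow>
      emeasure J {p. fst p \<noteq> snd p \<and> (fst p \<in> B \<or> snd p \<in> B)} \<le> ennreal (\<delta> * (2 * v * (A + \<rho> + 1)))"
proof -
  have \<nu>_dens: "\<nu> \<in> cube_densities" and \<delta>\<rho>: "\<delta> \<le> \<rho>" using \<nu> by (auto simp: density_ball_def \<delta>_def)
  have diff: "\<bar>\<kappa> x - \<nu> x\<bar> \<le> \<delta>" for x unfolding \<delta>_def by (rule abs_diff_le_sup_norm[OF \<kappa> \<nu>])
  have \<delta>0: "0 \<le> \<delta>" unfolding \<delta>_def by (rule abs_diff_le_sup_norm[OF \<kappa> \<nu>])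
  have nn: "0 \<le> \<kappa> x" "0 \<le> \<nu> x" for x using \<kappa> \<nu>_dens by (auto simp: cube_densities_def)
  have A0: "0 \<le> A" using A[of 0] nn(1)[of 0] by linarith
  have \<nu>A: "\<nu> x \<le> A + \<rho>" for x using A[of x] diff[of x] \<delta>\<rho> by linarith
  have outside: "\<kappa> x = 0" "\<nu> x = 0" if "x \<notin> unit_cube" for x
    using \<kappa> \<nu>_dens that by (auto simp: cube_densities_def)
  have meas[measurable]: "\<kappa> \<in> borel_measurable borel" "\<nu> \<in> borel_measurable borel"
    using \<kappa> \<nu>_dens by (auto simp: cube_densities_def)
  obtain J where J: "prob_space J" "sets J = sets (borel \<Otimes>\<^sub>M borel)"
    "distr J lborel fst = density lborel (\<lambda>x. ennreal (\<kappa> x))"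
    "distr J lborel snd = density lborel (\<lambda>x. ennreal (\<nu> x))"
    "\<And>B. B \<in> sets borel \<Longrightarrow> emeasure J {p. fst p \<noteq> snd p \<and> fst p \<in> B}
        \<le> (\<integral>\<^sup>+x\<in>B. (ennreal (\<kappa> x) - ennreal (\<nu> x)) \<partial>lborel)"
    "\<And>B. B \<in> sets borel \<Longrightarrow> emeasure J {p. fst p \<noteq> snd p \<and> snd p \<in> B}
        \<le> (\<integral>\<^sup>+x\<in>B. (ennreal (\<nu> x) - ennreal (\<kappa> x)) \<partial>lborel)"
    by (rule maximal_coupling_exists[of "\<lambda>x. ennreal (\<kappa> x)" "\<lambda>x. ennreal (\<nu> x)"])
      (use \<kappa> \<nu>_dens in \<open>auto simp: cube_densities_def\<close>)
  have space_J: "space J = UNIV" using sets_eq_imp_space_eq[OF J(2)] by (simp add: space_pair_measure)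
  have fs: "fst \<in> measurable J borel" "snd \<in> measurable J borel"
    unfolding measurable_cong_sets[OF J(2) refl] by simp_all
  have pred_ne: "Measurable.pred J (\<lambda>p. fst p \<noteq> snd p)" by (rule pred_neq[OF fs])
  have pred_in: "Measurable.pred J (\<lambda>p. fst p \<in> B)" "Measurable.pred J (\<lambda>p. snd p \<in> B)"
    if "B \<in> sets borel" for B
    by (rule measurable_compose[OF fs(1)] measurable_compose[OF fs(2)], use that in \<open>simp add: pred_def\<close>)+
  have union: "emeasure J {p. P p \<or> Q p} \<le> emeasure J {p. P p} + emeasure J {p. Q p}"
    if "Measurable.pred J P" "Measurable.pred J Q" for P Q
    unfolding Collect_disj_eq using that
    by (intro emeasure_subadditive) (simp_all add: pred_def space_J)
  have marg: "emeasure J {p. k p \<in> B} \<le> ennreal (v * c)"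
    if k: "k \<in> measurable J borel" "distr J lborel k = density lborel (\<lambda>x. ennreal (f x))"
      and f[measurable]: "f \<in> borel_measurable borel" and fc: "\<And>x. f x \<le> c" and c: "0 \<le> c"
      and B[measurable]: "B \<in> sets borel" and v: "emeasure lborel B = ennreal v" "0 \<le> v"
    for k :: "(real^'d) \<times> (real^'d) \<Rightarrow> real^'d" and f B v c
  proof -
    have "emeasure J {p. k p \<in> B} = emeasure (distr J lborel k) B"
      using k(1) by (subst emeasure_distr) (simp_all add: space_J vimage_def)
    also have "\<dots> = (\<integral>\<^sup>+x. ennreal (f x) * indicator B x \<partial>lborel)"
      unfolding k(2) by (rule emeasure_density) simp_all
    also have "\<dots> \<le> (\<integral>\<^sup>+x. ennreal c * indicator B x \<partial>lborel)"
      by (intro nn_integral_mono mult_right_mono ennreal_leI fc) simp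
    also have "\<dots> = ennreal (v * c)"
      using v c by (simp add: nn_integral_cmult_indicator ennreal_mult'' mult.commute)
    finally show ?thesis .
  qed
  have diff_int: "(\<integral>\<^sup>+x\<in>B. (ennreal (f x) - ennreal (g x)) \<partial>lborel) \<le> ennreal \<delta> * emeasure lborel (B \<inter> unit_cube)"
    if B: "B \<in> sets borel" and fg: "\<And>x. f x - g x \<le> \<delta>" "\<And>x. 0 \<le> g x" "\<And>x. x \<notin> unit_cube \<Longrightarrow> f x = 0"
    for f g :: "real^'d \<Rightarrow> real" and B
  proof -
    have "(\<integral>\<^sup>+x\<in>B. (ennreal (f x) - ennreal (g x)) \<partial>lborel)
        \<le> (\<integral>\<^sup>+x. ennreal \<delta> * indicator (B \<inter> unit_cube) x \<partial>lborel)"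
    proof (rule nn_integral_mono)
      fix x
      have "ennreal (f x) - ennreal (g x) \<le> ennreal \<delta> * indicator unit_cube x"
      proof (cases "x \<in> unit_cube")
        case True
        then show ?thesis using fg(1)[of x] by (simp add: ennreal_minus fg(2) ennreal_leI)
      next
        case False
        then show ?thesis by (simp add: fg(3))
      qed
      then show "(ennreal (f x) - ennreal (g x)) * indicator B x \<le> ennreal \<delta> * indicator (B \<inter> unit_cube) x"
        by (cases "x \<in> B"; cases "x \<in> unit_cube") simp_all
    qed
    also have "\<dots> = ennreal \<delta> * emeasure lborel (B \<inter> unit_cube)"
      using B by (intro nn_integral_cmult_indicator) simp
    finally show ?thesis .
  qed
  have bad: "emeasure J {p. fst p \<noteq> snd p \<and> fst p \<in> B} \<le> ennreal \<delta> * emeasure lborel (B \<inter> unit_cube)"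
    "emeasure J {p. fst p \<noteq> snd p \<and> snd p \<in> B} \<le> ennreal \<delta> * emeasure lborel (B \<inter> unit_cube)"
    if B: "B \<in> sets borel" for B
  proof -
    have "\<kappa> x - \<nu> x \<le> \<delta>" "\<nu> x - \<kappa> x \<le> \<delta>" for x using diff[of x] by linarith+
    then show "emeasure J {p. fst p \<noteq> snd p \<and> fst p \<in> B} \<le> ennreal \<delta> * emeasure lborel (B \<inter> unit_cube)"
      "emeasure J {p. fst p \<noteq> snd p \<and> snd p \<in> B} \<le> ennreal \<delta> * emeasure lborel (B \<inter> unit_cube)"
      using order_trans[OF J(5)[OF B] diff_int[OF B]] order_trans[OF J(6)[OF B] diff_int[OF B]] nn outside
      by blast+
  qed
  show thesis
  proof (rule that[OF J(1-4)])
    show "emeasure J {p. fst p \<noteq> snd p} \<le> ennreal \<delta>"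
      using bad(1)[of UNIV] by (simp add: emeasure_lborel_unit_cube)
  next
    fix B :: "(real^'d) set" and v :: real
    assume B: "B \<in> sets borel" and v: "emeasure lborel B = ennreal v" "0 \<le> v"
    have "emeasure J {p. fst p \<in> B \<or> snd p \<in> B} \<le> ennreal (v * A) + ennreal (v * (A + \<rho>))"
      using marg[OF fs(1) J(3) meas(1) A A0 B v] marg[OF fs(2) J(4) meas(2) \<nu>A _ B v] A0 \<rho>
      by (intro order_trans[OF union[OF pred_in[OF B]] add_mono]) simp_all
    also have "\<dots> = ennreal (v * A + v * (A + \<rho>))" using v A0 \<rho> by (simp add: ennreal_plus)
    also have "\<dots> \<le> ennreal (2 * v * (A + \<rho> + 1))"
      using v A0 \<rho> by (intro ennreal_leI) (simp add: algebra_simps)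
    finally show "emeasure J {p. fst p \<in> B \<or> snd p \<in> B} \<le> ennreal (2 * v * (A + \<rho> + 1))" .
    have "emeasure J {p. fst p \<noteq> snd p \<and> (fst p \<in> B \<or> snd p \<in> B)}
        \<le> emeasure J {p. fst p \<noteq> snd p \<and> fst p \<in> B} + emeasure J {p. fst p \<noteq> snd p \<and> snd p \<in> B}"
      unfolding conj_disj_distribL by (intro union pred_intros_logic(3) pred_ne pred_in B)
    also have "\<dots> \<le> ennreal \<delta> * emeasure lborel B + ennreal \<delta> * emeasure lborel B"
      using B by (intro add_mono order_trans[OF bad(1)] order_trans[OF bad(2)] mult_left_mono emeasure_mono) auto
    also have "\<dots> = ennreal (\<delta> * v + \<delta> * v)"
      unfolding v(1) ennreal_mult[OF \<delta>0 v(2), symmetric]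
      by (rule ennreal_plus[symmetric]) (use v \<delta>0 in simp_all)
    also have "\<dots> \<le> ennreal (\<delta> * (2 * v * (A + \<rho> + 1)))"
    proof (rule ennreal_leI)
      have "2 * v * 1 \<le> 2 * v * (A + \<rho> + 1)" using v A0 \<rho> by (intro mult_left_mono) auto
      from mult_left_mono[OF this \<delta>0] show "\<delta> * v + \<delta> * v \<le> \<delta> * (2 * v * (A + \<rho> + 1))" by simp
    qed
    finally show "emeasure J {p. fst p \<noteq> snd p \<and> (fst p \<in> B \<or> snd p \<in> B)}
        \<le> ennreal (\<delta> * (2 * v * (A + \<rho> + 1)))" .
  qed
qed

section \<open>Second moments of the difference of two coupled functionals\<close>

lemma prod_one_plus_indicator:
  assumes "finite I"
  shows "(\<Prod>l\<in>I. 1 + 3 * indicator A (w l) :: ennreal) = ennreal (4 ^ card {l\<in>I. w l \<in> A})"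
proof -
  have "(\<Prod>l\<in>I. 1 + 3 * indicator A (w l) :: ennreal) = (\<Prod>l\<in>I. if w l \<in> A then 4 else 1)"
    by (intro prod.cong) (auto simp: indicator_def)
  also have "\<dots> = (\<Prod>l\<in>{l\<in>I. w l \<in> A}. 4)"
    by (rule prod.inter_filter[OF assms, symmetric])
  finally show ?thesis by (simp flip: ennreal_power)
qed

lemma one_plus_mult_le_power: "0 \<le> (b::real) \<Longrightarrow> 1 + real k * b \<le> (1 + b) ^ k"
  using Bernoulli_inequality[of b k] by simp

lemma integral_PiM_UNIV_eq:
  fixes h :: "('i \<Rightarrow> 'a) \<Rightarrow> real"
  assumes J: "prob_space J" and K: "finite K"
    and h: "h \<in> borel_measurable (PiM K (\<lambda>_. J))" and res: "\<And>w. h (restrict w K) = h w"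
  shows "(\<integral>w. h w \<partial>PiM UNIV (\<lambda>_. J)) = (\<integral>w. h w \<partial>PiM K (\<lambda>_. J))"
proof -
  interpret J: prob_space J by fact
  interpret product_prob_space "\<lambda>_. J" UNIV by standard
  have "(\<integral>w. h w \<partial>PiM K (\<lambda>_. J))
      = (\<integral>w. h w \<partial>distr (PiM UNIV (\<lambda>_. J)) (PiM K (\<lambda>_. J)) (\<lambda>x. restrict x K))"
    by (subst distr_PiM_restrict_finite[OF K]) simp_all
  also have "\<dots> = (\<integral>w. h w \<partial>PiM UNIV (\<lambda>_. J))"
    by (subst integral_distr[OF measurable_restrict_subset h]) (simp_all add: res)
  finally show ?thesis ..
qed

text \<open>A local functional and a coupling of two point distributions in which pairs split with
  probability at most \<open>e\<close>, meet a given ball with probability at most \<open>b\<close>, and do both with probability at most \<open>e * b\<close>.\<close>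

locale coupled_functional =
  fixes J :: "((real^'d) \<times> (real^'d)) measure" and \<phi> :: "(real^'d) set \<Rightarrow> real" and r b e :: real
  assumes prob_J: "prob_space J" and sets_J: "sets J = sets (borel \<Otimes>\<^sub>M borel)"
    and \<phi>: "local_functional r \<phi>"
    and \<phi>_meas: "\<And>I f (M :: (nat \<Rightarrow> (real^'d) \<times> (real^'d)) measure). finite (I :: nat set) \<Longrightarrow>
        (\<And>i. i \<in> I \<Longrightarrow> f i \<in> borel_measurable M) \<Longrightarrow> (\<lambda>w. \<phi> ((\<lambda>i. f i w) ` I)) \<in> borel_measurable M"
    and b0: "0 \<le> b" and e0: "0 \<le> e"
    and near: "\<And>z. emeasure J {p. fst p \<in> cball z r \<or> snd p \<in> cball z r} \<le> ennreal b"
    and near_bad: "\<And>z. emeasure J {p. fst p \<noteq> snd p \<and> (fst p \<in> cball z r \<or> snd p \<in> cball z r)}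
        \<le> ennreal (e * b)"
    and bad: "emeasure J {p. fst p \<noteq> snd p} \<le> ennreal e"
begin

sublocale J: prob_space J by (rule prob_J)

definition Near :: "real^'d \<Rightarrow> ((real^'d) \<times> (real^'d)) set" where
  "Near z = {p. fst p \<in> cball z r \<or> snd p \<in> cball z r}"

definition Bad :: "((real^'d) \<times> (real^'d)) set" where
  "Bad = {p. fst p \<noteq> snd p}"

definition F :: "nat set \<Rightarrow> (nat \<Rightarrow> (real^'d) \<times> (real^'d)) \<Rightarrow> real" where
  "F I w = \<phi> ((\<lambda>i. fst (w i)) ` I) - \<phi> ((\<lambda>i. snd (w i)) ` I)"

text \<open>The growth rate of the bounds in the number of pairs: one factor \<open>1 + 4 * b\<close> comes from the
  exponential moment of the number of near points, the other from the number of pairs that may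
  split near the added one.\<close>

definition q :: real where "q = (1 + 4 * b)\<^sup>2"

lemma q_ge_1: "1 \<le> q"
  using b0 by (simp add: q_def)

lemma space_J: "space J = UNIV"
  using sets_eq_imp_space_eq[OF sets_J] by (simp add: space_pair_measure)

lemma sets_Near: "Near z \<in> sets J"
proof -
  have c: "Measurable.pred borel (\<lambda>x. x \<in> cball z r)" by (simp add: pred_def)
  have "Measurable.pred (borel \<Otimes>\<^sub>M borel) (\<lambda>p::(real^'d) \<times> (real^'d). fst p \<in> cball z r \<or> snd p \<in> cball z r)"
    by (intro pred_intros_logic(5); rule measurable_compose[OF _ c]) simp_all
  then show ?thesis by (simp add: pred_def space_pair_measure Near_def sets_J)
qed

lemma sets_Bad: "Bad \<in> sets J"
proof -
  have "Measurable.pred (borel \<Otimes>\<^sub>M borel) (\<lambda>p::(real^'d) \<times> (real^'d). fst p \<noteq> snd p)"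
    by measurable
  then show ?thesis by (simp add: pred_def space_pair_measure Bad_def sets_J)
qed

text \<open>If the added pair is split, each of the two increments is estimated separately. If it is not
  split and no split pair is near, then both configurations agree near the added point and the
  increments cancel. Otherwise the estimate of the first case is charged to some split near pair.
  The products are \<open>4\<close> to the number of near pairs, written so that they factorize over the
  independent pairs.\<close>

lemma F_insert_bound:
  assumes I: "finite I"
  shows "ennreal ((F (insert i I) w - F I w)\<^sup>2) \<le>
    (if w i \<in> Bad
     then 2 * (\<Prod>l\<in>I. 1 + 3 * indicator (Near (fst (w i))) (w l))
        + 2 * (\<Prod>l\<in>I. 1 + 3 * indicator (Near (snd (w i))) (w l))
     else (\<Sum>j\<in>I. 4 * (indicator (Bad \<inter> Near (fst (w i))) (w j)
        * (\<Prod>l\<in>I. 1 + 3 * indicator (Near (fst (w i))) (w l)))))"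
proof -
  define x y where "x = fst (w i)" and "y = snd (w i)"
  define X Y where "X = (\<lambda>i. fst (w i)) ` I" and "Y = (\<lambda>i. snd (w i)) ` I"
  define N where "N z = card {l\<in>I. w l \<in> Near z}" for z
  have fin: "finite X" "finite Y" using I by (auto simp: X_def Y_def)
  have D: "F (insert i I) w - F I w = (\<phi> (insert x X) - \<phi> X) - (\<phi> (insert y Y) - \<phi> Y)"
    by (simp add: F_def x_def y_def X_def Y_def)
  have sq: "(u - v)\<^sup>2 \<le> 2 * 4 ^ m + 2 * 4 ^ n" if "\<bar>u\<bar> \<le> 2 ^ m" "\<bar>v\<bar> \<le> 2 ^ n" for u v :: real and m n
  proof -
    have "\<bar>u\<bar>\<^sup>2 \<le> (2 ^ m)\<^sup>2" "\<bar>v\<bar>\<^sup>2 \<le> (2 ^ n)\<^sup>2" by (intro power_mono that abs_ge_zero)+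
    moreover have "(2 ^ m)\<^sup>2 = (4::real) ^ m" for m
      by (simp flip: power_mult_distrib add: power2_eq_square)
    ultimately have "u\<^sup>2 \<le> 4 ^ m" "v\<^sup>2 \<le> 4 ^ n" by simp_all
    moreover have "(u - v)\<^sup>2 + (u + v)\<^sup>2 = 2 * u\<^sup>2 + 2 * v\<^sup>2" by (simp add: power2_diff power2_sum)
    ultimately show ?thesis using zero_le_power2[of "u + v"] by linarith
  qed
  have le_pow: "\<bar>u\<bar> \<le> 2 ^ n" if "\<bar>u\<bar> \<le> 2 ^ m" "m \<le> n" for u :: real and m n
    using that power_increasing[of m n "2::real"] by linarith
  have Dx: "\<bar>\<phi> (insert x X) - \<phi> X\<bar> \<le> 2 ^ N x"
  proof (rule le_pow)
    show "\<bar>\<phi> (insert x X) - \<phi> X\<bar> \<le> 2 ^ card (X \<inter> cball x r)"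
      using local_functionalD[OF \<phi> fin(1)] by blast
    have "X \<inter> cball x r \<subseteq> (\<lambda>i. fst (w i)) ` {l\<in>I. w l \<in> Near x}"
      by (auto simp: X_def Near_def)
    then show "card (X \<inter> cball x r) \<le> N x"
      unfolding N_def by (rule surj_card_le[rotated]) (use I in simp)
  qed
  have Dy: "\<bar>\<phi> (insert y Y) - \<phi> Y\<bar> \<le> 2 ^ N y"
  proof (rule le_pow)
    show "\<bar>\<phi> (insert y Y) - \<phi> Y\<bar> \<le> 2 ^ card (Y \<inter> cball y r)"
      using local_functionalD[OF \<phi> fin(2)] by blast
    have "Y \<inter> cball y r \<subseteq> (\<lambda>i. snd (w i)) ` {l\<in>I. w l \<in> Near y}"
      by (auto simp: Y_def Near_def)
    then show "card (Y \<inter> cball y r) \<le> N y"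
      unfolding N_def by (rule surj_card_le[rotated]) (use I in simp)
  qed
  note D2 = sq[OF Dx Dy, folded D]
  have prd: "(\<Prod>l\<in>I. 1 + 3 * indicator (Near z) (w l)) = ennreal (4 ^ N z)" for z
    unfolding N_def by (rule prod_one_plus_indicator[OF I])
  show ?thesis
  proof (cases "w i \<in> Bad")
    case True
    have "ennreal ((F (insert i I) w - F I w)\<^sup>2) \<le> ennreal (2 * 4 ^ N x + 2 * 4 ^ N y)"
      by (rule ennreal_leI[OF D2])
    also have "\<dots> = 2 * ennreal (4 ^ N x) + 2 * ennreal (4 ^ N y)"
      by (simp add: ennreal_plus ennreal_mult)
    finally show ?thesis using True unfolding prd x_def[symmetric] y_def[symmetric] by simp
  next
    case False
    then have xy: "x = y" by (simp add: Bad_def x_def y_def)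
    show ?thesis
    proof (cases "\<exists>j\<in>I. w j \<in> Bad \<inter> Near x")
      case True
      then obtain j where j: "j \<in> I" "w j \<in> Bad \<inter> Near x" by blast
      have "ennreal ((F (insert i I) w - F I w)\<^sup>2) \<le> ennreal (4 * 4 ^ N x)"
        using D2 by (intro ennreal_leI) (simp add: xy)
      also have "\<dots> = 4 * (indicator (Bad \<inter> Near x) (w j) * ennreal (4 ^ N x))"
        using j by (simp add: ennreal_mult)
      also have "\<dots> \<le> (\<Sum>j\<in>I. 4 * (indicator (Bad \<inter> Near x) (w j) * ennreal (4 ^ N x)))"
        by (rule member_le_sum[OF j(1)]) (use I in auto)
      finally show ?thesis using \<open>w i \<notin> Bad\<close> unfolding prd x_def[symmetric] by simp
    next
      case noBad: False
      have "X \<inter> cball x r = Y \<inter> cball y r"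
      proof -
        have "fst (w j) \<in> cball x r \<longleftrightarrow> snd (w j) \<in> cball x r"
          "fst (w j) \<in> cball x r \<Longrightarrow> fst (w j) = snd (w j)" if "j \<in> I" for j
          using noBad that by (auto simp: Bad_def Near_def)
        then show ?thesis unfolding X_def Y_def xy[symmetric] by force
      qed
      then have "\<phi> (insert x X) - \<phi> X = \<phi> (insert y Y) - \<phi> Y"
        using local_functionalD[OF \<phi> fin(1), of x] local_functionalD[OF \<phi> fin(2), of y] xy by simp
      then show ?thesis using D by simp
    qed
  qed
qed

lemma F_bounded_measurable:
  assumes I: "finite I" "I \<subseteq> K"
  shows "bounded_measurable (PiM K (\<lambda>_. J)) (F I)"
proof (rule bounded_measurableI)
  have "(\<lambda>w. fst (w i)) \<in> borel_measurable (PiM K (\<lambda>_. J))"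
    "(\<lambda>w. snd (w i)) \<in> borel_measurable (PiM K (\<lambda>_. J))" if "i \<in> I" for i
  proof -
    have "(\<lambda>w. w i) \<in> measurable (PiM K (\<lambda>_. J)) (borel \<Otimes>\<^sub>M borel)"
      using measurable_component_singleton[of i K "\<lambda>_. J"] that I measurable_cong_sets[OF refl sets_J] by blast
    from measurable_compose[OF this measurable_fst] measurable_compose[OF this measurable_snd]
    show "(\<lambda>w. fst (w i)) \<in> borel_measurable (PiM K (\<lambda>_. J))"
      "(\<lambda>w. snd (w i)) \<in> borel_measurable (PiM K (\<lambda>_. J))" by auto
  qed
  then show "F I \<in> borel_measurable (PiM K (\<lambda>_. J))"
    unfolding F_def[abs_def] by (intro borel_measurable_diff \<phi>_meas I) auto
  fix w
  have "\<bar>\<phi> ((\<lambda>i. f i) ` I)\<bar> \<le> 2 ^ card I" for f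
  proof -
    have "\<bar>\<phi> (f ` I)\<bar> \<le> 2 ^ card (f ` I)" by (rule local_functional_bound[OF \<phi>]) (use I in simp)
    also have "\<dots> \<le> 2 ^ card I" using card_image_le[OF I(1)] by (rule power_increasing) simp
    finally show ?thesis .
  qed
  then show "\<bar>F I w\<bar> \<le> 2 ^ card I + 2 ^ card I"
    unfolding F_def by (intro order_trans[OF abs_triangle_ineq4 add_mono])
qed

lemma nn_integral_one_plus_Near:
  "(\<integral>\<^sup>+p. 1 + 3 * indicator (Near z) p \<partial>J) \<le> ennreal (1 + 4 * b)"
proof -
  have "(\<integral>\<^sup>+p. 1 + 3 * indicator (Near z) p \<partial>J) = 1 + 3 * emeasure J (Near z)"
    using sets_Near by (simp add: nn_integral_add nn_integral_cmult J.emeasure_space_1)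
  also have "\<dots> \<le> 1 + 3 * ennreal b"
    using near[of z] by (intro add_left_mono mult_left_mono) (auto simp: Near_def)
  also have "\<dots> = ennreal (1 + 3 * b)" using b0 by (simp add: ennreal_plus ennreal_mult)
  also have "\<dots> \<le> ennreal (1 + 4 * b)" using b0 by (intro ennreal_leI) simp
  finally show ?thesis .
qed

lemma nn_integral_prod_Near:
  assumes I: "finite I"
  shows "(\<integral>\<^sup>+w. (\<Prod>l\<in>I. 1 + 3 * indicator (Near z) (w l)) \<partial>PiM I (\<lambda>_. J)) \<le> ennreal ((1 + 4 * b) ^ card I)"
proof -
  interpret product_prob_space "\<lambda>_. J" UNIV by standard
  have "(\<integral>\<^sup>+w. (\<Prod>l\<in>I. 1 + 3 * indicator (Near z) (w l)) \<partial>PiM I (\<lambda>_. J))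
      = (\<Prod>l\<in>I. \<integral>\<^sup>+p. 1 + 3 * indicator (Near z) p \<partial>J)"
    by (rule product_nn_integral_prod[OF I]) (use sets_Near in measurable)
  also have "\<dots> \<le> (\<Prod>l\<in>I. ennreal (1 + 4 * b))"
    by (intro prod_mono_ennreal nn_integral_one_plus_Near)
  finally show ?thesis using b0 by (simp add: ennreal_power del: ennreal_plus)
qed

text \<open>By independence the expectation is a product. A pair that is split and near contributes
  \<open>1 + 3 = 4\<close> in its own factor, which explains the constant.\<close>

lemma nn_integral_bad_Near:
  assumes I: "finite I" and j: "j \<in> I"
  shows "(\<integral>\<^sup>+w. indicator (Bad \<inter> Near z) (w j) * (\<Prod>l\<in>I. 1 + 3 * indicator (Near z) (w l)) \<partial>PiM I (\<lambda>_. J))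
    \<le> ennreal (4 * e * b * (1 + 4 * b) ^ card I)"
proof -
  interpret product_prob_space "\<lambda>_. J" UNIV by standard
  define h where "h l = (if l = j then (\<lambda>p. 4 * indicator (Bad \<inter> Near z) p)
      else (\<lambda>p. 1 + 3 * indicator (Near z) p :: ennreal))" for l
  have BN: "Bad \<inter> Near z \<in> sets J" using sets_Bad sets_Near by auto
  have "indicator (Bad \<inter> Near z) (w j) * (\<Prod>l\<in>I. 1 + 3 * indicator (Near z) (w l)) = (\<Prod>l\<in>I. h l (w l))" for w
  proof -
    have "(\<Prod>l\<in>I - {j}. 1 + 3 * indicator (Near z) (w l) :: ennreal) = (\<Prod>l\<in>I - {j}. h l (w l))"
      by (intro prod.cong) (auto simp: h_def)
    then show ?thesis unfolding prod.remove[OF I j] by (auto simp: h_def indicator_def)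
  qed
  then have "(\<integral>\<^sup>+w. indicator (Bad \<inter> Near z) (w j) * (\<Prod>l\<in>I. 1 + 3 * indicator (Near z) (w l)) \<partial>PiM I (\<lambda>_. J))
      = (\<integral>\<^sup>+w. (\<Prod>l\<in>I. h l (w l)) \<partial>PiM I (\<lambda>_. J))" by simp
  also have "\<dots> = (\<Prod>l\<in>I. \<integral>\<^sup>+p. h l p \<partial>J)"
    by (rule product_nn_integral_prod[OF I]) (use sets_Near BN in \<open>auto simp: h_def\<close>)
  also have "\<dots> = (\<integral>\<^sup>+p. h j p \<partial>J) * (\<Prod>l\<in>I - {j}. \<integral>\<^sup>+p. h l p \<partial>J)" by (rule prod.remove[OF I j])
  also have "\<dots> \<le> ennreal (4 * e * b) * (\<Prod>l\<in>I - {j}. ennreal (1 + 4 * b))"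
  proof (intro mult_mono prod_mono_ennreal)
    have "(\<integral>\<^sup>+p. h j p \<partial>J) = 4 * emeasure J (Bad \<inter> Near z)"
      using BN by (simp add: h_def nn_integral_cmult)
    also have "\<dots> \<le> 4 * ennreal (e * b)"
    proof -
      have "Bad \<inter> Near z = {p. fst p \<noteq> snd p \<and> (fst p \<in> cball z r \<or> snd p \<in> cball z r)}"
        by (auto simp: Bad_def Near_def)
      then show ?thesis using near_bad[of z] by (intro mult_left_mono) simp_all
    qed
    also have "\<dots> = ennreal (4 * e * b)"
      using b0 e0 by (subst ennreal_numeral[symmetric], subst ennreal_mult[symmetric]) (simp_all add: mult.assoc)
    finally show "(\<integral>\<^sup>+p. h j p \<partial>J) \<le> ennreal (4 * e * b)" .
    show "(\<integral>\<^sup>+p. h l p \<partial>J) \<le> ennreal (1 + 4 * b)" if "l \<in> I - {j}" for l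
      using that nn_integral_one_plus_Near by (simp add: h_def)
  qed simp_all
  also have "\<dots> = ennreal (4 * e * b * (1 + 4 * b) ^ card (I - {j}))"
    using b0 e0 by (subst prod_constant, subst ennreal_power) (simp_all add: ennreal_mult[symmetric] del: ennreal_plus)
  also have "\<dots> \<le> ennreal (4 * e * b * (1 + 4 * b) ^ card I)"
    using b0 e0 I by (intro ennreal_leI mult_left_mono power_increasing card_mono) auto
  finally show ?thesis .
qed

text \<open>With \<open>\<theta> = 1 + 4 * b\<close>, splitting of the added pair contributes \<open>4 * e * \<theta> ^ k\<close>, and splitting of
  one of the \<open>k\<close> other pairs near it contributes \<open>16 * e * k * b * \<theta> ^ k\<close>. The sum is absorbed by
  \<open>1 + 4 * k * b \<le> \<theta> ^ k\<close>.\<close>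

lemma F_insert_moment:
  assumes I: "finite I" "i \<notin> I"
  shows "(\<integral>w. (F (insert i I) w - F I w)\<^sup>2 \<partial>PiM (insert i I) (\<lambda>_. J)) \<le> 4 * e * q ^ card I"
proof (rule integral_real_bounded)
  interpret product_prob_space "\<lambda>_. J" UNIV by standard
  define k where "k = card I"
  define \<theta> where "\<theta> = 1 + 4 * b"
  have \<theta>1: "1 \<le> \<theta>" using b0 by (simp add: \<theta>_def)
  let ?D = "\<lambda>w. ennreal ((F (insert i I) w - F I w)\<^sup>2)"
  have "bounded_measurable (PiM (insert i I) (\<lambda>_. J)) (\<lambda>w. (F (insert i I) w - F I w)\<^sup>2)"
    by (intro bounded_measurable_power2 bounded_measurable_diff F_bounded_measurable) (use I in auto)
  then have "?D \<in> borel_measurable (PiM (insert i I) (\<lambda>_. J))"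
    by (auto simp: bounded_measurable_def)
  then have "(\<integral>\<^sup>+w. ?D w \<partial>PiM (insert i I) (\<lambda>_. J)) = (\<integral>\<^sup>+p. \<integral>\<^sup>+w. ?D (fun_upd w i p) \<partial>PiM I (\<lambda>_. J) \<partial>J)"
    by (rule product_nn_integral_insert_rev[OF I])
  also have "\<dots> \<le> (\<integral>\<^sup>+p. ennreal (4 * \<theta> ^ k) * indicator Bad p + ennreal (16 * e * k * b * \<theta> ^ k) \<partial>J)"
  proof (rule nn_integral_mono)
    fix p
    let ?U = "\<lambda>z w. (\<Prod>l\<in>I. 1 + 3 * indicator (Near z) (w l) :: ennreal)"
    let ?B = "\<lambda>w. if p \<in> Bad then 2 * ?U (fst p) w + 2 * ?U (snd p) w
        else (\<Sum>j\<in>I. 4 * (indicator (Bad \<inter> Near (fst p)) (w j) * ?U (fst p) w))"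
    have U_meas: "?U z \<in> borel_measurable (PiM I (\<lambda>_. J))" for z
      using sets_Near[of z] by measurable
    have i_meas: "(\<lambda>w. indicator (Bad \<inter> Near z) (w j) * ?U z w) \<in> borel_measurable (PiM I (\<lambda>_. J))"
      if "j \<in> I" for z j
      using sets_Near[of z] sets_Bad that by measurable
    have "(\<integral>\<^sup>+w. ?D (fun_upd w i p) \<partial>PiM I (\<lambda>_. J)) \<le> (\<integral>\<^sup>+w. ?B w \<partial>PiM I (\<lambda>_. J))"
    proof (rule nn_integral_mono)
      fix w
      have "(fun_upd w i p) l = w l" if "l \<in> I" for l using that I by auto
      then have upd: "(\<Prod>l\<in>I. 1 + 3 * indicator (Near z) (fun_upd w i p l)) = ?U z w"
        "(\<Sum>j\<in>I. 4 * (indicator (Bad \<inter> Near z) (fun_upd w i p j) * u))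
          = (\<Sum>j\<in>I. 4 * (indicator (Bad \<inter> Near z) (w j) * u))" for z and u :: ennreal
        by (auto intro!: prod.cong sum.cong)
      show "?D (fun_upd w i p) \<le> ?B w"
        using F_insert_bound[OF I(1), of i "fun_upd w i p"] unfolding upd fun_upd_same .
    qed
    also have "\<dots> \<le> ennreal (4 * \<theta> ^ k) * indicator Bad p + ennreal (16 * e * k * b * \<theta> ^ k)"
    proof (cases "p \<in> Bad")
      case True
      have "(\<integral>\<^sup>+w. ?B w \<partial>PiM I (\<lambda>_. J))
          = 2 * (\<integral>\<^sup>+w. ?U (fst p) w \<partial>PiM I (\<lambda>_. J)) + 2 * (\<integral>\<^sup>+w. ?U (snd p) w \<partial>PiM I (\<lambda>_. J))"
        using True U_meas by (simp add: nn_integral_add nn_integral_cmult)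
      also have "\<dots> \<le> 2 * ennreal (\<theta> ^ k) + 2 * ennreal (\<theta> ^ k)"
        unfolding \<theta>_def k_def by (intro add_mono mult_left_mono nn_integral_prod_Near I) simp_all
      also have "\<dots> = ennreal (4 * \<theta> ^ k)"
        using \<theta>1 by (simp add: ennreal_mult flip: distrib_right)
      finally show ?thesis using True by (simp add: add_increasing2)
    next
      case False
      have "(\<integral>\<^sup>+w. ?B w \<partial>PiM I (\<lambda>_. J))
          = (\<Sum>j\<in>I. 4 * (\<integral>\<^sup>+w. indicator (Bad \<inter> Near (fst p)) (w j) * ?U (fst p) w \<partial>PiM I (\<lambda>_. J)))"
        using False i_meas by (simp add: nn_integral_sum nn_integral_cmult)
      also have "\<dots> \<le> (\<Sum>j\<in>I. 4 * ennreal (4 * e * b * \<theta> ^ k))"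
        unfolding \<theta>_def k_def by (intro sum_mono mult_left_mono nn_integral_bad_Near I) simp_all
      also have "\<dots> = (\<Sum>j\<in>I. ennreal (4 * (4 * e * b * \<theta> ^ k)))"
        by (intro sum.cong refl) (simp only: ennreal_mult' ennreal_numeral)
      also have "\<dots> = ennreal (\<Sum>j\<in>I. 4 * (4 * e * b * \<theta> ^ k))"
        using b0 e0 \<theta>1 by (intro sum_ennreal) simp
      also have "(\<Sum>j\<in>I. 4 * (4 * e * b * \<theta> ^ k)) = 16 * e * k * b * \<theta> ^ k" by (simp add: k_def)
      finally show ?thesis using False by simp
    qed
    finally show "(\<integral>\<^sup>+w. ?D (fun_upd w i p) \<partial>PiM I (\<lambda>_. J))
        \<le> ennreal (4 * \<theta> ^ k) * indicator Bad p + ennreal (16 * e * k * b * \<theta> ^ k)" .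
  qed
  also have "\<dots> = ennreal (4 * \<theta> ^ k) * emeasure J Bad + ennreal (16 * e * k * b * \<theta> ^ k)"
    using sets_Bad by (simp add: nn_integral_add nn_integral_cmult J.emeasure_space_1)
  also have "\<dots> \<le> ennreal (4 * \<theta> ^ k) * ennreal e + ennreal (16 * e * k * b * \<theta> ^ k)"
    using bad by (intro add_right_mono mult_left_mono) (auto simp: Bad_def)
  also have "\<dots> = ennreal (4 * \<theta> ^ k * e + 16 * e * k * b * \<theta> ^ k)"
    using b0 e0 \<theta>1 by (simp add: ennreal_mult ennreal_plus)
  also have "\<dots> \<le> ennreal (4 * e * q ^ k)"
  proof (rule ennreal_leI)
    have "4 * \<theta> ^ k * e + 16 * e * k * b * \<theta> ^ k = 4 * e * \<theta> ^ k * (1 + k * (4 * b))"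
      by (simp add: algebra_simps)
    also have "\<dots> \<le> 4 * e * \<theta> ^ k * \<theta> ^ k"
      unfolding \<theta>_def using b0 e0 by (intro mult_left_mono one_plus_mult_le_power) auto
    also have "\<dots> = 4 * e * q ^ k" by (simp add: q_def \<theta>_def power2_eq_square power_mult_distrib)
    finally show "4 * \<theta> ^ k * e + 16 * e * k * b * \<theta> ^ k \<le> 4 * e * q ^ k" .
  qed
  finally show "(\<integral>\<^sup>+w. ?D w \<partial>PiM (insert i I) (\<lambda>_. J)) \<le> ennreal (4 * e * q ^ card I)"
    by (simp add: k_def)
  show "0 \<le> 4 * e * q ^ card I" using e0 q_ge_1 by simp
qed

lemma F_restrict: "I \<subseteq> K \<Longrightarrow> F I (restrict w K) = F I w"
proof -
  assume "I \<subseteq> K"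
  then have "(\<lambda>i. g (restrict w K i)) ` I = (\<lambda>i. g (w i)) ` I" for g :: "_ \<Rightarrow> real^'d"
    by (intro image_cong) auto
  then show ?thesis unfolding F_def by (simp only:)
qed

abbreviation \<Omega> :: "(nat \<Rightarrow> (real^'d) \<times> (real^'d)) measure" where "\<Omega> \<equiv> PiM UNIV (\<lambda>_. J)"

sublocale \<Omega>: prob_space \<Omega> by (intro prob_space_PiM prob_J)

definition mean :: "nat \<Rightarrow> real" where "mean k = (\<integral>w. F {1..k} w \<partial>\<Omega>)"

lemma F_bm_\<Omega>: "finite I \<Longrightarrow> bounded_measurable \<Omega> (F I)"
  by (rule F_bounded_measurable) auto

lemma variance_F: "(\<integral>w. (F {1..k} w - mean k)\<^sup>2 \<partial>\<Omega>) \<le> 4 * e * k * q ^ k"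
proof -
  let ?P = "PiM {1..k} (\<lambda>_. J)"
  have bm: "bounded_measurable ?P (F I)" if "I \<subseteq> {1..k}" for I
    by (rule F_bounded_measurable) (use that finite_subset in auto)
  have bm1: "F {1..k} \<in> borel_measurable ?P" using bm[of "{1..k}"] by (simp add: bounded_measurable_def)
  have mean: "mean k = (\<integral>w. F {1..k} w \<partial>?P)"
    unfolding mean_def by (rule integral_PiM_UNIV_eq[OF prob_J _ bm1]) (simp_all add: F_restrict)
  have "(\<integral>w. (F {1..k} w - mean k)\<^sup>2 \<partial>\<Omega>) = (\<integral>w. (F {1..k} w - mean k)\<^sup>2 \<partial>?P)"
    by (rule integral_PiM_UNIV_eq[OF prob_J]) (use bm1 in \<open>simp_all add: F_restrict\<close>)
  also have "\<dots> \<le> (\<Sum>i\<in>{1..k}. \<integral>w. (F {1..k} w - F ({1..k} - {i}) w)\<^sup>2 \<partial>?P)"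
    unfolding mean
  proof (rule efron_stein[OF prob_J])
    fix i w and y :: "(real^'d) \<times> (real^'d)"
    have "(\<lambda>j. g ((fun_upd w i y) j)) ` ({1..k} - {i}) = (\<lambda>j. g (w j)) ` ({1..k} - {i})"
      for g :: "_ \<Rightarrow> real^'d" by (intro image_cong) auto
    then show "F ({1..k} - {i}) (fun_upd w i y) = F ({1..k} - {i}) w" unfolding F_def by (simp only:)
  qed (rule finite_atLeastAtMost | rule bm, rule subset_refl | rule bm, rule Diff_subset)+
  also have "\<dots> \<le> (\<Sum>i\<in>{1..k}. 4 * e * q ^ k)"
  proof (rule sum_mono)
    fix i assume i: "i \<in> {1..k}"
    then have ins: "{1..k} = insert i ({1..k} - {i})" by auto
    have "(\<integral>w. (F {1..k} w - F ({1..k} - {i}) w)\<^sup>2 \<partial>?P) \<le> 4 * e * q ^ card ({1..k} - {i})"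
      using F_insert_moment[of "{1..k} - {i}" i] i by (simp only: ins[symmetric]) simp
    also have "\<dots> \<le> 4 * e * q ^ k"
      using e0 q_ge_1 by (intro mult_left_mono power_increasing) (auto simp: card_Diff_subset_Int)
    finally show "(\<integral>w. (F {1..k} w - F ({1..k} - {i}) w)\<^sup>2 \<partial>?P) \<le> 4 * e * q ^ k" .
  qed
  also have "\<dots> = 4 * e * k * q ^ k" by simp
  finally show ?thesis .
qed

lemma mean_step: "(mean (Suc k) - mean k)\<^sup>2 \<le> 4 * e * q ^ k"
proof -
  have ins: "{1..Suc k} = insert (Suc k) {1..k}" by auto
  let ?D = "\<lambda>w. F {1..Suc k} w - F {1..k} w"
  have "mean (Suc k) - mean k = (\<integral>w. ?D w \<partial>\<Omega>)"
    unfolding mean_def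
    by (intro Bochner_Integration.integral_diff[symmetric] bounded_measurable_integrable F_bm_\<Omega> \<Omega>.finite_measure_axioms) auto
  then have "(mean (Suc k) - mean k)\<^sup>2 = (\<integral>w. ?D w \<partial>\<Omega>)\<^sup>2" by simp
  also have "\<dots> \<le> (\<integral>w. (?D w)\<^sup>2 \<partial>\<Omega>)"
    by (intro square_integral_le \<Omega>.prob_space_axioms bounded_measurable_diff F_bm_\<Omega>) auto
  also have "\<dots> = (\<integral>w. (?D w)\<^sup>2 \<partial>PiM {1..Suc k} (\<lambda>_. J))"
  proof (rule integral_PiM_UNIV_eq[OF prob_J])
    have "bounded_measurable (PiM {1..Suc k} (\<lambda>_. J)) (\<lambda>w. (?D w)\<^sup>2)"
      by (intro bounded_measurable_power2 bounded_measurable_diff F_bounded_measurable) auto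
    then show "(\<lambda>w. (?D w)\<^sup>2) \<in> borel_measurable (PiM {1..Suc k} (\<lambda>_. J))"
      by (simp add: bounded_measurable_def)
    show "(?D (restrict w {1..Suc k}))\<^sup>2 = (?D w)\<^sup>2" for w
      by (subst (1 2) F_restrict) auto
  qed simp
  also have "\<dots> \<le> 4 * e * q ^ card {1..k}"
    unfolding ins by (rule F_insert_moment) auto
  also have "4 * e * q ^ card {1..k} = 4 * e * q ^ k" by simp
  finally show ?thesis .
qed

lemma mean_diff:
  assumes "l \<le> k"
  shows "(mean k - mean l)\<^sup>2 \<le> 4 * e * (real k - real l)\<^sup>2 * q ^ k"
proof -
  \<comment> \<open>A common bound for the steps of the mean up to \<open>k\<close>, since \<open>q\<close> is at least \<open>1\<close>.\<close>
  define s where "s = sqrt (4 * e * q ^ k)"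
  have s0: "0 \<le> s" and s2: "s\<^sup>2 = 4 * e * q ^ k" using e0 q_ge_1 by (auto simp: s_def)
  have step: "\<bar>mean (Suc j) - mean j\<bar> \<le> s" if "j \<le> k" for j
  proof -
    have "4 * e * q ^ j \<le> 4 * e * q ^ k"
      using e0 q_ge_1 that by (intro mult_left_mono power_increasing) auto
    with mean_step[of j] have "(mean (Suc j) - mean j)\<^sup>2 \<le> s\<^sup>2" unfolding s2 by linarith
    then show ?thesis using s0 abs_le_square_iff[of "mean (Suc j) - mean j" s] by simp
  qed
  have "j \<le> k \<Longrightarrow> \<bar>mean j - mean l\<bar> \<le> (real j - real l) * s" if "l \<le> j" for j
    using that
  proof (induction j rule: dec_induct)
    case (step j)
    have "\<bar>mean (Suc j) - mean l\<bar> \<le> \<bar>mean (Suc j) - mean j\<bar> + \<bar>mean j - mean l\<bar>" by linarith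
    also have "\<dots> \<le> s + (real j - real l) * s"
      using step \<open>\<And>j. j \<le> k \<Longrightarrow> \<bar>mean (Suc j) - mean j\<bar> \<le> s\<close> by (intro add_mono) auto
    also have "\<dots> = (real (Suc j) - real l) * s" by (simp add: algebra_simps)
    finally show ?case .
  qed simp
  from this[of k] assms have "\<bar>mean k - mean l\<bar> \<le> (real k - real l) * s" by simp
  then have "\<bar>mean k - mean l\<bar>\<^sup>2 \<le> ((real k - real l) * s)\<^sup>2" by (intro power_mono) auto
  then show ?thesis by (simp add: power_mult_distrib s2 mult_ac)
qed

text \<open>The second moment is taken about the mean for \<open>n\<close> pairs although the number of pairs is \<open>k\<close>. Since
  this centre is the same for all \<open>k\<close>, integrating the bound over a random \<open>k\<close> bounds the variance.\<close>

lemma F_second_moment: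
  "(\<integral>w. (F {1..k} w - mean n)\<^sup>2 \<partial>\<Omega>) \<le> 4 * e * ((real k + (real k - real n)\<^sup>2) * (q ^ k + q ^ n))"
proof -
  have q0: "0 \<le> q ^ m" for m using q_ge_1 by simp
  have F: "bounded_measurable \<Omega> (F {1..k})" by (rule F_bm_\<Omega>) simp
  have "(\<integral>w. (F {1..k} w - mean n)\<^sup>2 \<partial>\<Omega>)
      = (\<integral>w. (F {1..k} w - mean k)\<^sup>2 \<partial>\<Omega>) + (mean k - mean n)\<^sup>2"
    unfolding mean_def[of k]
    by (intro second_moment_shift \<Omega>.prob_space_axioms bounded_measurable_integrable
        bounded_measurable_power2 F \<Omega>.finite_measure_axioms)
  also have "\<dots> \<le> 4 * e * k * q ^ k + 4 * e * (real k - real n)\<^sup>2 * (q ^ k + q ^ n)"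
  proof (intro add_mono variance_F)
    show "(mean k - mean n)\<^sup>2 \<le> 4 * e * (real k - real n)\<^sup>2 * (q ^ k + q ^ n)"
    proof (cases "n \<le> k")
      case True
      from mean_diff[OF True] show ?thesis
        using mult_left_mono[of "q ^ k" "q ^ k + q ^ n" "4 * e * (real k - real n)\<^sup>2"] q0 e0 by simp
    next
      case False
      then have "(mean n - mean k)\<^sup>2 \<le> 4 * e * (real n - real k)\<^sup>2 * q ^ n" by (intro mean_diff) simp
      then show ?thesis
        using mult_left_mono[of "q ^ n" "q ^ k + q ^ n" "4 * e * (real n - real k)\<^sup>2"] q0 e0
        by (simp add: power2_commute)
    qed
  qed
  also have "4 * e * k * q ^ k \<le> 4 * e * k * (q ^ k + q ^ n)"
    using q0 e0 by (intro mult_left_mono) simp_all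
  finally show ?thesis by (simp add: algebra_simps)
qed

end

section \<open>Poisson processes as mixed samples\<close>

text \<open>The level sets of a variable with natural values, together with the empty set, are stable under
  intersection and generate its sigma-algebra.\<close>

lemma (in prob_space) indep_vars_natI:
  fixes C :: "'i \<Rightarrow> 'a \<Rightarrow> nat"
  assumes C[measurable]: "\<And>i. i \<in> I \<Longrightarrow> C i \<in> measurable M (count_space UNIV)"
    and prod: "\<And>S k. finite S \<Longrightarrow> S \<subseteq> I \<Longrightarrow>
      prob {w\<in>space M. \<forall>j\<in>S. C j w = k j} = (\<Prod>j\<in>S. prob {w\<in>space M. C j w = k j})"
  shows "indep_vars (\<lambda>_. count_space UNIV) C I"
proof -
  define E where "E i = insert {} (range (\<lambda>k. {w\<in>space M. C i w = k}))" for i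
  have ev: "{w\<in>space M. C i w = k} \<in> events" if "i \<in> I" for i k
  proof -
    note C[OF that, measurable]
    show ?thesis by measurable
  qed
  have "indep_sets E I"
  proof (rule indep_setsI)
    show "E i \<subseteq> events" if "i \<in> I" for i using ev[OF that] by (auto simp: E_def)
  next
    fix A S assume S: "S \<noteq> {}" "S \<subseteq> I" "finite S" and A: "\<forall>j\<in>S. A j \<in> E j"
    show "prob (\<Inter>j\<in>S. A j) = (\<Prod>j\<in>S. prob (A j))"
    proof (cases "\<exists>j\<in>S. A j = {}")
      case True
      then have "(\<Inter>j\<in>S. A j) = {}" by auto
      moreover have "(\<Prod>j\<in>S. prob (A j)) = 0" using True measure_empty[of M] by (intro prod_zero[OF S(3)]) metis
      ultimately show ?thesis by simp
    next
      case False
      then have "\<forall>j\<in>S. \<exists>k. A j = {w\<in>space M. C j w = k}" using A unfolding E_def by blast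
      then obtain k where k: "\<And>j. j \<in> S \<Longrightarrow> A j = {w\<in>space M. C j w = k j}" by metis
      have "(\<Inter>j\<in>S. A j) = {w\<in>space M. \<forall>j\<in>S. C j w = k j}" using k S(1) by auto
      moreover have "(\<Prod>j\<in>S. prob (A j)) = (\<Prod>j\<in>S. prob {w\<in>space M. C j w = k j})"
        using k by (intro prod.cong) auto
      ultimately show ?thesis using prod[OF S(3,2)] by simp
    qed
  qed
  then have "indep_sets (\<lambda>i. sigma_sets (space M) (E i)) I"
    by (rule indep_sets_sigma) (auto simp: E_def Int_stable_def)
  then have "indep_sets (\<lambda>i. {C i -` A \<inter> space M | A. A \<in> sets (count_space UNIV)}) I"
  proof (rule indep_sets_mono_sets, safe)
    fix i and A :: "nat set" assume "i \<in> I"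
    have "C i -` A \<inter> space M = (\<Union>k. if k \<in> A then {w\<in>space M. C i w = k} else {})"
      by (auto split: if_splits)
    also have "\<dots> \<in> sigma_sets (space M) (E i)"
      by (rule sigma_sets.Union) (auto simp: E_def intro: sigma_sets.Basic sigma_sets.Empty)
    finally show "C i -` A \<inter> space M \<in> sigma_sets (space M) (E i)" .
  qed
  with C show ?thesis unfolding indep_vars_def2 by simp
qed

lemma pred_eq_nat:
  assumes [measurable]: "f \<in> measurable M (count_space UNIV)"
  shows "Measurable.pred M (\<lambda>x. f x = (k :: nat))"
  by measurable

lemma measurable_partition_counts:
  fixes B :: "'j \<Rightarrow> 'b set"
  assumes S: "finite S" and B: "\<And>j. j \<in> S \<Longrightarrow> B j \<in> sets J"
  shows "(\<lambda>w. if \<forall>j\<in>S. card {i\<in>{1..N}. w i \<in> B j} = k j then 1 else 0 :: real)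
    \<in> borel_measurable (PiM {1..N} (\<lambda>_::nat. J))"
proof -
  have "Measurable.pred (PiM {1..N} (\<lambda>_::nat. J)) (\<lambda>w. card {i\<in>{1..N}. w i \<in> B j} = k j)" if "j \<in> S" for j
  proof -
    have "{w\<in>space (PiM {1..N} (\<lambda>_::nat. J)). i \<in> {i\<in>{1..N}. w i \<in> B j}} \<in> sets (PiM {1..N} (\<lambda>_. J))" for i
    proof (cases "i \<in> {1..N}")
      case True
      then have "(\<lambda>w. w i) \<in> measurable (PiM {1..N} (\<lambda>_. J)) J" by (rule measurable_component_singleton)
      from measurable_sets[OF this B[OF that]] True show ?thesis
        by (simp add: vimage_def Int_def conj_commute)
    next
      case False
      then have "{w\<in>space (PiM {1..N} (\<lambda>_::nat. J)). i \<in> {i\<in>{1..N}. w i \<in> B j}} = {}" by blast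
      then show ?thesis by (simp only: sets.empty_sets)
    qed
    then have "(\<lambda>w. card {i\<in>{1..N}. w i \<in> B j}) \<in> measurable (PiM {1..N} (\<lambda>_. J)) (count_space UNIV)"
      by (rule measurable_card)
    then show ?thesis by (rule pred_eq_nat)
  qed
  then have "Measurable.pred (PiM {1..N} (\<lambda>_::nat. J)) (\<lambda>w. \<forall>j\<in>S. card {i\<in>{1..N}. w i \<in> B j} = k j)"
    by (intro pred_intros_finite(3) S)
  then show ?thesis
    unfolding pred_def by (intro measurable_If borel_measurable_const)
qed

text \<open>The multinomial distribution of the occupation numbers of a partition, by induction on the number
  of points: the last point falls into some cell \<open>B j\<close>, and the other points have to supply one
  point less for this cell.\<close>

lemma multinomial_counts:
  fixes B :: "'j \<Rightarrow> 'b set"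
  assumes J: "prob_space J" and S: "finite S"
    and B: "\<And>j. j \<in> S \<Longrightarrow> B j \<in> sets J" "disjoint_family_on B S" "(\<Union>j\<in>S. B j) = space J"
  shows "(\<integral>w. (if \<forall>j\<in>S. card {i\<in>{1..N}. w i \<in> B j} = k j then 1 else 0 :: real) \<partial>PiM {1..N} (\<lambda>_. J))
    = (if sum k S = N then fact N * (\<Prod>j\<in>S. measure J (B j) ^ k j / fact (k j)) else 0)"
proof (induction N arbitrary: k)
  case 0
  interpret P: prob_space "PiM {1..0} (\<lambda>_::nat. J)" by (intro prob_space_PiM J)
  have "sum k S = 0 \<longleftrightarrow> (\<forall>j\<in>S. 0 = k j)" using S by auto
  then show ?case
    by (cases "\<forall>j\<in>S. 0 = k j") (auto simp: P.prob_space[simplified])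
next
  case (Suc N)
  interpret J: prob_space J by fact
  let ?P = "PiM {1..N} (\<lambda>_::nat. J)" and ?P' = "PiM (insert (Suc N) {1..N}) (\<lambda>_::nat. J)"
  interpret P: prob_space ?P by (intro prob_space_PiM J)
  let ?p = "\<lambda>j. measure J (B j)"
  define G where "G N k w = (if \<forall>j\<in>S. card {i\<in>{1..N}. w i \<in> B j} = k j then 1 else 0 :: real)"
    for N :: nat and k and w :: "nat \<Rightarrow> 'b"
  have ins: "{1..Suc N} = insert (Suc N) {1..N}" by auto
  have bm: "bounded_measurable (PiM {1..N} (\<lambda>_. J)) (G N k)" for N k
  proof (rule bounded_measurableI)
    show "G N k \<in> borel_measurable (PiM {1..N} (\<lambda>_. J))"
      unfolding G_def[abs_def] by (rule measurable_partition_counts[OF S B(1)])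
    show "\<bar>G N k w\<bar> \<le> 1" for w by (simp add: G_def)
  qed
  have rec: "G (Suc N) k (fun_upd w (Suc N) y)
      = (\<Sum>j\<in>S. indicator (B j) y * (if k j = 0 then 0 else G N (fun_upd k j (k j - 1)) w))"
    if y: "y \<in> space J" for w y
  proof -
    obtain j1 where j1: "j1 \<in> S" "y \<in> B j1" using y B(3) by auto
    have yB: "y \<in> B j \<longleftrightarrow> j = j1" if "j \<in> S" for j
      using B(2) j1 that by (auto simp: disjoint_family_on_def)
    have cnt: "card {i\<in>{1..Suc N}. fun_upd w (Suc N) y i \<in> B j}
        = card {i\<in>{1..N}. w i \<in> B j} + (if j = j1 then 1 else 0)" if "j \<in> S" for j
    proof -
      have "{i\<in>{1..Suc N}. fun_upd w (Suc N) y i \<in> B j}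
          = {i\<in>{1..N}. w i \<in> B j} \<union> (if j = j1 then {Suc N} else {})"
        using yB[OF that] by auto
      then show ?thesis by (simp add: card_insert_if)
    qed
    have "(\<forall>j\<in>S. card {i\<in>{1..Suc N}. fun_upd w (Suc N) y i \<in> B j} = k j)
        \<longleftrightarrow> k j1 \<noteq> 0 \<and> (\<forall>j\<in>S. card {i\<in>{1..N}. w i \<in> B j} = fun_upd k j1 (k j1 - 1) j)"
      using cnt j1 by (auto simp: all_conj_distrib split: if_splits)
    then have "G (Suc N) k (fun_upd w (Suc N) y)
        = (if k j1 = 0 then 0 else G N (fun_upd k j1 (k j1 - 1)) w)" by (simp add: G_def)
    also have "\<dots> = (\<Sum>j\<in>S. if j = j1 then (if k j = 0 then 0 else G N (fun_upd k j (k j - 1)) w) else 0)"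
      using S j1 by simp
    also have "\<dots> = (\<Sum>j\<in>S. indicator (B j) y * (if k j = 0 then 0 else G N (fun_upd k j (k j - 1)) w))"
      by (intro sum.cong refl) (use yB in \<open>auto simp: indicator_def\<close>)
    finally show ?thesis .
  qed
  define Q where "Q N k = (if sum k S = N then fact N * (\<Prod>j\<in>S. ?p j ^ k j / fact (k j)) else 0)" for N k
  have IH: "(\<integral>w. G N k w \<partial>?P) = Q N k" for k
    unfolding G_def Q_def by (rule Suc.IH)
  have "(\<integral>w. G (Suc N) k w \<partial>?P') = (\<integral>w. \<integral>y. G (Suc N) k (fun_upd w (Suc N) y) \<partial>J \<partial>?P)"
    by (rule integral_PiM_insert(1)[OF J]) (use bm[of "Suc N" k, unfolded ins] in auto)
  also have "\<dots> = (\<integral>w. \<integral>y. (\<Sum>j\<in>S. indicator (B j) y * (if k j = 0 then 0 else G N (fun_upd k j (k j - 1)) w)) \<partial>J \<partial>?P)"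
    by (intro Bochner_Integration.integral_cong refl rec)
  also have "\<dots> = (\<integral>w. (\<Sum>j\<in>S. ?p j * (if k j = 0 then 0 else G N (fun_upd k j (k j - 1)) w)) \<partial>?P)"
  proof (intro Bochner_Integration.integral_cong refl)
    fix w
    have int: "integrable J (\<lambda>y. indicator (B j) y :: real)" if "j \<in> S" for j
      using B(1)[OF that] by (simp add: J.emeasure_eq_measure)
    have "B j \<inter> space J = B j" if "j \<in> S" for j
      using sets.sets_into_space[OF B(1)[OF that]] by auto
    then show "(\<integral>y. (\<Sum>j\<in>S. indicator (B j) y * (if k j = 0 then 0 else G N (fun_upd k j (k j - 1)) w)) \<partial>J)
        = (\<Sum>j\<in>S. ?p j * (if k j = 0 then 0 else G N (fun_upd k j (k j - 1)) w))"
      by (subst Bochner_Integration.integral_sum) (auto intro!: sum.cong int integrable_mult_left)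
  qed
  also have "\<dots> = (\<Sum>j\<in>S. ?p j * (if k j = 0 then 0 else Q N (fun_upd k j (k j - 1))))"
  proof -
    have int: "integrable ?P (G N k)" for k
      by (intro bounded_measurable_integrable P.finite_measure_axioms bm)
    have "(\<integral>w. (\<Sum>j\<in>S. ?p j * (if k j = 0 then 0 else G N (fun_upd k j (k j - 1)) w)) \<partial>?P)
        = (\<Sum>j\<in>S. \<integral>w. ?p j * (if k j = 0 then 0 else G N (fun_upd k j (k j - 1)) w) \<partial>?P)"
    proof (rule Bochner_Integration.integral_sum)
      show "integrable ?P (\<lambda>w. ?p j * (if k j = 0 then 0 else G N (fun_upd k j (k j - 1)) w))" for j
        by (cases "k j = 0") (use int[of "fun_upd k j (k j - 1)"] in simp_all)
    qed
    also have "\<dots> = (\<Sum>j\<in>S. ?p j * (if k j = 0 then 0 else Q N (fun_upd k j (k j - 1))))"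
      by (intro sum.cong refl) (simp add: IH[unfolded One_nat_def])
    finally show ?thesis .
  qed
  also have "\<dots> = Q (Suc N) k"
  proof (cases "sum k S = Suc N")
    case True
    let ?R = "\<Prod>j\<in>S. ?p j ^ k j / fact (k j)"
    have "?p j * (if k j = 0 then 0 else Q N (fun_upd k j (k j - 1))) = fact N * ?R * k j" if j: "j \<in> S" for j
    proof (cases "k j")
      case (Suc m)
      have S_eq: "S = insert j (S - {j})" using j by auto
      have "sum (fun_upd k j m) S = m + sum k (S - {j})"
        using S j by (subst sum.remove[of S j]) (auto intro!: sum.cong)
      moreover have "sum k S = Suc m + sum k (S - {j})" using S j Suc by (simp add: sum.remove)
      ultimately have sm: "sum (fun_upd k j m) S = N" using True by simp
      define W where "W = (\<Prod>i\<in>S - {j}. ?p i ^ k i / fact (k i))"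
      have W: "(\<Prod>i\<in>S. ?p i ^ fun_upd k j m i / fact (fun_upd k j m i)) = ?p j ^ m / fact m * W"
        using S j unfolding W_def by (subst prod.remove[of S j]) (auto intro!: prod.cong)
      have R: "?R = ?p j ^ Suc m / fact (Suc m) * W"
        using S j Suc unfolding W_def by (subst prod.remove[of S j]) auto
      have "?R * real (Suc m) = ?p j * (?p j ^ m / fact m * W)"
        unfolding R fact_Suc by (simp del: of_nat_Suc)
      moreover have "Q N (fun_upd k j m) = fact N * (?p j ^ m / fact m * W)"
        unfolding Q_def W sm by (simp only: if_True refl)
      ultimately show ?thesis using Suc by (simp add: mult_ac del: of_nat_Suc)
    qed simp
    then have "(\<Sum>j\<in>S. ?p j * (if k j = 0 then 0 else Q N (fun_upd k j (k j - 1))))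
        = fact N * ?R * real (sum k S)" by (simp add: sum_distrib_left)
    then show ?thesis using True by (simp add: Q_def)
  next
    case False
    have Q0: "Q N (fun_upd k j (k j - 1)) = 0" if "j \<in> S" "k j \<noteq> 0" for j
    proof -
      have "sum (fun_upd k j (k j - 1)) S = k j - 1 + sum k (S - {j})"
        using S that by (subst sum.remove[of S j]) (auto intro!: sum.cong)
      moreover have "sum k S = k j + sum k (S - {j})" using S that by (simp add: sum.remove)
      ultimately show ?thesis using that False by (simp add: Q_def)
    qed
    have "?p j * (if k j = 0 then 0 else Q N (fun_upd k j (k j - 1))) = 0" if "j \<in> S" for j
    proof (cases "k j = 0")
      case True
      then show ?thesis by (simp only: simp_thms if_True mult_zero_right)
    next
      case nz: False
      show ?thesis unfolding Q0[OF that nz] by simp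
    qed
    then have "(\<Sum>j\<in>S. ?p j * (if k j = 0 then 0 else Q N (fun_upd k j (k j - 1)))) = 0"
      by (intro sum.neutral ballI)
    also have "0 = Q (Suc N) k" using False by (simp add: Q_def)
    finally show ?thesis .
  qed
  finally show ?case unfolding Q_def G_def ins[symmetric] .
qed

text \<open>A random number of points, and independently of it an infinite sequence of points or pairs of
  points. With a deterministic number of points this carries a sample of fixed size, and with a
  Poisson number a Poisson process.\<close>

definition mixed_space :: "'b measure \<Rightarrow> nat pmf \<Rightarrow> (nat \<times> (nat \<Rightarrow> 'b)) measure" where
  "mixed_space J p = measure_pmf p \<Otimes>\<^sub>M PiM UNIV (\<lambda>_. J)"

lemma prob_space_mixed_space:
  assumes "prob_space J"
  shows "prob_space (mixed_space J p)"
proof -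
  interpret \<Omega>: prob_space "PiM UNIV (\<lambda>_::nat. J)" by (intro prob_space_PiM assms)
  interpret pair_prob_space "measure_pmf p" "PiM UNIV (\<lambda>_::nat. J)" ..
  show ?thesis unfolding mixed_space_def by (rule prob_space_axioms)
qed

lemma measurable_mixed_space:
  assumes "\<And>k. (\<lambda>w. g (k, w)) \<in> measurable (PiM UNIV (\<lambda>_. J)) N"
  shows "g \<in> measurable (mixed_space J p) N"
proof -
  have "(\<lambda>(k, w). g (k, w)) \<in> measurable (count_space UNIV \<Otimes>\<^sub>M PiM UNIV (\<lambda>_. J)) N"
    by (rule measurable_pair_measure_countable1) (use assms in auto)
  then have "g \<in> measurable (count_space UNIV \<Otimes>\<^sub>M PiM UNIV (\<lambda>_. J)) N" by simp
  moreover have "sets (mixed_space J p) = sets (count_space UNIV \<Otimes>\<^sub>M PiM UNIV (\<lambda>_. J))"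
    unfolding mixed_space_def by (intro sets_pair_measure_cong) simp_all
  ultimately show ?thesis by (simp cong: measurable_cong_sets)
qed

lemma nn_integral_mixed_space:
  assumes J: "prob_space J" and h: "h \<in> borel_measurable (mixed_space J p)"
  shows "(\<integral>\<^sup>+x. h x \<partial>mixed_space J p) = (\<integral>\<^sup>+k. \<integral>\<^sup>+w. h (k, w) \<partial>PiM UNIV (\<lambda>_. J) \<partial>measure_pmf p)"
proof -
  interpret \<Omega>: prob_space "PiM UNIV (\<lambda>_::nat. J)" by (intro prob_space_PiM J)
  show ?thesis using \<Omega>.nn_integral_fst[of h "measure_pmf p"] h by (simp add: mixed_space_def)
qed

lemma emeasure_mixed_space:
  assumes J: "prob_space J" and P: "Measurable.pred (mixed_space J p) P"
  shows "emeasure (mixed_space J p) {x\<in>space (mixed_space J p). P x}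
    = (\<integral>\<^sup>+k. emeasure (PiM UNIV (\<lambda>_. J)) {w\<in>space (PiM UNIV (\<lambda>_. J)). P (k, w)} \<partial>measure_pmf p)"
proof -
  interpret \<Omega>: prob_space "PiM UNIV (\<lambda>_::nat. J)" by (intro prob_space_PiM J)
  have "{x\<in>space (mixed_space J p). P x} \<in> sets (measure_pmf p \<Otimes>\<^sub>M PiM UNIV (\<lambda>_. J))"
    using P by (simp add: pred_def mixed_space_def)
  from \<Omega>.emeasure_pair_measure_alt[OF this]
  show ?thesis by (simp add: mixed_space_def space_pair_measure vimage_def)
qed

locale iid_points = prob_space J for J :: "'b measure" +
  fixes f :: "'b \<Rightarrow> real^'d"
  assumes f_meas[measurable]: "f \<in> borel_measurable J"
    and no_atoms: "\<And>x. measure J {p\<in>space J. f p = x} = 0"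
begin

abbreviation \<Omega> :: "(nat \<Rightarrow> 'b) measure" where "\<Omega> \<equiv> PiM UNIV (\<lambda>_. J)"

definition points :: "nat \<times> (nat \<Rightarrow> 'b) \<Rightarrow> (real^'d) set" where
  "points x = (\<lambda>i. f (snd x i)) ` {1..fst x}"

lemma prob_space_\<Omega>: "prob_space \<Omega>"
  by (intro prob_space_PiM prob_space_axioms)

lemma coordinate_meas: "(\<lambda>w. f (w i)) \<in> borel_measurable (PiM K (\<lambda>_. J))" if "i \<in> K" for i K
  by (rule measurable_compose[OF measurable_component_singleton[OF that] f_meas])

text \<open>The process is a set of points, so counts agree with numbers of indices only up to coincidences.
  These have probability zero because the point distribution has no atoms.\<close>

lemma AE_distinct: "AE w in \<Omega>. inj (\<lambda>i. f (w i))"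
proof -
  interpret \<Omega>: prob_space \<Omega> by (rule prob_space_\<Omega>)
  have "AE w in \<Omega>. i \<noteq> j \<longrightarrow> f (w i) \<noteq> f (w j)" for i j :: nat
  proof (cases "i = j")
    case False
    let ?P = "PiM (insert j {i}) (\<lambda>_. J)"
    define h where "h w = (if f (w i) = f (w j) then 1 else 0 :: real)" for w
    have bm: "bounded_measurable (PiM K (\<lambda>_. J)) h" if "{i, j} \<subseteq> K" for K
    proof (rule bounded_measurableI)
      have [measurable]: "(\<lambda>w. f (w i)) \<in> borel_measurable (PiM K (\<lambda>_. J))"
        "(\<lambda>w. f (w j)) \<in> borel_measurable (PiM K (\<lambda>_. J))"
        by (intro coordinate_meas; use that in simp)+
      show "h \<in> borel_measurable (PiM K (\<lambda>_. J))" unfolding h_def[abs_def] by measurable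
      show "\<bar>h w\<bar> \<le> 1" for w by (simp add: h_def)
    qed
    have "(\<integral>w. h w \<partial>\<Omega>) = (\<integral>w. h w \<partial>?P)"
      using bm[of "insert j {i}"]
      by (intro integral_PiM_UNIV_eq prob_space_axioms) (auto simp: bounded_measurable_def h_def)
    also have "\<dots> = (\<integral>w. \<integral>y. h (fun_upd w j y) \<partial>J \<partial>PiM {i} (\<lambda>_. J))"
      by (rule integral_PiM_insert(1)[OF prob_space_axioms]) (use False bm in auto)
    also have "\<dots> = (\<integral>w. 0 \<partial>PiM {i} (\<lambda>_. J))"
    proof (intro Bochner_Integration.integral_cong refl)
      fix w
      have "(\<integral>y. h (fun_upd w j y) \<partial>J) = (\<integral>y. indicator {p\<in>space J. f p = f (w i)} y \<partial>J)"
        using False by (intro Bochner_Integration.integral_cong) (auto simp: h_def indicator_def)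
      also have "\<dots> = measure J {p\<in>space J. f p = f (w i)}"
        by (simp add: Int_absorb2)
      finally show "(\<integral>y. h (fun_upd w j y) \<partial>J) = 0" by (simp add: no_atoms)
    qed
    finally have "(\<integral>w. h w \<partial>\<Omega>) = 0" by simp
    moreover have "integrable \<Omega> h"
      by (intro bounded_measurable_integrable \<Omega>.finite_measure_axioms bm) simp
    ultimately have "AE w in \<Omega>. h w = 0"
      by (subst (asm) integral_nonneg_eq_0_iff_AE) (auto simp: h_def)
    then show ?thesis by (auto simp: h_def split: if_splits elim: eventually_mono)
  qed simp
  then have "AE w in \<Omega>. \<forall>i j. i \<noteq> j \<longrightarrow> f (w i) \<noteq> f (w j)"
    by (simp add: AE_all_countable)
  then show ?thesis by (rule eventually_mono) (auto simp: inj_def)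
qed

lemma card_points_meas:
  assumes A: "A \<in> sets borel"
  shows "(\<lambda>x. card (points x \<inter> A)) \<in> measurable (mixed_space J p) (count_space UNIV)"
proof (rule measurable_mixed_space)
  fix k :: nat
  define R where "R w = {i\<in>{1..k}. \<forall>j\<in>{1..k}. j < i \<longrightarrow> f (w j) \<noteq> f (w i)}" for w
  have cf: "(\<lambda>w. f (w i)) \<in> borel_measurable \<Omega>" for i by (rule coordinate_meas) simp
  have "card (points (k, w) \<inter> A) = card {i\<in>R w. f (w i) \<in> A}" for w
  proof -
    have "points (k, w) = (\<lambda>i. f (w i)) ` R w"
      unfolding R_def image_first_occurrences[of "\<lambda>i. f (w i)"] by (simp add: points_def)
    then have "points (k, w) \<inter> A = (\<lambda>i. f (w i)) ` {i\<in>R w. f (w i) \<in> A}" by auto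
    moreover have "inj_on (\<lambda>i. f (w i)) {i\<in>R w. f (w i) \<in> A}"
      by (rule inj_on_subset[OF inj_on_first_occurrences[of "\<lambda>i. f (w i)" "{1..k}", folded R_def]]) auto
    ultimately show ?thesis by (simp add: card_image)
  qed
  moreover have "(\<lambda>w. card {i\<in>R w. f (w i) \<in> A}) \<in> measurable \<Omega> (count_space UNIV)"
  proof (rule measurable_card)
    fix i
    have 1: "Measurable.pred \<Omega> (\<lambda>w. i \<in> {1..k})" by simp
    have "Measurable.pred borel (\<lambda>y. y \<in> A)" using A by (simp add: pred_def)
    then have 2: "Measurable.pred \<Omega> (\<lambda>w. f (w i) \<in> A)" by (rule measurable_compose[OF cf])
    have 3: "Measurable.pred \<Omega> (\<lambda>w. \<forall>j\<in>{1..k}. j < i \<longrightarrow> f (w j) \<noteq> f (w i))"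
    proof (rule pred_intros_finite(3)[OF finite_atLeastAtMost])
      fix j
      have "Measurable.pred \<Omega> (\<lambda>w. f (w j) \<noteq> f (w i))" by (rule pred_neq[OF cf cf])
      then show "Measurable.pred \<Omega> (\<lambda>w. j < i \<longrightarrow> f (w j) \<noteq> f (w i))"
        by (cases "j < i") simp_all
    qed
    show "{w\<in>space \<Omega>. i \<in> {i\<in>R w. f (w i) \<in> A}} \<in> sets \<Omega>"
      using pred_intros_logic(3)[OF pred_intros_logic(3)[OF 1 3] 2]
      unfolding R_def mem_Collect_eq pred_def .
  qed
  ultimately show "(\<lambda>w. card (points (k, w) \<inter> A)) \<in> measurable \<Omega> (count_space UNIV)"
    by (simp only:)
qed

text \<open>The counts of the cells almost surely determine the number of points, so that only one value of
  that number contributes. The factorial in the multinomial formula cancels the one in the Poisson weight, and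
  what remains is a product.\<close>

lemma poisson_counts_partition:
  assumes \<mu>: "0 < \<mu>" and S: "finite S"
    and A: "\<And>j. j \<in> S \<Longrightarrow> A j \<in> sets borel" "disjoint_family_on A S" "(\<Union>j\<in>S. A j) = UNIV"
  defines "m j \<equiv> \<mu> * measure J {p\<in>space J. f p \<in> A j}"
  shows "measure (mixed_space J (poisson_pmf \<mu>))
      {x\<in>space (mixed_space J (poisson_pmf \<mu>)). \<forall>j\<in>S. card (points x \<inter> A j) = k j}
    = (\<Prod>j\<in>S. exp (- m j) * m j ^ k j / fact (k j))"
proof -
  interpret \<Omega>: prob_space \<Omega> by (rule prob_space_\<Omega>)
  let ?M = "mixed_space J (poisson_pmf \<mu>)"
  interpret M: prob_space ?M by (rule prob_space_mixed_space[OF prob_space_axioms])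
  define B where "B j = {p\<in>space J. f p \<in> A j}" for j
  define K where "K = sum k S"
  let ?p = "\<lambda>j. measure J (B j)"
  let ?R = "\<Prod>j\<in>S. ?p j ^ k j / fact (k j)"
  have BS: "B j \<in> sets J" if "j \<in> S" for j
    using measurable_sets[OF f_meas A(1)[OF that]] by (simp add: B_def vimage_def Int_def conj_commute)
  have Bdisj: "disjoint_family_on B S" using A(2) by (auto simp: B_def disjoint_family_on_def)
  have BU: "(\<Union>j\<in>S. B j) = space J" using A(3) by (auto simp: B_def)
  have psum: "(\<Sum>j\<in>S. ?p j) = 1"
    using finite_measure_finite_Union[OF S _ Bdisj] BS by (auto simp: BU prob_space)
  have pred: "Measurable.pred ?M (\<lambda>x. \<forall>j\<in>S. card (points x \<inter> A j) = k j)"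
    by (intro pred_intros_finite(3) S pred_eq_nat card_points_meas A)
  have prob_N: "emeasure \<Omega> {w\<in>space \<Omega>. \<forall>j\<in>S. card (points (N, w) \<inter> A j) = k j}
      = ennreal (fact K * ?R) * indicator {K} N" for N
  proof -
    have sec: "Measurable.pred \<Omega> (\<lambda>w. \<forall>j\<in>S. card (points (N, w) \<inter> A j) = k j)"
    proof (intro pred_intros_finite(3) S pred_eq_nat)
      fix j assume j: "j \<in> S"
      have "Pair N \<in> measurable \<Omega> (measure_pmf (poisson_pmf \<mu>) \<Otimes>\<^sub>M \<Omega>)" by (rule measurable_Pair1') simp
      then show "(\<lambda>w. card (points (N, w) \<inter> A j)) \<in> measurable \<Omega> (count_space UNIV)"
        using card_points_meas[OF A(1)[OF j]] unfolding mixed_space_def by (rule measurable_compose)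
    qed
    define g where "g w = (if \<forall>j\<in>S. card {i\<in>{1..N}. w i \<in> B j} = k j then 1 else 0 :: real)"
      for w :: "nat \<Rightarrow> 'b"
    have g_meas: "g \<in> borel_measurable (PiM {1..N} (\<lambda>_. J))"
      unfolding g_def[abs_def] by (rule measurable_partition_counts) (use S BS in auto)
    have g_int: "(\<integral>w. g w \<partial>\<Omega>) = (if K = N then fact N * ?R else 0)"
    proof -
      have "(\<integral>w. g w \<partial>\<Omega>) = (\<integral>w. g w \<partial>PiM {1..N} (\<lambda>_. J))"
        by (rule integral_PiM_UNIV_eq[OF prob_space_axioms _ g_meas])
          (auto simp: g_def cong: conj_cong)
      then show ?thesis
        using multinomial_counts[OF prob_space_axioms S BS Bdisj BU, of N k] by (simp add: g_def K_def)
    qed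
    have "measure \<Omega> {w\<in>space \<Omega>. \<forall>j\<in>S. card (points (N, w) \<inter> A j) = k j}
        = (\<integral>w. indicator {w\<in>space \<Omega>. \<forall>j\<in>S. card (points (N, w) \<inter> A j) = k j} w \<partial>\<Omega>)"
      by (simp add: Int_absorb2)
    also have "\<dots> = (\<integral>w. g w \<partial>\<Omega>)"
    proof (rule integral_cong_AE)
      show "indicator {w\<in>space \<Omega>. \<forall>j\<in>S. card (points (N, w) \<inter> A j) = k j} \<in> borel_measurable \<Omega>"
        using sec by (intro borel_measurable_indicator) (simp add: pred_def)
      have "(\<lambda>w. g (restrict w {1..N})) \<in> borel_measurable \<Omega>"
        by (rule measurable_compose[OF measurable_restrict_subset g_meas]) simp
      also have "(\<lambda>w. g (restrict w {1..N})) = g" by (auto simp: g_def cong: conj_cong)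
      finally show "g \<in> borel_measurable \<Omega>" .
      show "AE w in \<Omega>. indicator {w\<in>space \<Omega>. \<forall>j\<in>S. card (points (N, w) \<inter> A j) = k j} w = g w"
        using AE_distinct AE_space
      proof eventually_elim
        case (elim w)
        have "w i \<in> space J" for i using elim(2) by (auto simp: space_PiM PiE_def)
        then have "points (N, w) \<inter> A j = (\<lambda>i. f (w i)) ` {i\<in>{1..N}. w i \<in> B j}" for j
          by (auto simp: points_def B_def)
        then have "card (points (N, w) \<inter> A j) = card {i\<in>{1..N}. w i \<in> B j}" for j
          using elim(1) by (simp add: card_image inj_on_subset)
        then show ?case using elim(2) by (simp add: g_def indicator_def)
      qed
    qed
    finally show ?thesis using g_int by (auto simp: \<Omega>.emeasure_eq_measure indicator_def)
  qed
  have "emeasure ?M {x\<in>space ?M. \<forall>j\<in>S. card (points x \<inter> A j) = k j}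
      = (\<integral>\<^sup>+N. ennreal (fact K * ?R) * indicator {K} N \<partial>measure_pmf (poisson_pmf \<mu>))"
    unfolding emeasure_mixed_space[OF prob_space_axioms pred] prob_N ..
  also have "\<dots> = ennreal (fact K * ?R) * ennreal (pmf (poisson_pmf \<mu>) K)"
    by (subst nn_integral_cmult_indicator) (simp_all add: emeasure_pmf_single)
  also have "\<dots> = ennreal (fact K * ?R * pmf (poisson_pmf \<mu>) K)"
    by (rule ennreal_mult''[symmetric]) simp
  also have "fact K * ?R * pmf (poisson_pmf \<mu>) K = exp (- \<mu>) * \<mu> ^ K * ?R"
    using \<mu> by simp
  also have "\<dots> = (\<Prod>j\<in>S. exp (- m j) * m j ^ k j / fact (k j))"
  proof -
    have m: "m j = \<mu> * ?p j" for j by (simp only: m_def B_def)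
    have "(\<Sum>j\<in>S. - m j) = - \<mu>"
      unfolding m sum_negf sum_distrib_left[symmetric] psum by simp
    then have exp: "(\<Prod>j\<in>S. exp (- m j)) = exp (- \<mu>)" by (simp only: exp_sum[OF S, symmetric])
    have pow: "(\<Prod>j\<in>S. \<mu> ^ k j) = \<mu> ^ K" by (simp only: K_def power_sum)
    have "(\<Prod>j\<in>S. exp (- m j) * m j ^ k j / fact (k j))
        = (\<Prod>j\<in>S. exp (- m j) * (\<mu> ^ k j * (?p j ^ k j / fact (k j))))"
      unfolding m power_mult_distrib by (simp only: times_divide_eq_right mult.assoc)
    also have "\<dots> = exp (- \<mu>) * \<mu> ^ K * ?R"
      by (simp only: prod.distrib exp pow mult.assoc)
    finally show ?thesis ..
  qed
  finally have "emeasure ?M {x\<in>space ?M. \<forall>j\<in>S. card (points x \<inter> A j) = k j}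
      = ennreal (\<Prod>j\<in>S. exp (- m j) * m j ^ k j / fact (k j))" .
  moreover have "0 \<le> (\<Prod>j\<in>S. exp (- m j) * m j ^ k j / fact (k j))"
    using \<mu> by (intro prod_nonneg) (simp add: m_def)
  ultimately show ?thesis unfolding measure_def by (simp only: enn2real_ennreal)
qed

text \<open>A disjoint family is completed to a partition by its complement, and the count of the complement
  is summed out.\<close>

lemma poisson_counts:
  assumes \<mu>: "0 < \<mu>" and S: "finite S"
    and A: "\<And>j::nat. j \<in> S \<Longrightarrow> A j \<in> sets borel" "disjoint_family_on A S"
  defines "m j \<equiv> \<mu> * measure J {p\<in>space J. f p \<in> A j}"
  shows "measure (mixed_space J (poisson_pmf \<mu>))
      {x\<in>space (mixed_space J (poisson_pmf \<mu>)). \<forall>j\<in>S. card (points x \<inter> A j) = k j}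
    = (\<Prod>j\<in>S. exp (- m j) * m j ^ k j / fact (k j))"
proof -
  let ?M = "mixed_space J (poisson_pmf \<mu>)"
  interpret M: prob_space ?M by (rule prob_space_mixed_space[OF prob_space_axioms])
  obtain j0 where j0: "j0 \<notin> S" using ex_new_if_finite[OF infinite_UNIV_nat S] by auto
  \<comment> \<open>The fresh index \<open>j0\<close> stands for the complement.\<close>
  define A' where "A' j = (if j = j0 then UNIV - (\<Union>j\<in>S. A j) else A j)" for j
  define c where "c = \<mu> * measure J {p\<in>space J. f p \<in> A' j0}"
  have A'S: "A' j = A j" if "j \<in> S" for j using that j0 by (auto simp: A'_def)
  have A'sets: "A' j \<in> sets borel" if "j \<in> insert j0 S" for j
    using that A(1) S by (auto simp: A'_def)
  let ?P = "\<Prod>j\<in>S. exp (- m j) * m j ^ k j / fact (k j)"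
  let ?E = "\<lambda>r. {x\<in>space ?M. \<forall>j\<in>insert j0 S. card (points x \<inter> A' j) = fun_upd k j0 r j}"
  have ne: "j \<noteq> j0" if "j \<in> S" for j using that j0 by auto
  have E_iff: "(\<forall>j\<in>insert j0 S. card (points x \<inter> A' j) = fun_upd k j0 r j)
      \<longleftrightarrow> card (points x \<inter> A' j0) = r \<and> (\<forall>j\<in>S. card (points x \<inter> A j) = k j)" for x r
  proof -
    have "(\<forall>j\<in>S. card (points x \<inter> A' j) = fun_upd k j0 r j) \<longleftrightarrow> (\<forall>j\<in>S. card (points x \<inter> A j) = k j)"
      by (rule ball_cong[OF refl]) (simp add: A'S ne)
    moreover have "(\<forall>j\<in>insert j0 S. Q j) \<longleftrightarrow> Q j0 \<and> (\<forall>j\<in>S. Q j)" for Q by blast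
    ultimately show ?thesis by (simp only: fun_upd_same)
  qed
  have E: "measure ?M (?E r) = ?P * (exp (- c) * c ^ r / fact r)" for r
  proof -
    have "measure ?M (?E r) = (\<Prod>j\<in>insert j0 S. exp (- (\<mu> * measure J {p\<in>space J. f p \<in> A' j}))
        * (\<mu> * measure J {p\<in>space J. f p \<in> A' j}) ^ fun_upd k j0 r j / fact (fun_upd k j0 r j))"
    proof (rule poisson_counts_partition[OF \<mu>])
      show "disjoint_family_on A' (insert j0 S)"
        using A(2) j0 by (auto simp: disjoint_family_on_def A'_def)
      have "x \<in> (\<Union>j\<in>insert j0 S. A' j)" for x
      proof (cases "\<exists>j\<in>S. x \<in> A j")
        case True
        then show ?thesis using A'S by blast
      next
        case False
        then have "x \<in> A' j0" by (simp add: A'_def)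
        then show ?thesis by blast
      qed
      then show "\<Union> (A' ` insert j0 S) = UNIV" by blast
    qed (use S A'sets in auto)
    also have "\<dots> = (exp (- c) * c ^ r / fact r) * ?P"
    proof -
      have "(\<Prod>j\<in>S. exp (- (\<mu> * measure J {p\<in>space J. f p \<in> A' j}))
        * (\<mu> * measure J {p\<in>space J. f p \<in> A' j}) ^ fun_upd k j0 r j / fact (fun_upd k j0 r j)) = ?P"
        by (intro prod.cong refl) (simp add: m_def A'S ne)
      then show ?thesis unfolding prod.insert[OF S j0] by (simp add: c_def)
    qed
    finally show ?thesis by simp
  qed
  have sums: "(\<lambda>r. measure ?M (?E r)) sums measure ?M (\<Union>r. ?E r)"
  proof (rule M.finite_measure_UNION)
    have "?E r \<in> sets ?M" for r
      unfolding pred_def[symmetric]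
      by (intro pred_intros_finite(3) finite.insertI S pred_eq_nat card_points_meas A'sets)
    then show "range ?E \<subseteq> sets ?M" by (rule image_subsetI)
    show "disjoint_family ?E" unfolding E_iff by (auto simp: disjoint_family_on_def)
  qed
  have Un: "(\<Union>r. ?E r) = {x\<in>space ?M. \<forall>j\<in>S. card (points x \<inter> A j) = k j}"
    unfolding E_iff by auto
  have sums': "(\<lambda>r. ?P * (exp (- c) * c ^ r / fact r)) sums ?P"
  proof -
    have "(\<lambda>r. c ^ r / fact r) sums exp c" using exp_converges[of c] by (simp add: field_simps scaleR_conv_of_real)
    then have "(\<lambda>r. (?P * exp (- c)) * (c ^ r / fact r)) sums ((?P * exp (- c)) * exp c)" by (rule sums_mult)
    then show ?thesis by (simp add: mult.assoc flip: exp_add)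
  qed
  show ?thesis by (rule sums_unique2[OF sums[unfolded E Un] sums'])
qed

theorem poisson_process_points:
  assumes \<mu>: "0 < \<mu>" and \<kappa>: "\<kappa> \<in> borel_measurable borel" "\<And>x. 0 \<le> \<kappa> x"
    and distr: "distr J lborel f = density lborel (\<lambda>x. ennreal (\<kappa> x))"
  shows "poisson_process (mixed_space J (poisson_pmf \<mu>)) (\<lambda>x. \<mu> * \<kappa> x) points"
proof -
  let ?M = "mixed_space J (poisson_pmf \<mu>)"
  interpret M: prob_space ?M by (rule prob_space_mixed_space[OF prob_space_axioms])
  have int: "(LINT x:B|lborel. \<mu> * \<kappa> x) = \<mu> * measure J {p\<in>space J. f p \<in> B}" if B: "B \<in> sets borel" for B
  proof -
    have "emeasure J {p\<in>space J. f p \<in> B} = emeasure (distr J lborel f) B"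
      using B by (subst emeasure_distr) (auto intro!: arg_cong[where f = "emeasure J"])
    also have "\<dots> = (\<integral>\<^sup>+x. ennreal (indicator B x * \<kappa> x) \<partial>lborel)"
      unfolding distr using B \<kappa>
      by (subst emeasure_density) (auto intro!: nn_integral_cong simp: indicator_def)
    finally have "measure J {p\<in>space J. f p \<in> B} = (\<integral>x. indicator B x * \<kappa> x \<partial>lborel)"
      using B \<kappa> by (subst integral_eq_nn_integral) (auto simp: measure_def)
    then show ?thesis by (simp add: set_lebesgue_integral_def mult.left_commute)
  qed
  have single: "measure ?M {x\<in>space ?M. card (points x \<inter> B) = k}
      = exp (- (LINT x:B|lborel. \<mu> * \<kappa> x)) * (LINT x:B|lborel. \<mu> * \<kappa> x) ^ k / fact k"
    if B: "B \<in> sets borel" for B k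
    unfolding int[OF B] using poisson_counts[OF \<mu>, of "{0}" "\<lambda>_. B" "\<lambda>_. k"] B
    by (simp add: disjoint_family_on_def)
  show ?thesis
    unfolding poisson_process_def
  proof (intro conjI ballI allI impI)
    show "prob_space ?M" by (rule prob_space_mixed_space[OF prob_space_axioms])
    show "finite (points x)" for x by (simp add: points_def)
    show "measure ?M {x\<in>space ?M. card (points x \<inter> B) = k}
      = exp (- (LINT x:B|lborel. \<mu> * \<kappa> x)) * (LINT x:B|lborel. \<mu> * \<kappa> x) ^ k / fact k"
      if "B \<in> sets borel" for B k by (rule single[OF that])
    fix A :: "nat \<Rightarrow> (real^'d) set" assume A: "range A \<subseteq> sets borel \<and> disjoint_family A"
    then have As: "A j \<in> sets borel" for j by auto
    show "M.indep_vars (\<lambda>_. count_space UNIV) (\<lambda>i x. card (points x \<inter> A i)) UNIV"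
    proof (rule M.indep_vars_natI)
      show "(\<lambda>x. card (points x \<inter> A i)) \<in> measurable ?M (count_space UNIV)" for i
        by (rule card_points_meas[OF As])
      fix S :: "nat set" and k assume S: "finite S"
      have "disjoint_family_on A S" using A by (auto intro: disjoint_family_on_mono)
      then show "M.prob {x\<in>space ?M. \<forall>j\<in>S. card (points x \<inter> A j) = k j}
          = (\<Prod>j\<in>S. M.prob {x\<in>space ?M. card (points x \<inter> A j) = k j})"
        unfolding single[OF As] int[OF As] by (rule poisson_counts[OF \<mu> S As])
    qed
  qed
qed

lemma prob_cylinder:
  assumes S: "finite S" and B: "\<And>j. j \<in> S \<Longrightarrow> B j \<in> sets borel"
  shows "emeasure (mixed_space J p) {x\<in>space (mixed_space J p). \<forall>j\<in>S. f (snd x j) \<in> B j}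
    = (\<Prod>j\<in>S. emeasure J {q\<in>space J. f q \<in> B j})"
proof -
  interpret PP: product_prob_space "\<lambda>_. J" UNIV by standard
  have Bs: "{q\<in>space J. f q \<in> B j} \<in> sets J" if "j \<in> S" for j
    using measurable_sets[OF f_meas B[OF that]] by (simp add: vimage_def Int_def conj_commute)
  have "Measurable.pred (mixed_space J p) (\<lambda>x. f (snd x j) \<in> B j)" if j: "j \<in> S" for j
  proof (rule measurable_mixed_space)
    have "Measurable.pred borel (\<lambda>y. y \<in> B j)" using B[OF j] by (simp add: pred_def)
    from measurable_compose[OF coordinate_meas[of j UNIV] this]
    show "Measurable.pred \<Omega> (\<lambda>w. f (snd (k, w) j) \<in> B j)" for k :: nat by simp
  qed
  then have pred: "Measurable.pred (mixed_space J p) (\<lambda>x. \<forall>j\<in>S. f (snd x j) \<in> B j)"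
    by (rule pred_intros_finite(3)[OF S])
  have "{w\<in>space \<Omega>. \<forall>j\<in>S. f (w j) \<in> B j} = {w\<in>space \<Omega>. \<forall>j\<in>S. w j \<in> {q\<in>space J. f q \<in> B j}}"
    by (auto simp: space_PiM PiE_def)
  then have "emeasure \<Omega> {w\<in>space \<Omega>. \<forall>j\<in>S. f (w j) \<in> B j} = (\<Prod>j\<in>S. emeasure J {q\<in>space J. f q \<in> B j})"
    using PP.emeasure_PiM_Collect[of S "\<lambda>j. {q\<in>space J. f q \<in> B j}"] S Bs by simp
  then show ?thesis
    unfolding emeasure_mixed_space[OF prob_space_axioms pred] by simp
qed

theorem iid_sample_coordinates:
  assumes \<kappa>: "\<kappa> \<in> borel_measurable borel"
    and distr: "distr J lborel f = density lborel (\<lambda>x. ennreal (\<kappa> x))"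
  shows "iid_sample (mixed_space J p) n \<kappa> (\<lambda>i x. f (snd x i))"
proof -
  let ?M = "mixed_space J p"
  interpret M: prob_space ?M by (rule prob_space_mixed_space[OF prob_space_axioms])
  have X: "(\<lambda>x. f (snd x i)) \<in> borel_measurable ?M" for i
    by (rule measurable_mixed_space) (use coordinate_meas[of i UNIV] in simp)
  have cyl: "M.prob {x\<in>space ?M. \<forall>j\<in>S. f (snd x j) \<in> B j} = (\<Prod>j\<in>S. prob {q\<in>space J. f q \<in> B j})"
    if "finite S" "\<And>j. j \<in> S \<Longrightarrow> B j \<in> sets borel" for S B
    using prob_cylinder[OF that, where p = p]
    by (simp add: M.emeasure_eq_measure emeasure_eq_measure prod_ennreal prod_nonneg)
  show ?thesis
    unfolding iid_sample_def M.indep_vars_def2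
  proof (intro conjI ballI M.indep_setsI)
    show "prob_space ?M" by (rule prob_space_mixed_space[OF prob_space_axioms])
    show "(\<lambda>x. f (snd x i)) \<in> borel_measurable ?M" for i by (rule X)
    show "{(\<lambda>x. f (snd x i)) -` A \<inter> space ?M |A. A \<in> sets borel} \<subseteq> M.events" for i
      using measurable_sets[OF X] by auto
    show "distributed ?M lborel (\<lambda>x. f (snd x i)) (\<lambda>x. ennreal (\<kappa> x))" for i
      unfolding distributed_def
    proof (intro conjI)
      show "distr ?M lborel (\<lambda>x. f (snd x i)) = density lborel (\<lambda>x. ennreal (\<kappa> x))"
        unfolding distr[symmetric]
      proof (rule measure_eqI)
        fix A assume "A \<in> sets (distr ?M lborel (\<lambda>x. f (snd x i)))"
        then have A: "A \<in> sets borel" by simp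
        have "emeasure (distr ?M lborel (\<lambda>x. f (snd x i))) A = emeasure ?M {x\<in>space ?M. f (snd x i) \<in> A}"
          using A X by (subst emeasure_distr) (auto intro!: arg_cong[where f = "emeasure ?M"])
        also have "\<dots> = emeasure J {q\<in>space J. f q \<in> A}"
          using prob_cylinder[of "{i}" "\<lambda>_. A", where p = p] A by simp
        also have "\<dots> = emeasure (distr J lborel f) A"
          using A by (subst emeasure_distr) (auto intro!: arg_cong[where f = "emeasure J"])
        finally show "emeasure (distr ?M lborel (\<lambda>x. f (snd x i))) A = emeasure (distr J lborel f) A" .
      qed simp
    qed (use \<kappa> X in simp_all)
  next
    fix A S assume S: "S \<noteq> {}" "S \<subseteq> {1..n}" "finite S"
      and A: "\<forall>j\<in>S. A j \<in> {(\<lambda>x. f (snd x j)) -` A \<inter> space ?M |A. A \<in> sets borel}"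
    then have "\<forall>j\<in>S. \<exists>B. B \<in> sets borel \<and> A j = {x\<in>space ?M. f (snd x j) \<in> B}" by fastforce
    then obtain B where B: "\<And>j. j \<in> S \<Longrightarrow> B j \<in> sets borel"
        "\<And>j. j \<in> S \<Longrightarrow> A j = {x\<in>space ?M. f (snd x j) \<in> B j}"
      unfolding bchoice_iff by blast
    have "(\<Inter>j\<in>S. A j) = {x\<in>space ?M. \<forall>j\<in>S. f (snd x j) \<in> B j}" using B(2) S(1) by auto
    moreover have "M.prob (A j) = prob {q\<in>space J. f q \<in> B j}" if "j \<in> S" for j
      using cyl[of "{j}" B] B that by simp
    ultimately show "M.prob (\<Inter>j\<in>S. A j) = (\<Prod>j\<in>S. M.prob (A j))"
      using cyl[OF S(3) B(1)] by simp
  qed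
qed

end

section \<open>Moments of the number of points\<close>

lemma nn_integral_pmf_sums:
  fixes h :: "nat \<Rightarrow> real"
  assumes h: "\<And>k. 0 \<le> h k" and s: "(\<lambda>k. pmf p k * h k) sums s"
  shows "(\<integral>\<^sup>+k. ennreal (h k) \<partial>measure_pmf p) = ennreal s"
proof -
  have "(\<integral>\<^sup>+k. ennreal (h k) \<partial>measure_pmf p) = (\<integral>\<^sup>+k. ennreal (pmf p k * h k) \<partial>count_space UNIV)"
    by (simp add: nn_integral_measure_pmf ennreal_mult')
  also have "\<dots> = (\<Sum>k. ennreal (pmf p k * h k))" by (rule nn_integral_count_space_nat)
  also have "\<dots> = ennreal s"
    using s h by (intro suminf_ennreal_eq) auto
  finally show ?thesis .
qed

lemma exp_series_moments:
  fixes m :: real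
  shows "(\<lambda>k. m ^ k / fact k) sums exp m"
    and "(\<lambda>k. real k * (m ^ k / fact k)) sums (m * exp m)"
    and "(\<lambda>k. (real k)\<^sup>2 * (m ^ k / fact k)) sums ((m\<^sup>2 + m) * exp m)"
proof -
  show s0: "(\<lambda>k. m ^ k / fact k) sums exp m"
    using exp_converges[of m] by (simp add: divide_inverse mult.commute)
  have rec: "real (Suc k) * (m ^ Suc k / fact (Suc k)) = m * (m ^ k / fact k)" for k
    unfolding fact_Suc power_Suc by (simp del: of_nat_Suc)
  have "(\<lambda>k. real (Suc k) * (m ^ Suc k / fact (Suc k))) sums (m * exp m)"
    unfolding rec by (rule sums_mult[OF s0])
  from sums_Suc[OF this] show s1: "(\<lambda>k. real k * (m ^ k / fact k)) sums (m * exp m)" by simp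
  have "(real (Suc k))\<^sup>2 * (m ^ Suc k / fact (Suc k)) = m * (real k * (m ^ k / fact k)) + m * (m ^ k / fact k)" for k
  proof -
    have "(real (Suc k))\<^sup>2 * (m ^ Suc k / fact (Suc k))
        = real (Suc k) * (real (Suc k) * (m ^ Suc k / fact (Suc k)))"
      by (simp only: power2_eq_square mult.assoc)
    also have "\<dots> = m * (real k * (m ^ k / fact k)) + m * (m ^ k / fact k)"
    proof -
      have "real (Suc k) * (m * w) = m * (real k * w) + m * w" for w by (simp add: algebra_simps)
      then show ?thesis unfolding rec .
    qed
    finally show ?thesis .
  qed
  then have "(\<lambda>k. (real (Suc k))\<^sup>2 * (m ^ Suc k / fact (Suc k))) sums (m * (m * exp m) + m * exp m)"
    by (simp only: sums_add sums_mult s0 s1)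
  from sums_Suc[OF this]
  show "(\<lambda>k. (real k)\<^sup>2 * (m ^ k / fact k)) sums ((m\<^sup>2 + m) * exp m)"
    by (simp add: power2_eq_square distrib_right mult.assoc)
qed

text \<open>The weight \<open>\<theta> ^ k\<close> turns the Poisson weights of mean \<open>n\<close> into those of mean \<open>n * \<theta>\<close>, up to the
  normalizing factor.\<close>

lemma poisson_weighted_moment:
  assumes n: "0 < (n::real)" and \<theta>: "0 \<le> \<theta>"
  shows "(\<lambda>k. pmf (poisson_pmf n) k * ((real k + (real k - n)\<^sup>2) * \<theta> ^ k))
    sums (exp (n * \<theta> - n) * (2 * (n * \<theta>) + (n * \<theta> - n)\<^sup>2))"
proof -
  define m where "m = n * \<theta>"
  let ?w = "\<lambda>k. m ^ k / fact k"
  have "(\<lambda>k. exp (- n) * ((real k)\<^sup>2 * ?w k + (1 - 2 * n) * (real k * ?w k) + n\<^sup>2 * ?w k))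
      sums (exp (- n) * ((m\<^sup>2 + m) * exp m + (1 - 2 * n) * (m * exp m) + n\<^sup>2 * exp m))"
    by (intro sums_mult sums_add exp_series_moments)
  moreover have "exp (- n) * ((real k)\<^sup>2 * ?w k + (1 - 2 * n) * (real k * ?w k) + n\<^sup>2 * ?w k)
      = pmf (poisson_pmf n) k * ((real k + (real k - n)\<^sup>2) * \<theta> ^ k)" for k
  proof -
    have "pmf (poisson_pmf n) k * \<theta> ^ k = exp (- n) * ?w k"
      using n by (simp add: m_def power_mult_distrib)
    moreover have "pmf (poisson_pmf n) k * (G * \<theta> ^ k) = (pmf (poisson_pmf n) k * \<theta> ^ k) * G" for G
      by (simp only: mult_ac)
    ultimately have H: "pmf (poisson_pmf n) k * ((real k + (real k - n)\<^sup>2) * \<theta> ^ k)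
        = (exp (- n) * ?w k) * (real k + (real k - n)\<^sup>2)" by (simp only:)
    have G: "real k + (real k - n)\<^sup>2 = (real k)\<^sup>2 + (1 - 2 * n) * real k + n\<^sup>2"
      by (simp add: power2_diff left_diff_distrib)
    have "exp (- n) * (x * w + y * (z * w) + u * w) = (exp (- n) * w) * (x + y * z + u)"
      for x y z u w :: real by (simp add: algebra_simps)
    then show ?thesis unfolding H unfolding G .
  qed
  moreover have "exp (- n) * ((m\<^sup>2 + m) * exp m + (1 - 2 * n) * (m * exp m) + n\<^sup>2 * exp m)
      = exp (m - n) * (2 * m + (m - n)\<^sup>2)"
  proof -
    have "(m\<^sup>2 + m) * exp m + (1 - 2 * n) * (m * exp m) + n\<^sup>2 * exp m = exp m * (2 * m + (m - n)\<^sup>2)"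
      by (simp add: power2_diff distrib_left distrib_right left_diff_distrib right_diff_distrib mult_ac)
    moreover have "exp (- n) * exp m = exp (m - n)" by (simp add: exp_add[symmetric])
    ultimately show ?thesis by (simp add: mult.assoc[symmetric])
  qed
  ultimately show ?thesis unfolding m_def by simp
qed

lemma nn_integral_poisson_power_finite:
  assumes n: "0 < (n::real)"
  shows "(\<integral>\<^sup>+k. ennreal (4 ^ k) \<partial>measure_pmf (poisson_pmf n)) < \<infinity>"
proof -
  have "(\<lambda>k. exp (- n) * ((4 * n) ^ k / fact k)) sums (exp (- n) * exp (4 * n))"
    by (intro sums_mult exp_series_moments)
  moreover have "exp (- n) * ((4 * n) ^ k / fact k) = pmf (poisson_pmf n) k * 4 ^ k" for k
    using n by (simp add: power_mult_distrib)
  ultimately have "(\<lambda>k. pmf (poisson_pmf n) k * 4 ^ k) sums (exp (- n) * exp (4 * n))" by simp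
  from nn_integral_pmf_sums[OF _ this] show ?thesis by simp
qed

definition moment_constant :: "real \<Rightarrow> real" where
  "moment_constant c = exp c * (4 + 2 * c + c\<^sup>2)"

lemma moment_constant_pos: "0 \<le> c \<Longrightarrow> 0 < moment_constant c"
  by (simp add: moment_constant_def add_pos_nonneg)

lemma power_le_exp_of_le:
  assumes "1 \<le> q" "q \<le> 1 + c / real n" "1 \<le> n" "0 \<le> c"
  shows "q ^ n \<le> exp c"
proof -
  have "q ^ n \<le> (1 + c / real n) ^ n" using assms by (intro power_mono) auto
  also have "\<dots> \<le> exp c" using assms by (intro exp_ge_one_plus_x_over_n_power_n) auto
  finally show ?thesis .
qed

text \<open>For the weight \<open>1 + c / n\<close> the tilted mean is \<open>n + c\<close>, so neither the exponential factor
  nor the shift of the mean spoils the order \<open>n\<close>.\<close>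

lemma poisson_moment_bound:
  assumes q: "1 \<le> q" "q \<le> 1 + c / real n" and n: "1 \<le> n" and c: "0 \<le> c"
  shows "(\<integral>\<^sup>+k. ennreal ((real k + (real k - real n)\<^sup>2) * (q ^ k + q ^ n)) \<partial>measure_pmf (poisson_pmf (real n)))
    \<le> ennreal (moment_constant c * n)"
proof -
  define Q where "Q = 1 + c / real n"
  have Q: "0 \<le> Q" "real n * Q = n + c" using n c by (simp_all add: Q_def distrib_left)
  have n0: "0 < real n" using n by simp
  let ?g = "\<lambda>k::nat. real k + (real k - real n)\<^sup>2"
  have "(\<lambda>k. pmf (poisson_pmf (real n)) k * (?g k * Q ^ k)
        + exp c * (pmf (poisson_pmf (real n)) k * (?g k * 1 ^ k)))
      sums (exp c * (2 * (n + c) + c\<^sup>2) + exp c * (2 * n))"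
    using sums_add[OF poisson_weighted_moment[OF n0 Q(1)]
        sums_mult[OF poisson_weighted_moment[OF n0, of 1], of "exp c"]] by (simp add: Q)
  moreover have "P * (G * Q ^ k) + exp c * (P * (G * 1 ^ k)) = P * (G * (Q ^ k + exp c))" for P G k
    by (simp add: algebra_simps)
  ultimately have sums: "(\<lambda>k. pmf (poisson_pmf (real n)) k * (?g k * (Q ^ k + exp c)))
      sums (exp c * (2 * (n + c) + c\<^sup>2) + exp c * (2 * n))"
    by (simp only:)
  have "(\<integral>\<^sup>+k. ennreal (?g k * (q ^ k + q ^ n)) \<partial>measure_pmf (poisson_pmf (real n)))
      \<le> (\<integral>\<^sup>+k. ennreal (?g k * (Q ^ k + exp c)) \<partial>measure_pmf (poisson_pmf (real n)))"
    using q by (intro nn_integral_mono ennreal_leI mult_left_mono add_mono power_mono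
        power_le_exp_of_le[OF q n c]) (auto simp: Q_def)
  also have "\<dots> = ennreal (exp c * (2 * (n + c) + c\<^sup>2) + exp c * (2 * n))"
    by (rule nn_integral_pmf_sums[OF _ sums]) (use Q in simp)
  also have "\<dots> \<le> ennreal (moment_constant c * n)"
  proof (rule ennreal_leI)
    have n1: "1 \<le> real n" using n by simp
    have "2 * c \<le> 2 * c * n" using mult_left_mono[OF n1, of "2 * c"] c by simp
    moreover have "c\<^sup>2 \<le> c\<^sup>2 * n" using mult_left_mono[OF n1, of "c\<^sup>2"] by simp
    ultimately have "(2 * (n + c) + c\<^sup>2) + 2 * n \<le> (4 + 2 * c + c\<^sup>2) * n" by (simp add: distrib_right)
    then have "exp c * ((2 * (n + c) + c\<^sup>2) + 2 * n) \<le> exp c * ((4 + 2 * c + c\<^sup>2) * n)" by simp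
    then show "exp c * (2 * (n + c) + c\<^sup>2) + exp c * (2 * n) \<le> moment_constant c * n"
      unfolding moment_constant_def distrib_left[symmetric] mult.assoc[symmetric]
      by (simp only: of_nat_mult of_nat_numeral mult.assoc)
  qed
  finally show ?thesis .
qed

lemma binomial_moment_bound:
  assumes q: "1 \<le> q" "q \<le> 1 + c / real n" and n: "1 \<le> n" and c: "0 \<le> c"
  shows "(real n + (real n - real n)\<^sup>2) * (q ^ n + q ^ n) \<le> moment_constant c * n"
proof -
  have "(real n + (real n - real n)\<^sup>2) * (q ^ n + q ^ n) = n * (2 * q ^ n)" by simp
  also have "\<dots> \<le> n * (2 * exp c)"
    using power_le_exp_of_le[OF q n c] by (intro mult_left_mono) auto
  also have "\<dots> \<le> n * moment_constant c"
  proof (rule mult_left_mono)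
    have "2 \<le> 4 + 2 * c + c\<^sup>2" using c by (simp add: add_increasing2)
    from mult_left_mono[OF this, of "exp c"] show "2 * exp c \<le> moment_constant c"
      by (simp add: moment_constant_def mult.commute)
  qed simp
  finally show ?thesis by (simp add: mult.commute)
qed

section \<open>From second moments to the normalized Euler characteristic\<close>

lemma lipschitz_1_abs:
  fixes f :: "real \<Rightarrow> real"
  assumes "1-lipschitz_on UNIV f"
  shows "\<bar>f x - f y\<bar> \<le> \<bar>x - y\<bar>"
  using lipschitz_onD[OF assms, of x y] by (simp add: dist_real_def)

lemma wasserstein_le_sqrt:
  fixes U V :: "'w \<Rightarrow> real"
  assumes M: "prob_space M"
    and UV: "U \<in> borel_measurable M" "V \<in> borel_measurable M" "integrable M U" "integrable M V"
    and sq: "integrable M (\<lambda>w. (U w - V w)\<^sup>2)" and c: "(\<integral>w. (U w - V w)\<^sup>2 \<partial>M) \<le> c"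
  shows "wasserstein (distr M borel U) (distr M borel V) \<le> ereal (sqrt c)"
  unfolding wasserstein_def
proof (rule SUP_least)
  interpret prob_space M by fact
  fix f :: "real \<Rightarrow> real" assume "f \<in> {f. 1-lipschitz_on UNIV f}"
  then have lip: "1-lipschitz_on UNIV f" by simp
  note L = lipschitz_1_abs[OF lip]
  have f[measurable]: "f \<in> borel_measurable borel"
    by (rule borel_measurable_continuous_onI[OF lipschitz_on_continuous_on[OF lip]])
  have int: "integrable M (\<lambda>w. f (Z w))" if Z: "Z \<in> borel_measurable M" "integrable M Z" for Z
  proof (rule Bochner_Integration.integrable_bound)
    show "integrable M (\<lambda>w. \<bar>f 0\<bar> + \<bar>Z w\<bar>)" using Z by auto
    show "(\<lambda>w. f (Z w)) \<in> borel_measurable M" by (rule measurable_compose[OF Z(1) f])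
    have "\<bar>f (Z w)\<bar> \<le> \<bar>f 0\<bar> + \<bar>Z w\<bar>" for w using L[of "Z w" 0] by linarith
    then show "AE w in M. norm (f (Z w)) \<le> norm (\<bar>f 0\<bar> + \<bar>Z w\<bar>)" by auto
  qed
  have "\<bar>(\<integral>x. f x \<partial>distr M borel U) - (\<integral>x. f x \<partial>distr M borel V)\<bar>
      = \<bar>\<integral>w. f (U w) - f (V w) \<partial>M\<bar>"
    using UV by (simp add: integral_distr int Bochner_Integration.integral_diff)
  also have "\<dots> \<le> (\<integral>w. \<bar>f (U w) - f (V w)\<bar> \<partial>M)" by (rule integral_abs_bound)
  also have "\<dots> \<le> (\<integral>w. \<bar>U w - V w\<bar> \<partial>M)"
    using UV int L by (intro integral_mono) auto
  also have "\<dots> \<le> sqrt c"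
  proof (rule real_le_rsqrt)
    have abs: "integrable M (\<lambda>w. \<bar>U w - V w\<bar>)" "integrable M (\<lambda>w. \<bar>U w - V w\<bar>\<^sup>2)"
      using UV sq by auto
    have "0 \<le> (\<integral>w. \<bar>U w - V w\<bar>\<^sup>2 \<partial>M) - (\<integral>w. \<bar>U w - V w\<bar> \<partial>M)\<^sup>2"
      unfolding variance_eq[OF abs, symmetric] by (rule variance_positive)
    then show "(\<integral>w. \<bar>U w - V w\<bar> \<partial>M)\<^sup>2 \<le> c" using c by simp
  qed
  finally show "ereal \<bar>(\<integral>x. f x \<partial>distr M borel U) - (\<integral>x. f x \<partial>distr M borel V)\<bar> \<le> ereal (sqrt c)"
    by simp
qed

text \<open>The centre \<open>m\<close> is arbitrary because the variance is the smallest second moment.\<close>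

lemma chi_bar_difference_bounds:
  fixes P Q :: "'w \<Rightarrow> (real^'d) set" and c m :: real
  assumes M: "prob_space M" and n: "1 \<le> n"
    and P: "square_integrable M (chi K n P t)" and Q: "square_integrable M (chi K n Q t)"
    and c: "(\<integral>w. (chi K n P t w - chi K n Q t w - m)\<^sup>2 \<partial>M) \<le> c * n"
  shows "prob_space.variance M (\<lambda>w. chi_bar M K n P t w - chi_bar M K n Q t w) \<le> c"
    and "wasserstein (distr M borel (chi_bar M K n P t)) (distr M borel (chi_bar M K n Q t)) \<le> ereal (sqrt c)"
proof -
  interpret prob_space M by fact
  define U where "U = chi K n P t"
  define V where "V = chi K n Q t"
  define a where "a = real n powr (- 1 / 2)"
  have meas[measurable]: "U \<in> borel_measurable M" "V \<in> borel_measurable M"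
    using P Q by (auto simp: square_integrable_def U_def V_def)
  have sq: "integrable M (\<lambda>w. (U w)\<^sup>2)" "integrable M (\<lambda>w. (V w)\<^sup>2)"
    using P Q by (auto simp: square_integrable_def U_def V_def)
  have int: "integrable M U" "integrable M V"
    by (rule square_integrable_imp_integrable[OF meas(1) sq(1)] square_integrable_imp_integrable[OF meas(2) sq(2)])+
  have sqD: "integrable M (\<lambda>w. (U w - V w)\<^sup>2)"
  proof (rule Bochner_Integration.integrable_bound)
    show "integrable M (\<lambda>w. 2 * (U w)\<^sup>2 + 2 * (V w)\<^sup>2)" using sq by simp
    have "(u - v)\<^sup>2 \<le> 2 * u\<^sup>2 + 2 * v\<^sup>2" for u v :: real
      using zero_le_power2[of "u + v"] by (simp add: power2_diff power2_sum)
    then show "AE w in M. norm ((U w - V w)\<^sup>2) \<le> norm (2 * (U w)\<^sup>2 + 2 * (V w)\<^sup>2)" by simp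
  qed simp
  have "a = inverse (sqrt n)" using n by (simp add: a_def powr_minus powr_half_sqrt)
  then have a2: "a\<^sup>2 = 1 / n" using n by (simp add: power_inverse, simp add: inverse_eq_divide)
  have Pbar: "chi_bar M K n P t = (\<lambda>w. a * (U w - expectation U))"
    and Qbar: "chi_bar M K n Q t = (\<lambda>w. a * (V w - expectation V))"
    by (simp_all add: chi_bar_def a_def U_def V_def fun_eq_iff)
  define D where "D = (\<lambda>w. U w - V w)"
  have intD: "integrable M D" "integrable M (\<lambda>w. (D w)\<^sup>2)" using int sqD by (auto simp: D_def)
  have ED: "expectation D = expectation U - expectation V" using int by (simp add: D_def)
  have bar: "chi_bar M K n P t w - chi_bar M K n Q t w = a * (D w - expectation D)" for w
    unfolding Pbar Qbar ED by (simp add: D_def right_diff_distrib)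
  have var: "expectation (\<lambda>w. (a * (D w - expectation D))\<^sup>2) \<le> c"
  proof -
    have "expectation (\<lambda>w. (D w - expectation D)\<^sup>2) \<le> expectation (\<lambda>w. (D w - m)\<^sup>2)"
      using second_moment_shift[OF M intD, of m] by simp
    also have "\<dots> \<le> c * n" using c by (simp add: D_def U_def V_def)
    finally have "a\<^sup>2 * expectation (\<lambda>w. (D w - expectation D)\<^sup>2) \<le> a\<^sup>2 * (c * n)" by (intro mult_left_mono) auto
    then show ?thesis using n by (simp add: power_mult_distrib a2)
  qed
  have mean0: "expectation (\<lambda>w. a * (D w - expectation D)) = 0" using intD by (simp add: prob_space)
  show "variance (\<lambda>w. chi_bar M K n P t w - chi_bar M K n Q t w) \<le> c"
    unfolding bar mean0 diff_zero by (rule var)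
  show "wasserstein (distr M borel (chi_bar M K n P t)) (distr M borel (chi_bar M K n Q t)) \<le> ereal (sqrt c)"
  proof (rule wasserstein_le_sqrt[OF M])
    show "chi_bar M K n P t \<in> borel_measurable M" "chi_bar M K n Q t \<in> borel_measurable M"
      unfolding Pbar Qbar by measurable
    show "integrable M (chi_bar M K n P t)" "integrable M (chi_bar M K n Q t)"
      unfolding Pbar Qbar using int by simp_all
    have "integrable M (\<lambda>w. (D w)\<^sup>2 - 2 * expectation D * D w + (expectation D)\<^sup>2)" using intD by simp
    then have "integrable M (\<lambda>w. a\<^sup>2 * (D w - expectation D)\<^sup>2)"
      by (simp add: power2_diff mult_ac add_diff_eq diff_add_eq)
    then show "integrable M (\<lambda>w. (chi_bar M K n P t w - chi_bar M K n Q t w)\<^sup>2)"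
      unfolding bar by (simp add: power_mult_distrib)
    show "expectation (\<lambda>w. (chi_bar M K n P t w - chi_bar M K n Q t w)\<^sup>2) \<le> c"
      unfolding bar by (rule var)
  qed
qed

context coupled_functional
begin

lemma \<phi>_mixed_measurable:
  assumes f: "f \<in> borel_measurable J"
  shows "(\<lambda>x. \<phi> ((\<lambda>i. f (snd x i)) ` {1..N (fst x)})) \<in> borel_measurable (mixed_space J p)"
proof (rule measurable_mixed_space)
  fix k
  have "(\<lambda>w. f (w i)) \<in> borel_measurable \<Omega>" for i
    by (rule measurable_compose[OF measurable_component_singleton[of i UNIV "\<lambda>_. J"] f]) simp
  then have "(\<lambda>w. \<phi> ((\<lambda>i. f (w i)) ` {1..N k})) \<in> borel_measurable \<Omega>" by (intro \<phi>_meas) auto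
  then show "(\<lambda>w. \<phi> ((\<lambda>i. f (snd (k, w) i)) ` {1..N (fst (k, w))})) \<in> borel_measurable \<Omega>" by simp
qed

lemma \<phi>_square_integrable:
  assumes f: "f \<in> borel_measurable J"
    and p: "(\<integral>\<^sup>+k. ennreal (4 ^ N k) \<partial>measure_pmf p) < \<infinity>"
  shows "square_integrable (mixed_space J p) (\<lambda>x. \<phi> ((\<lambda>i. f (snd x i)) ` {1..N (fst x)}))"
  unfolding square_integrable_def
proof (intro conjI)
  let ?\<Phi> = "\<lambda>x. \<phi> ((\<lambda>i. f (snd x i)) ` {1..N (fst x)})"
  show meas: "?\<Phi> \<in> borel_measurable (mixed_space J p)" by (rule \<phi>_mixed_measurable[OF f])
  have bound: "(?\<Phi> x)\<^sup>2 \<le> 4 ^ N (fst x)" for x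
  proof -
    have "\<bar>?\<Phi> x\<bar> \<le> 2 ^ card ((\<lambda>i. f (snd x i)) ` {1..N (fst x)})"
      by (rule local_functional_bound[OF \<phi>]) simp
    also have "\<dots> \<le> 2 ^ N (fst x)"
      using card_image_le[of "{1..N (fst x)}" "\<lambda>i. f (snd x i)"] by (intro power_increasing) auto
    finally have "\<bar>?\<Phi> x\<bar>\<^sup>2 \<le> (2 ^ N (fst x))\<^sup>2" by (intro power_mono) auto
    also have "\<dots> = 4 ^ N (fst x)" by (simp add: power2_eq_square flip: power_mult_distrib)
    finally show ?thesis by simp
  qed
  have "(\<integral>\<^sup>+x. ennreal ((?\<Phi> x)\<^sup>2) \<partial>mixed_space J p)
      = (\<integral>\<^sup>+k. \<integral>\<^sup>+w. ennreal ((?\<Phi> (k, w))\<^sup>2) \<partial>\<Omega> \<partial>measure_pmf p)"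
    by (rule nn_integral_mixed_space[OF prob_J]) (use meas in measurable)
  also have "\<dots> \<le> (\<integral>\<^sup>+k. \<integral>\<^sup>+w. ennreal (4 ^ N k) \<partial>\<Omega> \<partial>measure_pmf p)"
    using bound[of "(k, w)" for k w] by (intro nn_integral_mono ennreal_leI) simp
  also have "\<dots> = (\<integral>\<^sup>+k. ennreal (4 ^ N k) \<partial>measure_pmf p)" by (simp add: \<Omega>.emeasure_space_1)
  finally show "integrable (mixed_space J p) (\<lambda>x. (?\<Phi> x)\<^sup>2)"
    using meas p by (intro integrableI_nonneg) auto
qed

text \<open>The number of points used is \<open>N k\<close>, where \<open>k\<close> is the random counter. The identity gives the
  Poisson scheme, and a constant function gives the binomial scheme.\<close>

lemma mixed_second_moment:
  assumes p: "(\<integral>\<^sup>+k. ennreal ((real (N k) + (real (N k) - real n)\<^sup>2) * (q ^ N k + q ^ n)) \<partial>measure_pmf p)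
      \<le> ennreal m" and m: "0 \<le> m"
  shows "(\<integral>x. (\<phi> ((\<lambda>i. fst (snd x i)) ` {1..N (fst x)}) - \<phi> ((\<lambda>i. snd (snd x i)) ` {1..N (fst x)}) - mean n)\<^sup>2
      \<partial>mixed_space J p) \<le> 4 * e * m"
proof (rule integral_real_bounded)
  let ?D = "\<lambda>x. \<phi> ((\<lambda>i. fst (snd x i)) ` {1..N (fst x)}) - \<phi> ((\<lambda>i. snd (snd x i)) ` {1..N (fst x)}) - mean n"
  have "fst \<in> borel_measurable J" "snd \<in> borel_measurable J"
    unfolding measurable_cong_sets[OF sets_J refl] by simp_all
  then have meas: "?D \<in> borel_measurable (mixed_space J p)"
    by (intro borel_measurable_diff borel_measurable_const \<phi>_mixed_measurable)
  have inner: "(\<integral>\<^sup>+w. ennreal ((?D (k, w))\<^sup>2) \<partial>\<Omega>)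
      \<le> ennreal (4 * e) * ennreal ((real (N k) + (real (N k) - real n)\<^sup>2) * (q ^ N k + q ^ n))" for k
  proof -
    have "bounded_measurable \<Omega> (\<lambda>w. (F {1..N k} w - mean n)\<^sup>2)"
      by (intro bounded_measurable_power2 bounded_measurable_diff F_bm_\<Omega> bounded_measurable_const) simp
    then have int: "integrable \<Omega> (\<lambda>w. (F {1..N k} w - mean n)\<^sup>2)"
      by (rule bounded_measurable_integrable[OF \<Omega>.finite_measure_axioms])
    have "(\<integral>\<^sup>+w. ennreal ((?D (k, w))\<^sup>2) \<partial>\<Omega>) = (\<integral>\<^sup>+w. ennreal ((F {1..N k} w - mean n)\<^sup>2) \<partial>\<Omega>)"
      by (simp add: F_def)
    also have "\<dots> = ennreal (\<integral>w. (F {1..N k} w - mean n)\<^sup>2 \<partial>\<Omega>)"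
      by (rule nn_integral_eq_integral[OF int]) simp
    also have "\<dots> \<le> ennreal (4 * e * ((real (N k) + (real (N k) - real n)\<^sup>2) * (q ^ N k + q ^ n)))"
      by (rule ennreal_leI[OF F_second_moment])
    also have "\<dots> = ennreal (4 * e) * ennreal ((real (N k) + (real (N k) - real n)\<^sup>2) * (q ^ N k + q ^ n))"
      by (rule ennreal_mult') (use e0 in simp)
    finally show ?thesis .
  qed
  have "(\<integral>\<^sup>+x. ennreal ((?D x)\<^sup>2) \<partial>mixed_space J p)
      = (\<integral>\<^sup>+k. \<integral>\<^sup>+w. ennreal ((?D (k, w))\<^sup>2) \<partial>\<Omega> \<partial>measure_pmf p)"
    by (rule nn_integral_mixed_space[OF prob_J]) (use meas in measurable)
  also have "\<dots> \<le> (\<integral>\<^sup>+k. ennreal (4 * e) * ennreal ((real (N k) + (real (N k) - real n)\<^sup>2) * (q ^ N k + q ^ n))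
      \<partial>measure_pmf p)"
    by (rule nn_integral_mono[OF inner])
  also have "\<dots> = ennreal (4 * e)
      * (\<integral>\<^sup>+k. ennreal ((real (N k) + (real (N k) - real n)\<^sup>2) * (q ^ N k + q ^ n)) \<partial>measure_pmf p)"
    by (rule nn_integral_cmult) simp
  also have "\<dots> \<le> ennreal (4 * e) * ennreal m" by (rule mult_left_mono[OF p]) simp
  also have "\<dots> = ennreal (4 * e * m)" using e0 m by (simp only: ennreal_mult mult_nonneg_nonneg zero_le_numeral)
  finally show "(\<integral>\<^sup>+x. ennreal ((?D x)\<^sup>2) \<partial>mixed_space J p) \<le> ennreal (4 * e * m)" .
  show "0 \<le> 4 * e * m" using e0 m by simp
qed

end

lemma coupling_scheme_bounds:
  fixes K :: "real \<Rightarrow> (real^'d) set \<Rightarrow> (real^'d) set set"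
    and J :: "((real^'d) \<times> (real^'d)) measure"
  assumes K: "cech_or_rips K" and t: "t \<in> {0..T}" and n: "1 \<le> n"
    and r: "r = 2 * T / real n powr (1 / real CARD('d))"
    and J: "prob_space J" "sets J = sets (borel \<Otimes>\<^sub>M borel)" and b: "0 \<le> b" and e: "0 \<le> e"
    and near: "\<And>z. emeasure J {p. fst p \<in> cball z r \<or> snd p \<in> cball z r} \<le> ennreal b"
    and near_bad: "\<And>z. emeasure J {p. fst p \<noteq> snd p \<and> (fst p \<in> cball z r \<or> snd p \<in> cball z r)}
        \<le> ennreal (e * b)"
    and bad: "emeasure J {p. fst p \<noteq> snd p} \<le> ennreal e"
    and fin: "(\<integral>\<^sup>+k. ennreal (4 ^ N k) \<partial>measure_pmf p) < \<infinity>"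
    and mom: "(\<integral>\<^sup>+k. ennreal ((real (N k) + (real (N k) - real n)\<^sup>2)
        * (((1 + 4 * b)\<^sup>2) ^ N k + ((1 + 4 * b)\<^sup>2) ^ n)) \<partial>measure_pmf p) \<le> ennreal (m * n)"
    and m: "0 \<le> m"
  defines "P \<equiv> \<lambda>x. (\<lambda>i. fst (snd x i)) ` {1..N (fst x)}"
    and "Q \<equiv> \<lambda>x. (\<lambda>i. snd (snd x i)) ` {1..N (fst x)}"
    and "M \<equiv> mixed_space J p"
  shows "square_integrable M (chi K n P t) \<and> square_integrable M (chi K n Q t)"
    and "prob_space.variance M (\<lambda>x. chi_bar M K n P t x - chi_bar M K n Q t x) \<le> 4 * m * e"
    and "wasserstein (distr M borel (chi_bar M K n P t)) (distr M borel (chi_bar M K n Q t))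
      \<le> ereal (sqrt (4 * m * e))"
proof -
  define \<phi> where "\<phi> = (\<lambda>S. real_of_int (euler_char (K t (rescale n S))))"
  interpret C: coupled_functional J \<phi> r b e
  proof (rule coupled_functional.intro)
    show "local_functional r \<phi>"
      unfolding \<phi>_def r by (rule local_functional_euler_char[OF K]) (use t n in auto)
    show "(\<lambda>w. \<phi> ((\<lambda>i. f i w) ` I)) \<in> borel_measurable M"
      if "finite I" "\<And>i. i \<in> I \<Longrightarrow> f i \<in> borel_measurable M"
      for I and f :: "nat \<Rightarrow> (nat \<Rightarrow> (real^'d) \<times> (real^'d)) \<Rightarrow> real^'d" and M
      unfolding \<phi>_def by (rule measurable_euler_char[OF K that])
  qed (rule J b e near near_bad bad)+
  have fs: "fst \<in> borel_measurable J" "snd \<in> borel_measurable J"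
    unfolding measurable_cong_sets[OF J(2) refl] by simp_all
  have chi: "chi K n P t = (\<lambda>x. \<phi> ((\<lambda>i. fst (snd x i)) ` {1..N (fst x)}))"
    "chi K n Q t = (\<lambda>x. \<phi> ((\<lambda>i. snd (snd x i)) ` {1..N (fst x)}))"
    by (simp_all add: chi_def[abs_def] \<phi>_def P_def Q_def)
  have P: "square_integrable M (chi K n P t)"
    unfolding chi M_def by (rule C.\<phi>_square_integrable[OF fs(1) fin])
  have Q: "square_integrable M (chi K n Q t)"
    unfolding chi M_def by (rule C.\<phi>_square_integrable[OF fs(2) fin])
  show "square_integrable M (chi K n P t) \<and> square_integrable M (chi K n Q t)" using P Q ..
  have "(\<integral>x. (chi K n P t x - chi K n Q t x - C.mean n)\<^sup>2 \<partial>M) \<le> 4 * e * (m * n)"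
    unfolding chi M_def by (rule C.mixed_second_moment) (use mom m in \<open>simp_all add: C.q_def\<close>)
  also have "4 * e * (m * n) = 4 * m * e * n" by simp
  finally have c: "(\<integral>x. (chi K n P t x - chi K n Q t x - C.mean n)\<^sup>2 \<partial>M) \<le> 4 * m * e * n" .
  have M: "prob_space M" unfolding M_def by (rule prob_space_mixed_space[OF J(1)])
  show "prob_space.variance M (\<lambda>x. chi_bar M K n P t x - chi_bar M K n Q t x) \<le> 4 * m * e"
    and "wasserstein (distr M borel (chi_bar M K n P t)) (distr M borel (chi_bar M K n Q t))
      \<le> ereal (sqrt (4 * m * e))"
    by (rule chi_bar_difference_bounds[OF M n P Q c])+
qed

theorem theorem3p1:
  fixes K :: "real \<Rightarrow> (real^'d) set \<Rightarrow> (real^'d) set set"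
    and \<kappa> :: "real^'d \<Rightarrow> real" and \<rho> T :: real
  assumes "K = cech_complex \<or> K = rips_complex"
    and "0 < T" and "0 < \<rho>"
    and "\<kappa> \<in> cube_densities" and "bounded (\<kappa> ` unit_cube)"
  shows "\<exists>C>0. \<forall>\<nu>\<in>density_ball \<kappa> \<rho>. \<forall>n\<ge>1.
    (\<exists>(M :: 'd sample measure) P Q.
       poisson_process M (\<lambda>x. real n * \<kappa> x) P \<and>
       poisson_process M (\<lambda>x. real n * \<nu> x) Q \<and>
       (\<forall>t\<in>{0..T}. square_integrable M (chi K n P t) \<and> square_integrable M (chi K n Q t)) \<and>
       (SUP t\<in>{0..T}. ereal (prob_space.variance M
            (\<lambda>\<omega>. chi_bar M K n P t \<omega> - chi_bar M K n Q t \<omega>)))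
         \<le> ereal (C * sup_norm (\<lambda>x. \<kappa> x - \<nu> x)) \<and>
       (SUP t\<in>{0..T}. wasserstein (distr M borel (chi_bar M K n P t))
            (distr M borel (chi_bar M K n Q t)))
         \<le> ereal (sqrt C * sqrt (sup_norm (\<lambda>x. \<kappa> x - \<nu> x)))) \<and>
    (\<exists>(M :: 'd sample measure) X Y.
       iid_sample M n \<kappa> X \<and> iid_sample M n \<nu> Y \<and>
       (\<forall>t\<in>{0..T}. square_integrable M (chi K n (point_set n X) t) \<and>
                   square_integrable M (chi K n (point_set n Y) t)) \<and>
       (SUP t\<in>{0..T}. ereal (prob_space.variance M
            (\<lambda>\<omega>. chi_bar M K n (point_set n X) t \<omega> - chi_bar M K n (point_set n Y) t \<omega>)))
         \<le> ereal (C * sup_norm (\<lambda>x. \<kappa> x - \<nu> x)) \<and>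
       (SUP t\<in>{0..T}. wasserstein (distr M borel (chi_bar M K n (point_set n X) t))
            (distr M borel (chi_bar M K n (point_set n Y) t)))
         \<le> ereal (sqrt C * sqrt (sup_norm (\<lambda>x. \<kappa> x - \<nu> x))))"
proof -
  have K: "cech_or_rips K" using assms(1) by (simp add: cech_or_rips_def)
  note \<kappa> = assms(4)
  obtain A0 where A0: "\<And>x. x \<in> unit_cube \<Longrightarrow> \<bar>\<kappa> x\<bar> \<le> A0"
    using assms(5) by (auto simp: bounded_iff)
  \<comment> \<open>The maximum with \<open>0\<close> takes care of the points outside the cube.\<close>
  define A where "A = max A0 0"
  have A_nonneg: "0 \<le> A" by (simp add: A_def)
  have A: "\<kappa> x \<le> A" for x
  proof (cases "x \<in> unit_cube")
    case True
    from A0[OF this] show ?thesis by (simp add: A_def)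
  next
    case False
    then have "\<kappa> x = 0" using \<kappa> by (simp add: cube_densities_def)
    then show ?thesis by (simp add: A_def)
  qed
  \<comment> \<open>\<open>V / n\<close> is the volume of a ball of the interaction radius in the unscaled picture.\<close>
  define V where "V = unit_ball_vol (real CARD('d)) * (2 * T) ^ CARD('d)"
  have V: "0 \<le> V" using assms(2) by (simp add: V_def)
  define B where "B = 2 * V * (A + \<rho> + 1)"
  have B: "0 \<le> B" using V A_nonneg assms(3) by (simp add: B_def)
  \<comment> \<open>The coefficients come from expanding \<open>(1 + 4 * (B / n))\<^sup>2\<close> and using that \<open>n\<close> is at least \<open>1\<close>.\<close>
  define c where "c = 8 * B + 16 * B\<^sup>2"
  have c: "0 \<le> c" using B by (simp add: c_def)
  define m where "m = moment_constant c"
  have m: "0 < m" unfolding m_def by (rule moment_constant_pos[OF c])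
  show ?thesis
  proof (intro exI[of _ "4 * m"] conjI ballI allI impI)
    show "0 < 4 * m" using m by simp
  next
    fix \<nu> and n :: nat assume \<nu>: "\<nu> \<in> density_ball \<kappa> \<rho>" and n: "1 \<le> n"
    let ?\<delta> = "sup_norm (\<lambda>x. \<kappa> x - \<nu> x)"
    have nonneg_sup: "0 \<le> ?\<delta>" by (rule abs_diff_le_sup_norm(2)[OF \<kappa> \<nu>])
    have sqrt: "sqrt (4 * m * ?\<delta>) = sqrt (4 * m) * sqrt ?\<delta>" by (rule real_sqrt_mult)
    obtain J :: "((real^'d) \<times> (real^'d)) measure" where J: "prob_space J" "sets J = sets (borel \<Otimes>\<^sub>M borel)"
      "distr J lborel fst = density lborel (\<lambda>x. ennreal (\<kappa> x))"
      "distr J lborel snd = density lborel (\<lambda>x. ennreal (\<nu> x))"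
      "emeasure J {p. fst p \<noteq> snd p} \<le> ennreal ?\<delta>"
      and near: "\<And>B v. B \<in> sets borel \<Longrightarrow> emeasure lborel B = ennreal v \<Longrightarrow> 0 \<le> v \<Longrightarrow>
        emeasure J {p. fst p \<in> B \<or> snd p \<in> B} \<le> ennreal (2 * v * (A + \<rho> + 1))"
      and near_bad: "\<And>B v. B \<in> sets borel \<Longrightarrow> emeasure lborel B = ennreal v \<Longrightarrow> 0 \<le> v \<Longrightarrow>
        emeasure J {p. fst p \<noteq> snd p \<and> (fst p \<in> B \<or> snd p \<in> B)} \<le> ennreal (?\<delta> * (2 * v * (A + \<rho> + 1)))"
      using density_ball_coupling[OF \<kappa> \<nu> A less_imp_le[OF assms(3)]] by blast
    define r where "r = 2 * T / real n powr (1 / real CARD('d))"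
    define b where "b = B / n"
    have b: "0 \<le> b" using B by (simp add: b_def)
    have vol: "emeasure lborel (cball z r) = ennreal (V / n)" for z :: "real^'d"
    proof -
      have "(real n powr (1 / real CARD('d))) ^ CARD('d) = n"
        using n by (simp add: powr_powr flip: powr_realpow)
      then have rd: "r ^ CARD('d) = (2 * T) ^ CARD('d) / n" by (simp add: r_def power_divide)
      have r0: "0 \<le> r" using assms(2) by (simp add: r_def)
      have dim: "DIM(real^'d) = CARD('d)" by simp
      show ?thesis unfolding emeasure_cball[OF r0] dim rd V_def times_divide_eq_right ..
    qed
    have V': "0 \<le> V / n" using V by simp
    have b_eq: "2 * (V / n) * (A + \<rho> + 1) = b" by (simp add: b_def B_def)
    have near': "emeasure J {p. fst p \<in> cball z r \<or> snd p \<in> cball z r} \<le> ennreal b" for z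
      using near[OF _ vol V', of z] unfolding b_eq by simp
    have near_bad': "emeasure J {p. fst p \<noteq> snd p \<and> (fst p \<in> cball z r \<or> snd p \<in> cball z r)}
        \<le> ennreal (?\<delta> * b)" for z
      using near_bad[OF _ vol V', of z] unfolding b_eq by simp
    have q: "1 \<le> (1 + 4 * b)\<^sup>2" "(1 + 4 * b)\<^sup>2 \<le> 1 + c / n"
    proof -
      show "1 \<le> (1 + 4 * b)\<^sup>2" using b by simp
      have "b\<^sup>2 = B\<^sup>2 / (real n * real n)" by (simp add: b_def power_divide power2_eq_square)
      also have "\<dots> \<le> B\<^sup>2 / n" using n by (intro divide_left_mono) auto
      finally have b2: "b\<^sup>2 \<le> B\<^sup>2 / n" .
      have "(1 + 4 * b)\<^sup>2 = 1 + 8 * b + 16 * b\<^sup>2" by (simp add: power2_sum power_mult_distrib)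
      also have "\<dots> \<le> 1 + 8 * (B / n) + 16 * (B\<^sup>2 / n)" using b2 by (simp add: b_def)
      also have "\<dots> = 1 + c / n" by (simp add: c_def add_divide_distrib)
      finally show "(1 + 4 * b)\<^sup>2 \<le> 1 + c / n" .
    qed
    have fst_meas: "fst \<in> borel_measurable J" and snd_meas: "snd \<in> borel_measurable J"
      unfolding measurable_cong_sets[OF J(2) refl] by simp_all
    have no_atoms: "measure J {p\<in>space J. f p = x} = 0"
      if f: "f \<in> borel_measurable J" "distr J lborel f = density lborel (\<lambda>x. ennreal (g x))"
        and g: "g \<in> borel_measurable borel" for f :: "_ \<Rightarrow> real^'d" and g x
    proof -
      have "emeasure J {p\<in>space J. f p = x} = emeasure (distr J lborel f) {x}"
        using f(1) by (subst emeasure_distr) (auto intro!: arg_cong[where f = "emeasure J"])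
      also have "\<dots> = (\<integral>\<^sup>+y. ennreal (g y) * indicator {x} y \<partial>lborel)"
        unfolding f(2) using g by (intro emeasure_density) auto
      also have "\<dots> = 0"
      proof (subst nn_integral_0_iff_AE)
        show "AE y in lborel. ennreal (g y) * indicator {x} y = 0"
          using AE_lborel_singleton[of x] by eventually_elim (simp add: indicator_def)
      qed (use g in simp)
      finally show ?thesis by (simp add: measure_def)
    qed
    have meas: "\<kappa> \<in> borel_measurable borel" "\<nu> \<in> borel_measurable borel"
      and nonneg: "\<And>x. 0 \<le> \<kappa> x" "\<And>x. 0 \<le> \<nu> x"
      using \<kappa> \<nu> by (auto simp: cube_densities_def density_ball_def)
    interpret X: iid_points J fst
      using J(1) fst_meas no_atoms[OF fst_meas J(3) meas(1)] by (simp add: iid_points_def iid_points_axioms_def)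
    interpret Y: iid_points J snd
      using J(1) snd_meas no_atoms[OF snd_meas J(4) meas(2)] by (simp add: iid_points_def iid_points_axioms_def)
    note bounds = coupling_scheme_bounds[OF K _ n r_def J(1,2) b nonneg_sup near' near_bad' J(5) _ _ less_imp_le[OF m]]
    have sup: "(SUP t\<in>{0..T}. ereal (f t)) \<le> ereal x" if "\<And>t. t \<in> {0..T} \<Longrightarrow> f t \<le> x" for f x
      using that by (intro SUP_least) simp
    show "\<exists>(M :: 'd sample measure) P Q.
       poisson_process M (\<lambda>x. real n * \<kappa> x) P \<and>
       poisson_process M (\<lambda>x. real n * \<nu> x) Q \<and>
       (\<forall>t\<in>{0..T}. square_integrable M (chi K n P t) \<and> square_integrable M (chi K n Q t)) \<and>
       (SUP t\<in>{0..T}. ereal (prob_space.variance M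
            (\<lambda>\<omega>. chi_bar M K n P t \<omega> - chi_bar M K n Q t \<omega>)))
         \<le> ereal (4 * m * ?\<delta>) \<and>
       (SUP t\<in>{0..T}. wasserstein (distr M borel (chi_bar M K n P t))
            (distr M borel (chi_bar M K n Q t)))
         \<le> ereal (sqrt (4 * m) * sqrt ?\<delta>)"
    proof (intro exI conjI)
      let ?p = "poisson_pmf (real n)"
      have n0: "0 < real n" using n by simp
      show "poisson_process (mixed_space J ?p) (\<lambda>x. real n * \<kappa> x) X.points"
        by (rule X.poisson_process_points[OF n0 meas(1) nonneg(1) J(3)])
      show "poisson_process (mixed_space J ?p) (\<lambda>x. real n * \<nu> x) Y.points"
        by (rule Y.poisson_process_points[OF n0 meas(2) nonneg(2) J(4)])
      note bnd = bounds[OF _ nn_integral_poisson_power_finite[OF n0] poisson_moment_bound[OF q n c, folded m_def],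
          folded X.points_def Y.points_def]
      show "\<forall>t\<in>{0..T}. square_integrable (mixed_space J ?p) (chi K n X.points t)
          \<and> square_integrable (mixed_space J ?p) (chi K n Y.points t)"
        using bnd(1) by blast
      show "(SUP t\<in>{0..T}. ereal (prob_space.variance (mixed_space J ?p)
            (\<lambda>\<omega>. chi_bar (mixed_space J ?p) K n X.points t \<omega> - chi_bar (mixed_space J ?p) K n Y.points t \<omega>)))
         \<le> ereal (4 * m * ?\<delta>)"
        by (rule sup[OF bnd(2)])
      show "(SUP t\<in>{0..T}. wasserstein (distr (mixed_space J ?p) borel (chi_bar (mixed_space J ?p) K n X.points t))
            (distr (mixed_space J ?p) borel (chi_bar (mixed_space J ?p) K n Y.points t)))
         \<le> ereal (sqrt (4 * m) * sqrt ?\<delta>)"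
        unfolding sqrt[symmetric] by (rule SUP_least[OF bnd(3)])
    qed
    show "\<exists>(M :: 'd sample measure) X Y.
       iid_sample M n \<kappa> X \<and> iid_sample M n \<nu> Y \<and>
       (\<forall>t\<in>{0..T}. square_integrable M (chi K n (point_set n X) t) \<and>
                   square_integrable M (chi K n (point_set n Y) t)) \<and>
       (SUP t\<in>{0..T}. ereal (prob_space.variance M
            (\<lambda>\<omega>. chi_bar M K n (point_set n X) t \<omega> - chi_bar M K n (point_set n Y) t \<omega>)))
         \<le> ereal (4 * m * ?\<delta>) \<and>
       (SUP t\<in>{0..T}. wasserstein (distr M borel (chi_bar M K n (point_set n X) t))
            (distr M borel (chi_bar M K n (point_set n Y) t)))
         \<le> ereal (sqrt (4 * m) * sqrt ?\<delta>)"
    proof (intro exI conjI)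
      let ?M = "mixed_space J (return_pmf n)"
      let ?X = "\<lambda>i x. fst (snd x i) :: real^'d" and ?Y = "\<lambda>i x. snd (snd x i) :: real^'d"
      show "iid_sample ?M n \<kappa> ?X" by (rule X.iid_sample_coordinates[OF meas(1) J(3)])
      show "iid_sample ?M n \<nu> ?Y" by (rule Y.iid_sample_coordinates[OF meas(2) J(4)])
      have points: "(\<lambda>x. (\<lambda>i. fst (snd x i)) ` {1..n}) = point_set n ?X"
        "(\<lambda>x. (\<lambda>i. snd (snd x i)) ` {1..n}) = point_set n ?Y" by (simp_all add: fun_eq_iff point_set_def)
      have mom: "(\<integral>\<^sup>+k. ennreal ((real n + (real n - real n)\<^sup>2)
          * (((1 + 4 * b)\<^sup>2) ^ n + ((1 + 4 * b)\<^sup>2) ^ n)) \<partial>measure_pmf (return_pmf n)) \<le> ennreal (m * n)"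
        using ennreal_leI[OF binomial_moment_bound[OF q n c]] by (simp add: m_def)
      have fin: "(\<integral>\<^sup>+k. ennreal (4 ^ n) \<partial>measure_pmf (return_pmf n)) < \<infinity>" by simp
      note bnd = bounds[where N = "\<lambda>_. n", OF _ fin mom, unfolded points]
      show "\<forall>t\<in>{0..T}. square_integrable ?M (chi K n (point_set n ?X) t)
          \<and> square_integrable ?M (chi K n (point_set n ?Y) t)"
        using bnd(1) by blast
      show "(SUP t\<in>{0..T}. ereal (prob_space.variance ?M
            (\<lambda>\<omega>. chi_bar ?M K n (point_set n ?X) t \<omega> - chi_bar ?M K n (point_set n ?Y) t \<omega>)))
         \<le> ereal (4 * m * ?\<delta>)"
        by (rule sup[OF bnd(2)])
      show "(SUP t\<in>{0..T}. wasserstein (distr ?M borel (chi_bar ?M K n (point_set n ?X) t))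
            (distr ?M borel (chi_bar ?M K n (point_set n ?Y) t)))
         \<le> ereal (sqrt (4 * m) * sqrt ?\<delta>)"
        unfolding sqrt[symmetric] by (rule SUP_least[OF bnd(3)])
    qed
  qed
qed

end
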